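(* Let $D\subseteq\mathbb{R}^d$ and $\mathcal{H}=L^2(D;\mathbb{R})$. Let $C_-:\mathcal{H}\to\mathcal{H}$ be a symmetric, positive covariance operator whose eigenvalues $\{\lambda_j^2\}_{j\ge1}$ satisfy $\lambda_j^2\asymp j^{-r}$ for some $r>1$, and let $P=C_-^{-1}$. Let $F:\mathbb{R}\to\mathbb{R}$ be continuous with $0\le F\le F_+$ for some constant $F_+\ge0$. For $u\in\mathcal{H}$ let $\Gamma(u)$ be the multiplication operator $(\Gamma(u)v)(x)=F(u(x))v(x)$ and let $C(u)=(P+\Gamma(u))^{-1}$. Let $\{u_n\}_{n\ge0}$ be the Markov chain on $\mathcal{H}$ with $u_{n+1}\mid u_n\sim N(0,C(u_n))$ (equivalently $u_{n+1}=C(u_n)^{1/2}\xi_{n+1}$ with $\{\xi_n\}$ i.i.d. Gaussian white noise), and let $\mathsf{P}^n(u_0,\cdot)$ be its $n$-step transition probability. Then there exists a unique invariant distribution $\pi$, and there exists $\varepsilon>0$ such that for any $u_0\in\mathcal{H}$, $$\|\mathsf{P}^n(u_0,\cdot)-\pi\|_{TV}\le(1-\varepsilon)^n\quad\text{for all }n\in\mathbb{N}.$$ In particular, the chain is ergodic.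
   Context: $\lambda_j^2\asymp j^{-r}$ means there are constants $0<c_1\le c_2$ with $c_1j^{-r}\le\lambda_j^2\le c_2j^{-r}$ for all $j$; in particular $C_-$ is trace-class. $P=C_-^{-1}$ is the densely defined (self-adjoint, positive) precision operator on $\mathcal{H}$. $N(0,C)$ is the centred Gaussian measure on $\mathcal{H}$ with covariance operator $C$. $\mathsf{P}^n(u,A)=\mathbb{P}(u_n\in A\mid u_0=u)$ for Borel $A\subseteq\mathcal{H}$. Total variation distance: $\|\mu-\nu\|_{TV}=\sup_A|\mu(A)-\nu(A)|$ over Borel sets $A$. *)

theory Defs
  imports "HOL-Probability.Probability"
begin

subsection \<open>The space of square-integrable functions modulo null sets\<close>

definition square_integrable :: "('a::euclidean_space \<Rightarrow> real) \<Rightarrow> bool" where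
  "square_integrable f \<longleftrightarrow>
     f \<in> borel_measurable lebesgue \<and> integrable lebesgue (\<lambda>x. (f x)\<^sup>2)"

lemma square_integrable_prod:
  assumes "square_integrable f" "square_integrable g"
  shows "integrable lebesgue (\<lambda>x. f x * g x)"
proof (rule Bochner_Integration.integrable_bound)
  show "integrable lebesgue (\<lambda>x. (f x)\<^sup>2 + (g x)\<^sup>2)"
    using assms by (simp add: square_integrable_def)
  show "(\<lambda>x. f x * g x) \<in> borel_measurable lebesgue"
    using assms unfolding square_integrable_def by (intro borel_measurable_times) auto
  have "\<bar>a * b\<bar> \<le> a\<^sup>2 + b\<^sup>2" for a b :: real
  proof -
    have "0 \<le> (\<bar>a\<bar> - \<bar>b\<bar>)\<^sup>2" by simp
    then have "2 * (\<bar>a\<bar> * \<bar>b\<bar>) \<le> a\<^sup>2 + b\<^sup>2" by (simp add: power2_diff)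
    moreover have "0 \<le> \<bar>a\<bar> * \<bar>b\<bar>" by (intro mult_nonneg_nonneg) auto
    ultimately show ?thesis unfolding abs_mult by linarith
  qed
  then show "AE x in lebesgue. norm (f x * g x) \<le> norm ((f x)\<^sup>2 + (g x)\<^sup>2)"
    by (intro AE_I2) (simp add: abs_of_nonneg)
qed

lemma square_integrable_zero: "square_integrable (\<lambda>x. 0)"
  by (simp add: square_integrable_def)

lemma square_integrable_add:
  assumes "square_integrable f" "square_integrable g"
  shows "square_integrable (\<lambda>x. f x + g x)"
  unfolding square_integrable_def
proof
  show "(\<lambda>x. f x + g x) \<in> borel_measurable lebesgue"
    using assms unfolding square_integrable_def by (intro borel_measurable_add) auto
  show "integrable lebesgue (\<lambda>x. (f x + g x)\<^sup>2)"
    using assms square_integrable_prod[OF assms]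
    by (simp add: square_integrable_def power2_sum mult.assoc)
qed

lemma square_integrable_scale:
  assumes "square_integrable f"
  shows "square_integrable (\<lambda>x. c * f x)"
  unfolding square_integrable_def
proof
  show "(\<lambda>x. c * f x) \<in> borel_measurable lebesgue"
    using assms unfolding square_integrable_def by (intro borel_measurable_times) auto
  show "integrable lebesgue (\<lambda>x. (c * f x)\<^sup>2)"
    using assms by (simp add: square_integrable_def power_mult_distrib)
qed

quotient_type (overloaded) 'a L2 = "'a::euclidean_space \<Rightarrow> real" /
  partial: "\<lambda>f g. square_integrable f \<and> square_integrable g \<and> (AE x in lebesgue. f x = g x)"
  morphisms rep_L2 abs_L2
proof (rule part_equivpI)
  show "\<exists>f::'a \<Rightarrow> real. square_integrable f \<and> square_integrable f \<and> (AE x in lebesgue. f x = f x)"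
    using square_integrable_zero by auto
  show "symp (\<lambda>f (g::'a \<Rightarrow> real). square_integrable f \<and> square_integrable g \<and> (AE x in lebesgue. f x = g x))"
    by (auto intro!: sympI simp: eq_commute)
  show "transp (\<lambda>f (g::'a \<Rightarrow> real). square_integrable f \<and> square_integrable g \<and> (AE x in lebesgue. f x = g x))"
    by (rule transpI) auto
qed

instantiation L2 :: (euclidean_space) real_inner
begin

lift_definition zero_L2 :: "'a L2" is "\<lambda>x. 0"
  by (simp add: square_integrable_zero)

lift_definition plus_L2 :: "'a L2 \<Rightarrow> 'a L2 \<Rightarrow> 'a L2" is "\<lambda>f g x. f x + g x"
  by (auto intro: square_integrable_add)

lift_definition scaleR_L2 :: "real \<Rightarrow> 'a L2 \<Rightarrow> 'a L2" is "\<lambda>c f x. c * f x"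
  by (auto intro: square_integrable_scale)

definition uminus_L2 :: "'a L2 \<Rightarrow> 'a L2" where "uminus_L2 u = (-1) *\<^sub>R u"

definition minus_L2 :: "'a L2 \<Rightarrow> 'a L2 \<Rightarrow> 'a L2" where "minus_L2 u v = u + (- v)"

lift_definition inner_L2 :: "'a L2 \<Rightarrow> 'a L2 \<Rightarrow> real" is
  "\<lambda>f g. \<integral>x. f x * g x \<partial>lebesgue"
proof -
  fix f1 f2 g1 g2 :: "'a \<Rightarrow> real"
  assume "square_integrable f1 \<and> square_integrable f2 \<and> (AE x in lebesgue. f1 x = f2 x)"
    and "square_integrable g1 \<and> square_integrable g2 \<and> (AE x in lebesgue. g1 x = g2 x)"
  then show "(\<integral>x. f1 x * g1 x \<partial>lebesgue) = (\<integral>x. f2 x * g2 x \<partial>lebesgue)"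
    by (intro integral_cong_AE) (auto simp: square_integrable_def)
qed

definition norm_L2 :: "'a L2 \<Rightarrow> real" where "norm_L2 u = sqrt (inner u u)"

definition sgn_L2 :: "'a L2 \<Rightarrow> 'a L2" where "sgn_L2 u = inverse (norm u) *\<^sub>R u"

definition dist_L2 :: "'a L2 \<Rightarrow> 'a L2 \<Rightarrow> real" where "dist_L2 u v = norm (u - v)"

definition uniformity_L2 :: "('a L2 \<times> 'a L2) filter" where
  "uniformity_L2 = (INF e\<in>{0<..}. principal {(u, v). dist u v < e})"

definition open_L2 :: "'a L2 set \<Rightarrow> bool" where
  "open_L2 U \<longleftrightarrow> (\<forall>u\<in>U. eventually (\<lambda>(u', v). u' = u \<longrightarrow> v \<in> U) uniformity)"

instance
proof
  fix u v w :: "'a L2" and a b :: real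
  show "u + v + w = u + (v + w)"
    by transfer (auto intro!: square_integrable_add simp: add.assoc)
  show "u + v = v + u"
    by transfer (auto intro!: square_integrable_add simp: add.commute)
  show "0 + u = u"
    by transfer auto
  show "- u + u = 0"
    unfolding uminus_L2_def
    by transfer (auto simp: square_integrable_zero)
  show "u - v = u + - v"
    by (simp add: minus_L2_def)
  show "a *\<^sub>R (u + v) = a *\<^sub>R u + a *\<^sub>R v"
    by transfer (auto intro!: square_integrable_add square_integrable_scale simp: algebra_simps)
  show "(a + b) *\<^sub>R u = a *\<^sub>R u + b *\<^sub>R u"
    by transfer (auto intro!: square_integrable_add square_integrable_scale simp: distrib_right)
  show "a *\<^sub>R b *\<^sub>R u = (a * b) *\<^sub>R u"
    by transfer (auto intro!: square_integrable_scale simp: mult.assoc)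
  show "1 *\<^sub>R u = u"
    by transfer auto
  show "inner u v = inner v u"
    by transfer (simp add: mult.commute)
  show "inner (u + v) w = inner u w + inner v w"
    by transfer (simp add: distrib_right square_integrable_prod)
  show "inner (a *\<^sub>R u) v = a * inner u v"
    by transfer (simp add: mult.assoc)
  show "0 \<le> inner u u"
    by transfer simp
  show "inner u u = 0 \<longleftrightarrow> u = 0"
  proof transfer
    fix f :: "'a \<Rightarrow> real"
    assume f: "square_integrable f \<and> square_integrable f \<and> (AE x in lebesgue. f x = f x)"
    have "(\<integral>x. f x * f x \<partial>lebesgue) = 0 \<longleftrightarrow> (AE x in lebesgue. f x * f x = 0)"
      using f by (intro integral_nonneg_eq_0_iff_AE) (auto simp: square_integrable_prod)
    then show "((\<integral>x. f x * f x \<partial>lebesgue) = 0) =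
        (square_integrable f \<and> square_integrable (\<lambda>x. 0::real) \<and> (AE x in lebesgue. f x = 0))"
      using f by (simp add: square_integrable_zero)
  qed
  show "norm u = sqrt (inner u u)" by (rule norm_L2_def)
  show "sgn u = inverse (norm u) *\<^sub>R u" by (simp add: sgn_L2_def)
  show "dist u v = norm (u - v)" by (rule dist_L2_def)
  show "(uniformity :: ('a L2 \<times> 'a L2) filter) =
      (INF e\<in>{0<..}. principal {(u, v). dist u v < e})" by (rule uniformity_L2_def)
  fix U :: "'a L2 set"
  show "open U \<longleftrightarrow> (\<forall>u\<in>U. eventually (\<lambda>(u', v). u' = u \<longrightarrow> v \<in> U) uniformity)"
    by (rule open_L2_def)
qed

end

text \<open>\<open>L\<^sup>2(D)\<close> is identified, by extension with \<open>0\<close>, with the closed subspace of those elements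
  of \<open>L\<^sup>2(\<real>\<^sup>d)\<close> that vanish almost everywhere outside \<open>D\<close>; the subspace inner product is then
  integration of \<open>u v\<close> over \<open>D\<close>.\<close>

definition L2_on :: "'a::euclidean_space set \<Rightarrow> 'a L2 set" where
  "L2_on D = {u. AE x in lebesgue. x \<notin> D \<longrightarrow> rep_L2 u x = 0}"

text \<open>For bounded continuous \<open>F\<close> the product below is square-integrable and its class does not
  depend on the representatives chosen by \<^const>\<open>rep_L2\<close>.\<close>

definition mult_op :: "(real \<Rightarrow> real) \<Rightarrow> 'a::euclidean_space L2 \<Rightarrow> 'a L2 \<Rightarrow> 'a L2" where
  "mult_op F u v = abs_L2 (\<lambda>x. F (rep_L2 u x) * rep_L2 v x)"

subsection \<open>Operators on a subspace \<open>H\<close>\<close>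

definition symmetric_positive_operator :: "'h::real_inner set \<Rightarrow> ('h \<Rightarrow> 'h) \<Rightarrow> bool" where
  "symmetric_positive_operator H C \<longleftrightarrow>
     C ` H \<subseteq> H \<and>
     (\<forall>u\<in>H. \<forall>v\<in>H. C (u + v) = C u + C v) \<and>
     (\<forall>u\<in>H. \<forall>a. C (a *\<^sub>R u) = a *\<^sub>R C u) \<and>
     (\<exists>K. \<forall>u\<in>H. norm (C u) \<le> K * norm u) \<and>
     (\<forall>u\<in>H. \<forall>v\<in>H. inner (C u) v = inner u (C v)) \<and>
     (\<forall>u\<in>H. 0 \<le> inner (C u) u)"

text \<open>\<open>\<mu>\<^sub>1, \<mu>\<^sub>2, \<dots>\<close> are the eigenvalues of \<open>C\<close>, repeated according to multiplicity: they belong to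
  a complete orthonormal system of eigenvectors. The index \<open>0\<close> is not used.\<close>

definition has_eigenvalues :: "'h::real_inner set \<Rightarrow> ('h \<Rightarrow> 'h) \<Rightarrow> (nat \<Rightarrow> real) \<Rightarrow> bool" where
  "has_eigenvalues H C \<mu> \<longleftrightarrow>
     (\<exists>e. (\<forall>j\<ge>1. e j \<in> H \<and> C (e j) = \<mu> j *\<^sub>R e j) \<and>
          (\<forall>i\<ge>1. \<forall>j\<ge>1. inner (e i) (e j) = (if i = j then 1 else 0)) \<and>
          H = closure (span (e ` {1..})))"

definition comparable :: "(nat \<Rightarrow> real) \<Rightarrow> (nat \<Rightarrow> real) \<Rightarrow> bool" where
  "comparable a b \<longleftrightarrow>
     (\<exists>c\<^sub>1 c\<^sub>2. 0 < c\<^sub>1 \<and> c\<^sub>1 \<le> c\<^sub>2 \<and> (\<forall>j\<ge>1. c\<^sub>1 * b j \<le> a j \<and> a j \<le> c\<^sub>2 * b j))"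

text \<open>For injective \<open>C\<close>, the precision operator \<open>P = C\<inverse>\<close> has the dense domain \<open>C ` H\<close>.\<close>

definition precision :: "'h set \<Rightarrow> ('h \<Rightarrow> 'h) \<Rightarrow> 'h \<Rightarrow> 'h" where
  "precision H C = inv_into H C"

text \<open>\<open>(P + \<Gamma>)\<inverse>\<close>, where \<open>P + \<Gamma>\<close> has the domain \<open>C ` H\<close> of \<open>P\<close>.\<close>

definition perturbed_covariance :: "'h::plus set \<Rightarrow> ('h \<Rightarrow> 'h) \<Rightarrow> ('h \<Rightarrow> 'h) \<Rightarrow> 'h \<Rightarrow> 'h" where
  "perturbed_covariance H C \<Gamma> = inv_into (C ` H) (\<lambda>v. precision H C v + \<Gamma> v)"

subsection \<open>Gaussian measures\<close>

abbreviation borel_on :: "'h::topological_space set \<Rightarrow> 'h measure" where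
  "borel_on H \<equiv> restrict_space borel H"

text \<open>The case \<open>\<sigma> = 0\<close> is separate because \<^const>\<open>normal_density\<close> is identically \<open>0\<close> there.\<close>

definition centred_normal :: "real \<Rightarrow> real measure" where
  "centred_normal \<sigma> =
     (if \<sigma> = 0 then return borel 0 else density lborel (\<lambda>x. ennreal (normal_density 0 \<sigma> x)))"

definition is_centred_gaussian :: "'h::real_inner set \<Rightarrow> ('h \<Rightarrow> 'h) \<Rightarrow> 'h measure \<Rightarrow> bool" where
  "is_centred_gaussian H C m \<longleftrightarrow>
     prob_space m \<and> sets m = sets (borel_on H) \<and>
     (\<forall>a\<in>H. \<exists>\<sigma>\<ge>0. distr m borel (inner a) = centred_normal \<sigma>) \<and>
     (\<forall>a\<in>H. \<forall>b\<in>H. (\<integral>x. inner a x * inner b x \<partial>m) = inner (C a) b)"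

definition gaussian :: "'h::real_inner set \<Rightarrow> ('h \<Rightarrow> 'h) \<Rightarrow> 'h measure" where
  "gaussian H C = (THE m. is_centred_gaussian H C m)"

subsection \<open>Markov chains\<close>

definition transition_kernel ::
    "'a::euclidean_space set \<Rightarrow> ('a L2 \<Rightarrow> 'a L2) \<Rightarrow> (real \<Rightarrow> real) \<Rightarrow> 'a L2 \<Rightarrow> 'a L2 measure" where
  "transition_kernel D C F u =
     gaussian (L2_on D) (perturbed_covariance (L2_on D) C (mult_op F u))"

text \<open>The \<open>n\<close>-step transition probability of the chain on \<open>S\<close> with one-step kernel \<open>K\<close>.\<close>

primrec n_step :: "'h measure \<Rightarrow> ('h \<Rightarrow> 'h measure) \<Rightarrow> nat \<Rightarrow> 'h \<Rightarrow> 'h measure" where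
  "n_step S K 0 u = return S u"
| "n_step S K (Suc n) u = n_step S K n u \<bind> K"

definition invariant_distribution :: "'h measure \<Rightarrow> ('h \<Rightarrow> 'h measure) \<Rightarrow> 'h measure \<Rightarrow> bool" where
  "invariant_distribution S K \<pi> \<longleftrightarrow> prob_space \<pi> \<and> sets \<pi> = sets S \<and> \<pi> \<bind> K = \<pi>"

definition tv_dist :: "'h measure \<Rightarrow> 'h measure \<Rightarrow> real" where
  "tv_dist \<mu> \<nu> = (SUP A\<in>sets \<mu>. \<bar>measure \<mu> A - measure \<nu> A\<bar>)"

text \<open>Ergodicity: convergence in total variation to the invariant distribution from every
  starting point, and triviality of the invariant sets of the stationary chain.\<close>

definition ergodic_chain :: "'h measure \<Rightarrow> ('h \<Rightarrow> 'h measure) \<Rightarrow> 'h measure \<Rightarrow> bool" where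
  "ergodic_chain S K \<pi> \<longleftrightarrow>
     invariant_distribution S K \<pi> \<and>
     (\<forall>u\<in>space S. (\<lambda>n. tv_dist (n_step S K n u) \<pi>) \<longlonglongrightarrow> 0) \<and>
     (\<forall>A\<in>sets S. (AE u in \<pi>. u \<in> A \<longrightarrow> measure (K u) A = 1) \<longrightarrow>
        measure \<pi> A = 0 \<or> measure \<pi> A = 1)"

end

(*
  With gamma = N(0,C) and Q_u(v) = <Gamma(u) v, v>,
  the measure N(0,C(u)) has density exp(-Q_u/2) / Z(u) with respect to gamma: the Cameron-Martin formula for
  gamma along h = C w turns into the formula for the tilted measure along h with w replaced by
  a = w + Gamma(u) h = (P + Gamma(u)) h, and integrating the formula over all multiples of h identifies the law
  of <a, .> as N(0, <a, h>). Since Q_u(v) <= F_plus |v|^2 and Z(u) <= 1, all these densities dominate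
  exp(-F_plus |v|^2 / 2) / 2, a Doeblin minorization uniform in u, which gives the invariant density as
  a Neumann series and a contraction of total variation.
*)
theory Submission
  imports Defs
begin

section \<open>Orthonormal bases\<close>

text \<open>The transition kernel is given by a definite description, so nothing can be said about
  it until some measure is shown to be the only centred Gaussian with the required covariance. The
  tilted measure is that candidate. Its normalising constant cancels in the shift formula, so no
  determinant has to be computed. Two obstacles shape the argument. The Cameron--Martin formula is
  proved only for w in the finite span of the eigenbasis, where finitely many coordinates are
  shifted; general w is reached by a limit of characteristic functions. And every direction a has to
  be written as (P + Gamma(u)) h, which is a solvability statement for an unbounded operator. In
  addition, H is a closed subset of an inner product type that need not be separable, so
  measurability of maps into H is always reduced to countably many coordinates.\<close>

lemma floor_list_measurable:
  fixes c :: "nat \<Rightarrow> 'a \<Rightarrow> real"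
  assumes [measurable]: "\<And>j. c j \<in> borel_measurable M"
  shows "(\<lambda>\<omega>. map (\<lambda>j. \<lfloor>c j \<omega>\<rfloor>) [0..<n]) \<in> measurable M (count_space UNIV)"
  unfolding measurable_count_space_eq2_countable
proof safe
  fix l :: "int list"
  have "(\<lambda>\<omega>. map (\<lambda>j. \<lfloor>c j \<omega>\<rfloor>) [0..<n]) -` {l} \<inter> space M =
      {\<omega>\<in>space M. length l = n \<and> (\<forall>j\<in>{..<n}. \<lfloor>c j \<omega>\<rfloor> = l ! j)}"
  proof -
    have "map (\<lambda>j. \<lfloor>c j \<omega>\<rfloor>) [0..<n] = l \<longleftrightarrow> length l = n \<and> (\<forall>j\<in>{..<n}. \<lfloor>c j \<omega>\<rfloor> = l ! j)" for \<omega>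
      unfolding list_eq_iff_nth_eq
      by (simp only: length_map length_upt diff_zero nth_map nth_upt add_0 Ball_def lessThan_iff
          cong: conj_cong) (safe; simp)
    then show ?thesis by blast
  qed
  also have "\<dots> \<in> sets M" by measurable
  finally show "(\<lambda>\<omega>. map (\<lambda>j. \<lfloor>c j \<omega>\<rfloor>) [0..<n]) -` {l} \<inter> space M \<in> sets M" .
qed auto

text \<open>\<open>H\<close> is a set and not a type because it will be \<open>L2_on D\<close>, a
  closed subspace varying with \<open>D\<close>. Completeness is assumed because
  \<open>real_inner\<close> does not include it.\<close>

locale hilbert_basis =
  fixes H :: "'h::real_inner set" and b :: "nat \<Rightarrow> 'h"
  assumes complete_H: "Topological_Spaces.complete H"
    and orthonormal: "inner (b i) (b j) = (if i = j then 1 else 0)"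
    and H_eq: "H = closure (span (range b))"
begin

lemma subspace_H: "subspace H"
proof (rule subspaceI)
  let ?S = "span (range b)"
  have add: "x + y \<in> ?S" if "x \<in> ?S" "y \<in> ?S" for x y using that by (rule span_add)
  have scale: "c *\<^sub>R x \<in> ?S" if "x \<in> ?S" for x c using that by (rule span_scale)
  show "0 \<in> H"
    unfolding H_eq using closure_subset span_zero by (rule subsetD)
  show "x + y \<in> H" if "x \<in> H" "y \<in> H" for x y
    using that add unfolding H_eq closure_sequential
    by clarify (intro exI[of _ "\<lambda>n. _ n + _ n"] conjI allI tendsto_add, auto)
  show "c *\<^sub>R x \<in> H" if "x \<in> H" for c x
    using that scale unfolding H_eq closure_sequential
    by clarify (intro exI[of _ "\<lambda>n. c *\<^sub>R _ n"] conjI allI tendsto_scaleR tendsto_const, auto)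
qed

lemma b_in_H [simp]: "b j \<in> H"
  unfolding H_eq by (rule subsetD[OF closure_subset]) (auto intro: span_base)

lemma zero_in_H [simp]: "0 \<in> H"
  using subspace_H by (rule subspace_0)

lemma H_add: "x \<in> H \<Longrightarrow> y \<in> H \<Longrightarrow> x + y \<in> H"
  using subspace_H by (rule subspace_add)

lemma H_diff: "x \<in> H \<Longrightarrow> y \<in> H \<Longrightarrow> x - y \<in> H"
  using subspace_H by (rule subspace_diff)

lemma H_scale: "x \<in> H \<Longrightarrow> c *\<^sub>R x \<in> H"
  using subspace_H by (rule subspace_scale)

lemma H_sum: "(\<And>i. i \<in> I \<Longrightarrow> f i \<in> H) \<Longrightarrow> sum f I \<in> H"
  using subspace_H by (rule subspace_sum)

lemma inner_b_sum: "inner (b i) (\<Sum>j<n. c j *\<^sub>R b j) = (if i < n then c i else 0)"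
  by (simp add: inner_sum_right orthonormal if_distrib cong: if_cong)

lemma norm_sum_b: "(norm (\<Sum>j\<in>J. c j *\<^sub>R b j))\<^sup>2 = (\<Sum>j\<in>J. (c j)\<^sup>2)" if "finite J"
  using that
  by (simp add: power2_norm_eq_inner inner_sum_left inner_sum_right orthonormal
      if_distrib power2_eq_square[of "c _"] cong: if_cong)

section \<open>Partial sums and Parseval's identity\<close>

definition psum :: "nat \<Rightarrow> 'h \<Rightarrow> 'h" where
  "psum n x = (\<Sum>j<n. inner (b j) x *\<^sub>R b j)"

lemma psum_in_span: "psum n x \<in> span (range b)"
  unfolding psum_def by (intro span_sum span_scale span_base) auto

lemma psum_in_H [simp]: "psum n x \<in> H"
  unfolding psum_def by (intro H_sum H_scale) auto

lemma inner_psum: "inner (psum n x) y = (\<Sum>j<n. inner (b j) x * inner (b j) y)"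
  by (simp add: psum_def inner_sum_left)

lemma inner_b_psum: "inner (b i) (psum n x) = (if i < n then inner (b i) x else 0)"
  unfolding psum_def by (rule inner_b_sum)

lemma psum_diff: "psum n (x - y) = psum n x - psum n y"
  by (simp add: psum_def inner_diff_right scaleR_left_diff_distrib sum_subtractf)

text \<open>The partial sum has the same inner product with itself as with \<open>x\<close>, so one
  factor of its norm cancels in the Cauchy--Schwarz inequality.\<close>

lemma norm_psum: "norm (psum n x) \<le> norm x"
proof -
  have "inner (psum n x) (psum n x) = inner (psum n x) x"
    by (simp add: inner_psum inner_b_psum)
  then have "(norm (psum n x))\<^sup>2 \<le> norm (psum n x) * norm x"
    by (metis norm_cauchy_schwarz power2_norm_eq_inner)
  then show ?thesis
    by (cases "norm (psum n x) = 0") (auto simp: power2_eq_square)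
qed

lemma psum_b: "j < n \<Longrightarrow> psum n (b j) = b j"
  by (simp add: psum_def orthonormal if_distrib[of "\<lambda>c. c *\<^sub>R _"] cong: if_cong)

lemma psum_eventually_eq: "x \<in> span (range b) \<Longrightarrow> \<exists>N. \<forall>n\<ge>N. psum n x = x"
proof (induction rule: span_induct_alt)
  case base
  then show ?case by (simp add: psum_def)
next
  case (step c x y)
  then obtain j N where j: "x = b j" and N: "\<forall>n\<ge>N. psum n y = y" by auto
  have "psum n (c *\<^sub>R x + y) = c *\<^sub>R psum n x + psum n y" for n
    by (simp add: psum_def inner_add_right scaleR_left_distrib sum.distrib scaleR_sum_right)
  then have "\<forall>n\<ge>max N (Suc j). psum n (c *\<^sub>R x + y) = c *\<^sub>R x + y"
    using j N by (simp add: psum_b)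
  then show ?case by blast
qed

text \<open>The projections are contractions and are exact from some index on for vectors of the
  dense span, so eventually the error at \<open>x\<close> is at most twice its distance to a nearby
  vector of the span.\<close>

lemma psum_tendsto:
  assumes "x \<in> H"
  shows "(\<lambda>n. psum n x) \<longlonglongrightarrow> x"
proof (rule LIMSEQ_I)
  fix \<epsilon> :: real assume "\<epsilon> > 0"
  then obtain z where z: "z \<in> span (range b)" "dist z x < \<epsilon> / 2"
    using assms unfolding H_eq closure_approachable by (meson half_gt_zero)
  obtain N where N: "\<forall>n\<ge>N. psum n z = z"
    using psum_eventually_eq[OF z(1)] by blast
  have "norm (psum n x - x) < \<epsilon>" if "n \<ge> N" for n
  proof -
    have eq: "psum n x - x = psum n (x - z) + (z - x)"
      using N that by (simp add: psum_diff)
    have "norm (psum n x - x) \<le> norm (x - z) + norm (z - x)"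
      unfolding eq using norm_triangle_ineq norm_psum by (meson add_right_mono order_trans)
    then show ?thesis
      using z(2) by (simp add: dist_norm norm_minus_commute)
  qed
  then show "\<exists>N. \<forall>n\<ge>N. norm (psum n x - x) < \<epsilon>" by blast
qed

lemma parseval:
  assumes "x \<in> H"
  shows "(\<lambda>j. inner (b j) x * inner (b j) y) sums inner x y"
  unfolding sums_def using tendsto_inner[OF psum_tendsto[OF assms] tendsto_const[of y]]
  by (simp add: inner_psum)

lemma H_eqI:
  assumes "x \<in> H" "y \<in> H" "\<And>j. inner (b j) x = inner (b j) y"
  shows "x = y"
proof -
  have "psum n x = psum n y" for n by (simp add: psum_def assms(3))
  then show ?thesis
    using LIMSEQ_unique[OF psum_tendsto[OF assms(1)]] psum_tendsto[OF assms(2)] by simp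
qed

text \<open>Inverse of the coordinate map on square-summable sequences. The value 0 elsewhere makes
  it total, so that it can be applied to every sample of an infinite product measure.\<close>

definition synth :: "(nat \<Rightarrow> real) \<Rightarrow> 'h" where
  "synth c = (if summable (\<lambda>j. (c j)\<^sup>2) then lim (\<lambda>n. \<Sum>j<n. c j *\<^sub>R b j) else 0)"

text \<open>By orthonormality the squared distance of two partial sums is a block of the convergent
  series of squares. The partial sums are therefore Cauchy, and completeness of \<open>H\<close>
  supplies the limit.\<close>

lemma synth_tendsto:
  assumes "summable (\<lambda>j. (c j)\<^sup>2)"
  shows "synth c \<in> H" "(\<lambda>n. \<Sum>j<n. c j *\<^sub>R b j) \<longlonglongrightarrow> synth c"
proof -
  let ?s = "\<lambda>n. \<Sum>j<n. c j *\<^sub>R b j"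
  have "Cauchy ?s"
  proof (rule metric_CauchyI)
    fix \<epsilon> :: real assume "\<epsilon> > 0"
    obtain N where N: "\<And>m n. m \<ge> N \<Longrightarrow> norm (\<Sum>j=m..<n. (c j)\<^sup>2) < \<epsilon>\<^sup>2"
      using assms \<open>\<epsilon> > 0\<close> unfolding summable_Cauchy by (meson zero_less_power)
    have *: "dist (?s m) (?s n) < \<epsilon>" if "m \<ge> N" "m \<le> n" for m n
    proof -
      have "?s n - ?s m = (\<Sum>j=m..<n. c j *\<^sub>R b j)"
        using that sum_diff_nat_ivl[of 0 m n "\<lambda>j. c j *\<^sub>R b j"] by (simp add: atLeast0LessThan)
      then have "(norm (?s n - ?s m))\<^sup>2 < \<epsilon>\<^sup>2"
        using N[OF that(1), of n] by (simp add: norm_sum_b)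
      then show ?thesis
        using \<open>\<epsilon> > 0\<close> by (simp add: dist_norm norm_minus_commute power2_less_imp_less)
    qed
    have "dist (?s m) (?s n) < \<epsilon>" if "m \<ge> N" "n \<ge> N" for m n
      using *[of m n] *[of n m] that by (cases "m \<le> n") (auto simp: dist_commute)
    then show "\<exists>N. \<forall>m\<ge>N. \<forall>n\<ge>N. dist (?s m) (?s n) < \<epsilon>" by blast
  qed
  moreover have "\<forall>n. ?s n \<in> H" by (auto intro!: H_sum H_scale)
  ultimately obtain l where l: "l \<in> H" "?s \<longlonglongrightarrow> l"
    using completeE[OF complete_H] by metis
  then show "synth c \<in> H" "?s \<longlonglongrightarrow> synth c"
    using assms by (auto simp: synth_def limI)
qed

lemma synth_in_H [simp]: "synth c \<in> H"
  using synth_tendsto(1)[of c] by (cases "summable (\<lambda>j. (c j)\<^sup>2)") (auto simp: synth_def)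

lemma inner_b_synth:
  "inner (b i) (synth c) = (if summable (\<lambda>j. (c j)\<^sup>2) then c i else 0)"
proof (cases "summable (\<lambda>j. (c j)\<^sup>2)")
  case True
  have "(\<lambda>n. inner (b i) (\<Sum>j<n. c j *\<^sub>R b j)) \<longlonglongrightarrow> inner (b i) (synth c)"
    by (intro tendsto_intros synth_tendsto True)
  moreover have "(\<lambda>n. inner (b i) (\<Sum>j<n. c j *\<^sub>R b j)) \<longlonglongrightarrow> c i"
    unfolding inner_b_sum
    by (rule tendsto_eventually) (auto simp: eventually_at_top_dense intro: exI[of _ i])
  ultimately show ?thesis
    using True by (auto dest: LIMSEQ_unique)
qed (simp add: synth_def)

lemma parseval_norm:
  assumes "x \<in> H"
  shows "(\<lambda>j. (inner (b j) x)\<^sup>2) sums (norm x)\<^sup>2"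
  using parseval[OF assms, of x] by (simp add: power2_norm_eq_inner power2_eq_square[of "inner (b _) x"])

lemma synth_coords: "x \<in> H \<Longrightarrow> synth (\<lambda>j. inner (b j) x) = x"
  by (intro H_eqI) (auto simp: inner_b_synth sums_summable[OF parseval_norm])

text \<open>The image is synthesised from its coordinates, whose squares are dominated by
  \<open>\<rho>\<^sup>2\<close> times those of \<open>x\<close>. The norm bound is attached because
  the result serves to build resolvents of the covariance with controlled norm.\<close>

lemma diagonal_operator:
  assumes "x \<in> H" and d: "\<And>j. \<bar>d j\<bar> \<le> \<rho>"
  shows "\<exists>y\<in>H. (\<forall>j. inner (b j) y = d j * inner (b j) x) \<and> norm y \<le> \<rho> * norm x"
proof (intro bexI conjI allI)
  let ?c = "\<lambda>j. d j * inner (b j) x"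
  have "\<rho> \<ge> 0" using d[of 0] by linarith
  have le: "(?c j)\<^sup>2 \<le> \<rho>\<^sup>2 * (inner (b j) x)\<^sup>2" for j
  proof -
    have "(d j)\<^sup>2 \<le> \<rho>\<^sup>2" using d[of j] \<open>\<rho> \<ge> 0\<close> by (rule power2_le_iff_abs_le[THEN iffD2, rotated])
    then show ?thesis unfolding power_mult_distrib by (rule mult_right_mono) simp
  qed
  have s: "(\<lambda>j. \<rho>\<^sup>2 * (inner (b j) x)\<^sup>2) sums (\<rho>\<^sup>2 * (norm x)\<^sup>2)"
    by (intro sums_mult parseval_norm assms)
  have "norm ((?c j)\<^sup>2) \<le> \<rho>\<^sup>2 * (inner (b j) x)\<^sup>2" for j
    unfolding real_norm_def abs_power2 by (rule le)
  then have sm: "summable (\<lambda>j. (?c j)\<^sup>2)"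
    by (rule summable_comparison_test'[OF sums_summable[OF s], of 0])
  show "synth ?c \<in> H" by simp
  have co: "inner (b j) (synth ?c) = ?c j" for j by (simp only: inner_b_synth sm if_True)
  then show "inner (b j) (synth ?c) = ?c j" for j .
  have "(norm (synth ?c))\<^sup>2 \<le> \<rho>\<^sup>2 * (norm x)\<^sup>2"
    by (rule sums_le[OF _ parseval_norm[OF synth_in_H] s]) (unfold co, rule le)
  then have "(norm (synth ?c))\<^sup>2 \<le> (\<rho> * norm x)\<^sup>2"
    unfolding power_mult_distrib .
  then show "norm (synth ?c) \<le> \<rho> * norm x"
    by (rule power2_le_imp_le) (use \<open>\<rho> \<ge> 0\<close> in simp)
qed

section \<open>Measurability through coordinates\<close>

lemma space_borel_on [simp]: "space (borel_on H) = H"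
  by (simp add: space_restrict_space)

lemma inner_measurable: "inner a \<in> borel_measurable (borel_on H)"
  by (intro measurable_restrict_space1 borel_measurable_continuous_onI continuous_intros)

text \<open>Rounding makes the combination depend only on a list of integers. Such lists form a
  countable space, so every function of them is measurable. Measurability of vector addition,
  delicate in a nonseparable space, is thereby avoided.\<close>

lemma floor_approx_measurable:
  fixes c :: "nat \<Rightarrow> 'a \<Rightarrow> real"
  assumes [measurable]: "\<And>j. c j \<in> borel_measurable M"
  shows "(\<lambda>\<omega>. \<Sum>j<n. (of_int \<lfloor>2 ^ n * c j \<omega>\<rfloor> / 2 ^ n) *\<^sub>R b j) \<in> borel_measurable M"
proof -
  let ?h = "\<lambda>\<omega>. map (\<lambda>j. \<lfloor>2 ^ n * c j \<omega>\<rfloor>) [0..<n]"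
  let ?g = "\<lambda>l. \<Sum>j<n. (of_int (l ! j) / 2 ^ n) *\<^sub>R b j"
  have "?h \<in> measurable M (count_space UNIV)"
    by (rule floor_list_measurable[of "\<lambda>j \<omega>. 2 ^ n * c j \<omega>"]) measurable
  then have "(\<lambda>\<omega>. ?g (?h \<omega>)) \<in> borel_measurable M"
    by (rule measurable_compose) simp
  moreover have "map (\<lambda>j. \<lfloor>2 ^ n * c j \<omega>\<rfloor>) [0..<n] ! j = \<lfloor>2 ^ n * c j \<omega>\<rfloor>" if "j < n" for j \<omega>
    using that by (simp only: nth_map nth_upt length_upt add_0 diff_zero)
  then have "?g (?h \<omega>) = (\<Sum>j<n. (of_int \<lfloor>2 ^ n * c j \<omega>\<rfloor> / 2 ^ n) *\<^sub>R b j)" for \<omega>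
    by (intro sum.cong refl) (simp only: lessThan_iff)
  ultimately show ?thesis by (simp only:)
qed

text \<open>\<open>f\<close> is the pointwise limit of its rounded expansions, each measurable by
  countability, and pointwise limits of measurable maps into a metric space are measurable.\<close>

lemma measurable_borel_on:
  assumes H: "\<And>\<omega>. \<omega> \<in> space M \<Longrightarrow> f \<omega> \<in> H"
    and meas: "\<And>j. (\<lambda>\<omega>. inner (b j) (f \<omega>)) \<in> borel_measurable M"
  shows "f \<in> measurable M (borel_on H)"
proof (rule measurable_restrict_space2)
  let ?c = "\<lambda>j \<omega>. inner (b j) (f \<omega>)"
  let ?a = "\<lambda>n \<omega>. \<Sum>j<n. (of_int \<lfloor>2 ^ n * ?c j \<omega>\<rfloor> / 2 ^ n) *\<^sub>R b j"
  show "f \<in> space M \<rightarrow> H" using H by auto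
  show "f \<in> borel_measurable M"
  proof (rule borel_measurable_LIMSEQ_metric)
    show "?a n \<in> borel_measurable M" for n
      by (rule floor_approx_measurable[OF meas])
    fix \<omega> assume "\<omega> \<in> space M"
    \<comment> \<open>The number of coordinates and the precision grow together: \<open>n\<close>
      rounding errors of size at most \<open>1 / 2 ^ n\<close> add up to a null sequence.\<close>
    have "norm (?a n \<omega> - psum n (f \<omega>)) \<le> real n * (1 / 2 ^ n)" for n
    proof -
      define d where "d j = of_int \<lfloor>2 ^ n * ?c j \<omega>\<rfloor> / 2 ^ n - ?c j \<omega>" for j
      have eq: "?a n \<omega> - psum n (f \<omega>) = (\<Sum>j<n. d j *\<^sub>R b j)"
        unfolding d_def psum_def sum_subtractf scaleR_left_diff_distrib ..
      have "norm (d j *\<^sub>R b j) \<le> 1 / 2 ^ n" for j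
      proof -
        have abs_le: "\<bar>of_int \<lfloor>y\<rfloor> - y\<bar> / 2 ^ n \<le> 1 / 2 ^ n" for y :: real
          by (rule divide_right_mono) (linarith, simp)
        have "d j = (of_int \<lfloor>2 ^ n * ?c j \<omega>\<rfloor> - 2 ^ n * ?c j \<omega>) / 2 ^ n"
          unfolding d_def diff_divide_distrib by simp
        then have "\<bar>d j\<bar> = \<bar>of_int \<lfloor>2 ^ n * ?c j \<omega>\<rfloor> - 2 ^ n * ?c j \<omega>\<bar> / 2 ^ n"
          by (simp only: abs_divide power_abs abs_numeral)
        then have "\<bar>d j\<bar> \<le> 1 / 2 ^ n"
          by (simp only: abs_le)
        moreover have "norm (b j) = 1"
          using orthonormal[of j j] by (simp add: norm_eq_sqrt_inner)
        ultimately show ?thesis by simp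
      qed
      then have "norm (\<Sum>j<n. d j *\<^sub>R b j) \<le> of_nat (card {..<n}) * (1 / 2 ^ n)"
        by (rule order_trans[OF norm_sum sum_bounded_above])
      then show ?thesis unfolding eq card_lessThan .
    qed
    then have "\<forall>\<^sub>F n in sequentially. norm (?a n \<omega> - psum n (f \<omega>)) \<le> real n * (1 / 2 ^ n)"
      by (rule always_eventually[OF allI])
    moreover have "(\<lambda>n. real n * (1 / 2 ^ n)) \<longlonglongrightarrow> 0"
      using powser_times_n_limit_0[of "1 / 2 :: real"] by (simp only: power_one_over) simp
    ultimately have "(\<lambda>n. ?a n \<omega> - psum n (f \<omega>)) \<longlonglongrightarrow> 0"
      by (rule Lim_null_comparison)
    from tendsto_add[OF this psum_tendsto[OF H[OF \<open>\<omega> \<in> space M\<close>]]]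
    show "(\<lambda>n. ?a n \<omega>) \<longlonglongrightarrow> f \<omega>" by (simp only: diff_add_cancel add_0)
  qed
qed

lemma synth_measurable: "synth \<in> measurable (\<Pi>\<^sub>M j\<in>UNIV. borel) (borel_on H)"
proof (rule measurable_borel_on)
  \<comment> \<open>Square-summability means that an extended nonnegative series is finite, which is
    a measurable condition.\<close>
  have "summable (\<lambda>j. (c j)\<^sup>2) \<longleftrightarrow> (\<Sum>j. ennreal ((c j)\<^sup>2)) \<noteq> \<top>" for c :: "nat \<Rightarrow> real"
    by (rule iffI, erule ennreal_suminf_neq_top, simp, rule summable_suminf_not_top, simp)
  then show "(\<lambda>c. inner (b j) (synth c)) \<in> borel_measurable (\<Pi>\<^sub>M j\<in>UNIV. borel)" for j
    unfolding inner_b_synth by (simp only:) measurable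
qed simp

end

section \<open>One-dimensional normal distributions\<close>

text \<open>Scaling a standard normal variable covers the point mass at \<open>\<sigma> = 0\<close>
  and the density case at once, so characteristic function and moments need no further case
  distinction.\<close>

lemma centred_normal_eq_distr:
  assumes "\<sigma> \<ge> 0"
  shows "centred_normal \<sigma> = distr std_normal_distribution borel (\<lambda>x. \<sigma> * x)"
proof (cases "\<sigma> = 0")
  case True
  interpret prob_space std_normal_distribution by (rule prob_space_normal_density) simp
  show ?thesis
    using True by (simp add: centred_normal_def)
next
  case False
  interpret prob_space std_normal_distribution by (rule prob_space_normal_density) simp
  have "distributed std_normal_distribution lborel (\<lambda>x. x) (normal_density 0 1)"
    unfolding distributed_def by (auto intro!: measure_eqI simp: emeasure_distr)
  from normal_density_affine[OF this, of \<sigma> 0]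
  have "distributed std_normal_distribution lborel (\<lambda>x. \<sigma> * x) (normal_density 0 \<sigma>)"
    using False assms by simp
  then have "distr std_normal_distribution lborel (\<lambda>x. \<sigma> * x) = density lborel (normal_density 0 \<sigma>)"
    by (simp add: distributed_def)
  moreover have "distr std_normal_distribution lborel (\<lambda>x. \<sigma> * x) = distr std_normal_distribution borel (\<lambda>x. \<sigma> * x)"
    by (rule distr_cong) simp_all
  ultimately show ?thesis using False by (simp add: centred_normal_def)
qed

lemma real_distribution_centred_normal:
  assumes "\<sigma> \<ge> 0"
  shows "real_distribution (centred_normal \<sigma>)"
proof -
  interpret prob_space std_normal_distribution by (rule prob_space_normal_density) simp
  show ?thesis
    unfolding centred_normal_eq_distr[OF assms] by (rule real_distribution_distr) simp
qed

lemma char_centred_normal: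
  assumes "\<sigma> \<ge> 0"
  shows "char (centred_normal \<sigma>) t = complex_of_real (exp (- (\<sigma>\<^sup>2 * t\<^sup>2) / 2))"
proof -
  have "char (centred_normal \<sigma>) t = char std_normal_distribution (\<sigma> * t)"
    unfolding char_def centred_normal_eq_distr[OF assms]
    by (subst integral_distr) (simp_all add: mult_ac)
  then show ?thesis by (simp add: char_std_normal_distribution power_mult_distrib)
qed

lemma centred_normal_second_moment:
  assumes "\<sigma> \<ge> 0"
  shows "integrable (centred_normal \<sigma>) (\<lambda>x. x\<^sup>2)" "(\<integral>x. x\<^sup>2 \<partial>centred_normal \<sigma>) = \<sigma>\<^sup>2"
proof -
  have int: "integrable std_normal_distribution (\<lambda>x. x\<^sup>2)" "(\<integral>x. x\<^sup>2 \<partial>std_normal_distribution) = 1"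
    using std_normal_distribution_even_moments[of 1] by (simp_all add: fact_2)
  show "integrable (centred_normal \<sigma>) (\<lambda>x. x\<^sup>2)"
    unfolding centred_normal_eq_distr[OF assms]
    by (subst integrable_distr_eq) (simp_all add: power_mult_distrib int(1))
  show "(\<integral>x. x\<^sup>2 \<partial>centred_normal \<sigma>) = \<sigma>\<^sup>2"
    unfolding centred_normal_eq_distr[OF assms]
    by (subst integral_distr) (simp_all add: power_mult_distrib int(2))
qed

text \<open>Levy uniqueness, applied after normalising both measures to mass 1. Cosines with
  arbitrary phase replace complex exponentials because the inductive argument for several
  coordinates works with real weights.\<close>

lemma finite_borel_measure_eqI:
  fixes M N :: "real measure"
  assumes M: "finite_measure M" "sets M = sets borel" and N: "finite_measure N" "sets N = sets borel"
    and eq: "\<And>t \<phi>. (\<integral>x. cos (t * x + \<phi>) \<partial>M) = (\<integral>x. cos (t * x + \<phi>) \<partial>N)"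
  shows "M = N"
proof -
  have sp: "space M = UNIV" "space N = UNIV"
    using sets_eq_imp_space_eq[OF M(2)] sets_eq_imp_space_eq[OF N(2)] by auto
  interpret M: finite_measure M by fact
  interpret N: finite_measure N by fact
  define c where "c = measure M UNIV"
  \<comment> \<open>At frequency and phase 0 the cosine is 1, so the hypothesis already equates the
    total masses.\<close>
  have c: "measure M UNIV = c" "measure N UNIV = c"
    using eq[of 0 0] by (simp_all add: c_def sp)
  show ?thesis
  proof (cases "c = 0")
    case True
    have "emeasure M A = 0" "emeasure N A = 0" for A
      using M.bounded_measure[of A] N.bounded_measure[of A] c True measure_nonneg[of M A] measure_nonneg[of N A]
      by (simp_all add: M.emeasure_eq_measure N.emeasure_eq_measure sp)
    then show ?thesis using M N by (intro measure_eqI) simp_all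
  next
    case False
    have "c > 0" using False measure_nonneg[of M UNIV] by (simp add: c_def less_le)
    let ?d = "\<lambda>L :: real measure. density L (\<lambda>_. ennreal (1 / c))"
    have dist: "real_distribution (?d L)" if "finite_measure L" "sets L = sets borel" "measure L UNIV = c" for L
    proof -
      interpret L: finite_measure L by fact
      have spL: "space L = UNIV" using sets_eq_imp_space_eq[OF that(2)] by simp
      have "emeasure (?d L) UNIV = ennreal (1 / c) * emeasure L UNIV"
        using spL that(2) by (subst emeasure_density_const) auto
      also have "\<dots> = 1"
        using that(3) \<open>c > 0\<close> by (simp add: L.emeasure_eq_measure flip: ennreal_mult)
      finally have "prob_space (?d L)" by (intro prob_spaceI) (simp add: spL)
      then show ?thesis
        by (simp add: real_distribution_def real_distribution_axioms_def that(2))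
    qed
    have char: "char (?d L) t = of_real (1 / c) * (of_real (\<integral>x. cos (t * x + 0) \<partial>L)
        + \<i> * of_real (\<integral>x. cos (t * x + (- (pi / 2))) \<partial>L))"
      if "finite_measure L" "sets L = sets borel" for L t
    proof -
      interpret L: finite_measure L by fact
      have [measurable_cong]: "sets L = sets borel" by fact
      have int: "integrable L (\<lambda>x. cos (t * x + \<phi>))" for \<phi>
        by (rule L.integrable_const_bound[where B=1]) simp_all
      \<comment> \<open>The phase \<open>- (pi / 2)\<close> turns the cosine into a sine, so two
        phases recover the real and the imaginary part.\<close>
      have iexp: "iexp (t * x) = of_real (cos (t * x + 0)) + \<i> * of_real (cos (t * x + (- (pi / 2))))" for x
      proof -
        show ?thesis
          by (simp only: cis_conv_exp[symmetric]) (simp add: complex_eq_iff cos_diff)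
      qed
      have "char (?d L) t = of_real (1 / c) * (\<integral>x. iexp (t * x) \<partial>L)"
        unfolding char_def using \<open>c > 0\<close> by (subst integral_density) (simp_all add: scaleR_conv_of_real)
      also have "(\<integral>x. iexp (t * x) \<partial>L) = of_real (\<integral>x. cos (t * x + 0) \<partial>L)
          + \<i> * of_real (\<integral>x. cos (t * x + (- (pi / 2))) \<partial>L)"
        unfolding iexp
        by (subst Bochner_Integration.integral_add, (intro integrable_mult_right integrable_of_real int)+)
          simp
      finally show ?thesis .
    qed
    have "?d M = ?d N"
      using dist[OF M c(1)] dist[OF N c(2)]
      by (rule Levy_uniqueness) (rule ext, simp only: char[OF M] char[OF N] eq)
    show ?thesis
    proof (rule measure_eqI)
      show "sets M = sets N" using M N by simp
      fix A assume A: "A \<in> sets M"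
      have "ennreal (1 / c) * emeasure M A = ennreal (1 / c) * emeasure N A"
        using A M N \<open>?d M = ?d N\<close> by (metis emeasure_density_const)
      then show "emeasure M A = emeasure N A"
        using \<open>c > 0\<close> by (simp add: ennreal_mult_cancel_left)
    qed
  qed
qed

text \<open>The shift identity is integrated over \<open>s\<close> against Lebesgue measure and the
  integrals are exchanged. On the left, invariance of Lebesgue measure removes all dependence on
  \<open>m\<close>; on the right, the weight becomes a Gaussian integral in \<open>s\<close> that
  can be evaluated for each \<open>x\<close>.\<close>

lemma normal_of_shift_density:
  fixes m :: "real measure"
  assumes m: "prob_space m" "sets m = sets borel" and "\<sigma> > 0"
    and shift: "\<And>s g. g \<in> borel_measurable borel \<Longrightarrow>
      (\<integral>\<^sup>+x. g (x + s * \<sigma>\<^sup>2) \<partial>m) = (\<integral>\<^sup>+x. g x * ennreal (exp (s * x - s\<^sup>2 * \<sigma>\<^sup>2 / 2)) \<partial>m)"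
  shows "m = density lborel (\<lambda>x. ennreal (normal_density 0 \<sigma> x))"
proof (rule measure_eqI)
  interpret m: prob_space m by fact
  interpret p: pair_sigma_finite lborel m ..
  have [measurable_cong]: "sets m = sets borel" by fact
  \<comment> \<open>This factor turns the exponential weight, as a function of \<open>s\<close>,
    into the normal density with mean \<open>x / \<sigma>\<^sup>2\<close> and deviation
    \<open>1 / \<sigma>\<close>, so its integral over \<open>s\<close> is 1 for every
    \<open>x\<close>.\<close>
  define c where "c x = normal_density 0 \<sigma> x * \<sigma>\<^sup>2" for x
  have [measurable]: "c \<in> borel_measurable borel" by (simp add: c_def[abs_def])
  have c0: "0 \<le> c x" for x by (simp add: c_def)
  have gauss: "c x * exp (s * x - s\<^sup>2 * \<sigma>\<^sup>2 / 2) = normal_density (x / \<sigma>\<^sup>2) (1 / \<sigma>) s" for s x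
  proof -
    have "s * x - s\<^sup>2 * \<sigma>\<^sup>2 / 2 - x\<^sup>2 / (2 * \<sigma>\<^sup>2) = - ((s - x / \<sigma>\<^sup>2)\<^sup>2 / (2 * (1 / \<sigma>)\<^sup>2))"
      using \<open>\<sigma> > 0\<close> by (simp add: field_simps power2_eq_square)
    moreover have "\<sigma>\<^sup>2 / sqrt (2 * pi * \<sigma>\<^sup>2) = 1 / sqrt (2 * pi * (1 / \<sigma>)\<^sup>2)"
      using \<open>\<sigma> > 0\<close> by (simp add: real_sqrt_mult real_sqrt_divide field_simps power2_eq_square)
    moreover have "c x * exp (s * x - s\<^sup>2 * \<sigma>\<^sup>2 / 2) =
        \<sigma>\<^sup>2 / sqrt (2 * pi * \<sigma>\<^sup>2) * exp (s * x - s\<^sup>2 * \<sigma>\<^sup>2 / 2 - x\<^sup>2 / (2 * \<sigma>\<^sup>2))"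
    proof -
      have "exp (e - y) = exp (- y) * exp e" for e y :: real by (simp add: mult_exp_exp)
      then show ?thesis by (simp add: c_def normal_density_def)
    qed
    ultimately show ?thesis
      by (simp only: normal_density_def minus_divide_left)
  qed
  show "sets m = sets (density lborel (\<lambda>x. ennreal (normal_density 0 \<sigma> x)))"
    using m by simp
  fix A assume "A \<in> sets m"
  then have [measurable]: "A \<in> sets borel" using m by simp
  \<comment> \<open>With this choice the right side collapses to \<open>emeasure m A\<close>, while
    the left side is the Lebesgue integral of \<open>g x / \<sigma>\<^sup>2\<close>, that is, of the
    normal density over \<open>A\<close>.\<close>
  define g where "g x = ennreal (c x) * indicator A x" for x
  have [measurable]: "g \<in> borel_measurable borel" by (simp add: g_def[abs_def])
  have "(\<integral>\<^sup>+s. (\<integral>\<^sup>+x. g (x + s * \<sigma>\<^sup>2) \<partial>m) \<partial>lborel) =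
      (\<integral>\<^sup>+x. (\<integral>\<^sup>+s. g (x + s * \<sigma>\<^sup>2) \<partial>lborel) \<partial>m)"
    by (subst p.Fubini') auto
  also have "\<dots> = (\<integral>\<^sup>+x. (\<integral>\<^sup>+y. g y \<partial>lborel) / ennreal (\<sigma>\<^sup>2) \<partial>m)"
  proof (rule nn_integral_cong)
    fix x
    have "(\<integral>\<^sup>+y. g y \<partial>lborel) = ennreal (\<sigma>\<^sup>2) * (\<integral>\<^sup>+s. g (x + s * \<sigma>\<^sup>2) \<partial>lborel)"
      using \<open>\<sigma> > 0\<close> by (subst nn_integral_real_affine[where c="\<sigma>\<^sup>2" and t=x]) (simp_all add: mult.commute)
    then show "(\<integral>\<^sup>+s. g (x + s * \<sigma>\<^sup>2) \<partial>lborel) = (\<integral>\<^sup>+y. g y \<partial>lborel) / ennreal (\<sigma>\<^sup>2)"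
      using \<open>\<sigma> > 0\<close> by (simp add: ennreal_mult_divide_eq mult.commute[of "ennreal _"])
  qed
  also have "\<dots> = (\<integral>\<^sup>+y. g y / ennreal (\<sigma>\<^sup>2) \<partial>lborel)"
    by (simp add: m.emeasure_space_1 nn_integral_divide)
  also have "\<dots> = emeasure (density lborel (\<lambda>x. ennreal (normal_density 0 \<sigma> x))) A"
    using \<open>\<sigma> > 0\<close>
    by (subst emeasure_density)
      (auto intro!: nn_integral_cong simp: g_def c_def ennreal_mult ennreal_mult_divide_eq split: split_indicator)
  finally have L: "(\<integral>\<^sup>+s. (\<integral>\<^sup>+x. g (x + s * \<sigma>\<^sup>2) \<partial>m) \<partial>lborel) =
      emeasure (density lborel (\<lambda>x. ennreal (normal_density 0 \<sigma> x))) A" .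
  have "(\<integral>\<^sup>+s. (\<integral>\<^sup>+x. g (x + s * \<sigma>\<^sup>2) \<partial>m) \<partial>lborel) =
      (\<integral>\<^sup>+s. (\<integral>\<^sup>+x. g x * ennreal (exp (s * x - s\<^sup>2 * \<sigma>\<^sup>2 / 2)) \<partial>m) \<partial>lborel)"
    by (simp add: shift)
  also have "\<dots> = (\<integral>\<^sup>+x. (\<integral>\<^sup>+s. g x * ennreal (exp (s * x - s\<^sup>2 * \<sigma>\<^sup>2 / 2)) \<partial>lborel) \<partial>m)"
    by (subst p.Fubini') auto
  also have "\<dots> = (\<integral>\<^sup>+x. indicator A x \<partial>m)"
  proof (rule nn_integral_cong)
    fix x
    have "(\<integral>\<^sup>+s. g x * ennreal (exp (s * x - s\<^sup>2 * \<sigma>\<^sup>2 / 2)) \<partial>lborel) =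
        (\<integral>\<^sup>+s. indicator A x * ennreal (normal_density (x / \<sigma>\<^sup>2) (1 / \<sigma>) s) \<partial>lborel)"
      by (rule nn_integral_cong)
        (simp add: g_def gauss[symmetric] c0 ennreal_mult mult.commute split: split_indicator)
    also have "\<dots> = indicator A x * (\<integral>\<^sup>+s. ennreal (normal_density (x / \<sigma>\<^sup>2) (1 / \<sigma>) s) \<partial>lborel)"
      by (rule nn_integral_cmult) simp
    also have "(\<integral>\<^sup>+s. ennreal (normal_density (x / \<sigma>\<^sup>2) (1 / \<sigma>) s) \<partial>lborel) = 1"
      using \<open>\<sigma> > 0\<close> by (subst nn_integral_eq_integral) simp_all
    finally show "(\<integral>\<^sup>+s. g x * ennreal (exp (s * x - s\<^sup>2 * \<sigma>\<^sup>2 / 2)) \<partial>lborel) = indicator A x"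
      by simp
  qed
  also have "\<dots> = emeasure m A" by simp
  finally show "emeasure m A = emeasure (density lborel (\<lambda>x. ennreal (normal_density 0 \<sigma> x))) A"
    using L by simp
qed

section \<open>Measures determined by one-dimensional marginals\<close>

context hilbert_basis
begin

lemma coords_measurable: "(\<lambda>v j. inner (b j) v) \<in> measurable (borel_on H) (\<Pi>\<^sub>M j\<in>UNIV. borel)"
  by (rule measurable_PiM_single') (auto intro: inner_measurable)

text \<open>Weighting by \<open>1 + cos (\<langle>a, v\<rangle> + \<theta>) \<ge> 0\<close> keeps the measures positive, so that coordinates can be
  restricted to Borel sets one after the other by one-dimensional uniqueness.\<close>

lemma cylinder_cos_integrals_eq:
  assumes m: "prob_space m" "sets m = sets (borel_on H)"
    and n: "prob_space n" "sets n = sets (borel_on H)"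
    and marginals: "\<And>a. a \<in> H \<Longrightarrow> distr m borel (inner a) = distr n borel (inner a)"
    and "finite J" and A: "\<And>j. A j \<in> sets borel" and "a \<in> H"
  shows "(\<integral>v. (\<Prod>j\<in>J. indicator (A j) (inner (b j) v)) * cos (inner a v + \<theta>) \<partial>m) =
         (\<integral>v. (\<Prod>j\<in>J. indicator (A j) (inner (b j) v)) * cos (inner a v + \<theta>) \<partial>n :: real)"
  using \<open>finite J\<close> \<open>a \<in> H\<close>
proof (induction J arbitrary: a \<theta> rule: finite_induct)
  case empty
  have "(\<integral>v. cos (inner a v + \<theta>) \<partial>m) = (\<integral>x. cos (x + \<theta>) \<partial>distr m borel (inner a))"
    if "sets m = sets (borel_on H)" for m
    using inner_measurable measurable_cong_sets[OF that refl]
    by (subst integral_distr) auto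
  from this[OF m(2)] this[OF n(2)] show ?case
    using marginals[OF empty] by simp
next
  case (insert k J)
  note [measurable] = A
  define W where "W v = (\<Prod>j\<in>J. indicator (A j) (inner (b j) v) :: real)" for v
  have W: "0 \<le> W v" "W v \<le> 1" for v
    by (auto simp: W_def intro!: prod_nonneg prod_le_1)
  define q where "q a \<theta> v = W v * (1 + cos (inner a v + \<theta>))" for a \<theta> v
  have absW: "\<bar>W v\<bar> \<le> 1" for v using W[of v] by simp
  have cos_bds: "0 \<le> 1 + cos x" "1 + cos x \<le> 2" for x :: real
    using cos_ge_minus_one[of x] cos_le_one[of x] by linarith+
  have q0: "0 \<le> q a \<theta> v" for a \<theta> v
    unfolding q_def by (intro mult_nonneg_nonneg W cos_bds)
  have q2: "q a \<theta> v \<le> 2" for a \<theta> v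
    unfolding q_def using mult_mono[OF W(2) cos_bds(2) _ cos_bds(1)] by simp
  \<comment> \<open>The law of the new coordinate under the weighted measure. Once it is the same
    for \<open>m\<close> and \<open>n\<close>, evaluating it at \<open>A k\<close> adds one more
    indicator to the product.\<close>
  define P where "P L a \<theta> = distr (density L (\<lambda>v. ennreal (q a \<theta> v))) borel (inner (b k))" for L a \<theta>
  have basic: "finite_measure (P L a \<theta>)" "sets (P L a \<theta>) = sets borel"
      "(\<integral>x. cos (t * x + \<phi>) \<partial>P L a \<theta>) = (\<integral>v. W v * cos (inner (t *\<^sub>R b k) v + \<phi>) \<partial>L)
        + 1 / 2 * (\<integral>v. W v * cos (inner (a + t *\<^sub>R b k) v + (\<theta> + \<phi>)) \<partial>L)
        + 1 / 2 * (\<integral>v. W v * cos (inner (a - t *\<^sub>R b k) v + (\<theta> - \<phi>)) \<partial>L)"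
      "measure (P L a \<theta>) (A k) = (\<integral>v. indicator (A k) (inner (b k) v) * W v \<partial>L)
        + (\<integral>v. indicator (A k) (inner (b k) v) * W v * cos (inner a v + \<theta>) \<partial>L)"
    if L: "prob_space L" "sets L = sets (borel_on H)" for L a \<theta> t \<phi>
  proof -
    interpret L: prob_space L by fact
    have [measurable]: "inner c \<in> borel_measurable L" for c
      using inner_measurable measurable_cong_sets[OF L(2) refl] by blast
    have [measurable]: "W \<in> borel_measurable L"
      unfolding W_def[abs_def] by measurable
    have [measurable]: "q a \<theta> \<in> borel_measurable L" for a \<theta>
      unfolding q_def[abs_def] by measurable
    have intW: "integrable L (\<lambda>v. W v * cos (inner c v + \<psi>))" for c \<psi>
      by (rule L.integrable_const_bound[where B=1])
        (auto simp: abs_mult intro!: AE_I2 mult_le_one absW)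
    have intAW: "integrable L (\<lambda>v. indicator (A k) (inner (b k) v) * W v * cos (inner c v + \<psi>))" for c \<psi>
      by (rule L.integrable_const_bound[where B=1])
        (auto simp: abs_mult absW intro!: AE_I2 mult_le_one split: split_indicator)
    have "ennreal (q a \<theta> v) \<le> ennreal 2" for v by (rule ennreal_leI) (rule q2)
    then have "(\<integral>\<^sup>+v. ennreal (q a \<theta> v) \<partial>L) \<le> (\<integral>\<^sup>+v. ennreal 2 \<partial>L)"
      by (rule nn_integral_mono)
    also have "\<dots> = ennreal 2" by (simp add: L.emeasure_space_1)
    finally have "emeasure (density L (\<lambda>v. ennreal (q a \<theta> v))) (space L) \<le> ennreal 2"
      by (simp add: emeasure_density cong: nn_integral_cong)
    then have fin: "emeasure (density L (\<lambda>v. ennreal (q a \<theta> v))) (space L) \<noteq> \<infinity>"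
      unfolding infinity_ennreal_def by (rule neq_top_trans[OF ennreal_neq_top])
    have "finite_measure (density L (\<lambda>v. ennreal (q a \<theta> v)))"
      by (rule finite_measureI) (simp only: space_density fin not_False_eq_True)
    then show "finite_measure (P L a \<theta>)"
      unfolding P_def by (rule finite_measure.finite_measure_distr) simp
    show "sets (P L a \<theta>) = sets borel" by (simp add: P_def)
    have "(\<integral>x. cos (t * x + \<phi>) \<partial>P L a \<theta>) = (\<integral>v. q a \<theta> v * cos (t * inner (b k) v + \<phi>) \<partial>L)"
      unfolding P_def using q0 by (subst integral_distr) (auto simp: integral_density)
    also have "\<dots> = (\<integral>v. W v * cos (inner (t *\<^sub>R b k) v + \<phi>)
        + 1 / 2 * (W v * cos (inner (a + t *\<^sub>R b k) v + (\<theta> + \<phi>)))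
        + 1 / 2 * (W v * cos (inner (a - t *\<^sub>R b k) v + (\<theta> - \<phi>))) \<partial>L)"
    proof (rule Bochner_Integration.integral_cong[OF refl])
      fix v
      \<comment> \<open>Product-to-sum formula: a test cosine in coordinate \<open>k\<close> merges
        with the weight into cosines in the directions \<open>a + t *\<^sub>R b k\<close> and
        \<open>a - t *\<^sub>R b k\<close>. For this reason the induction ranges over all directions
        and phases.\<close>
      define x y where "x = inner a v + \<theta>" and "y = t * inner (b k) v + \<phi>"
      have "inner (a + t *\<^sub>R b k) v + (\<theta> + \<phi>) = x + y" "inner (a - t *\<^sub>R b k) v + (\<theta> - \<phi>) = x - y"
        "inner (t *\<^sub>R b k) v + \<phi> = y"
        by (simp_all add: x_def y_def inner_add_left inner_diff_left)
      then show "q a \<theta> v * cos (t * inner (b k) v + \<phi>) = W v * cos (inner (t *\<^sub>R b k) v + \<phi>)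
          + 1 / 2 * (W v * cos (inner (a + t *\<^sub>R b k) v + (\<theta> + \<phi>)))
          + 1 / 2 * (W v * cos (inner (a - t *\<^sub>R b k) v + (\<theta> - \<phi>)))"
        unfolding q_def x_def[symmetric] y_def[symmetric]
        by (simp only: cos_add cos_diff) (simp add: algebra_simps)
    qed
    also have "\<dots> = (\<integral>v. W v * cos (inner (t *\<^sub>R b k) v + \<phi>) \<partial>L)
        + 1 / 2 * (\<integral>v. W v * cos (inner (a + t *\<^sub>R b k) v + (\<theta> + \<phi>)) \<partial>L)
        + 1 / 2 * (\<integral>v. W v * cos (inner (a - t *\<^sub>R b k) v + (\<theta> - \<phi>)) \<partial>L)"
      by (simp only: Bochner_Integration.integral_add Bochner_Integration.integrable_add
          integrable_mult_right intW integral_mult_right_zero)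
    finally show "(\<integral>x. cos (t * x + \<phi>) \<partial>P L a \<theta>) = \<dots>" .
    have "measure (P L a \<theta>) (A k) = (\<integral>x. indicator (A k) x \<partial>P L a \<theta>)"
      by (simp add: P_def)
    also have "\<dots> = (\<integral>v. q a \<theta> v * indicator (A k) (inner (b k) v) \<partial>L)"
      unfolding P_def using q0 by (subst integral_distr) (auto simp: integral_density)
    also have "\<dots> = (\<integral>v. indicator (A k) (inner (b k) v) * W v * cos (inner 0 v + 0)
        + indicator (A k) (inner (b k) v) * W v * cos (inner a v + \<theta>) \<partial>L)"
      by (intro Bochner_Integration.integral_cong refl) (simp add: q_def algebra_simps)
    also have "\<dots> = (\<integral>v. indicator (A k) (inner (b k) v) * W v * cos (inner 0 v + 0) \<partial>L)
        + (\<integral>v. indicator (A k) (inner (b k) v) * W v * cos (inner a v + \<theta>) \<partial>L)"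
      by (rule Bochner_Integration.integral_add[OF intAW intAW])
    finally show "measure (P L a \<theta>) (A k) = (\<integral>v. indicator (A k) (inner (b k) v) * W v \<partial>L)
        + (\<integral>v. indicator (A k) (inner (b k) v) * W v * cos (inner a v + \<theta>) \<partial>L)"
      by simp
  qed
  have "P m a \<theta> = P n a \<theta>" if "a \<in> H" for a \<theta>
  proof (rule finite_borel_measure_eqI[OF basic(1,2)[OF m] basic(1,2)[OF n]])
    fix t \<phi>
    have "t *\<^sub>R b k \<in> H" "a + t *\<^sub>R b k \<in> H" "a - t *\<^sub>R b k \<in> H"
      using that by (simp_all only: H_scale H_add H_diff b_in_H)
    then show "(\<integral>x. cos (t * x + \<phi>) \<partial>P m a \<theta>) = (\<integral>x. cos (t * x + \<phi>) \<partial>P n a \<theta>)"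
      unfolding basic(3)[OF m] basic(3)[OF n] W_def by (simp only: insert.IH)
  qed
  then have eq: "(\<integral>v. indicator (A k) (inner (b k) v) * W v \<partial>m)
        + (\<integral>v. indicator (A k) (inner (b k) v) * W v * cos (inner a v + \<theta>) \<partial>m) =
      (\<integral>v. indicator (A k) (inner (b k) v) * W v \<partial>n)
        + (\<integral>v. indicator (A k) (inner (b k) v) * W v * cos (inner a v + \<theta>) \<partial>n)"
    if "a \<in> H" for a \<theta>
    unfolding basic(4)[OF m, symmetric] basic(4)[OF n, symmetric] using that by simp
  have "(\<Prod>j\<in>insert k J. indicator (A j) (inner (b j) v)) = indicator (A k) (inner (b k) v) * W v" for v
    using insert.hyps by (simp add: W_def)
  \<comment> \<open>Direction 0 and phase 0 give twice the integral without cosine, which is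
    therefore common to both measures and can be subtracted from the general identity.\<close>
  then show ?case
    using eq[OF zero_in_H, of 0] eq[OF insert.prems, of \<theta>] by simp
qed

text \<open>At direction and phase 0 the weighted identity gives agreement on cylinder sets, hence
  equal joint laws of all coordinates. Since \<open>synth\<close> inverts the coordinate map on
  \<open>H\<close>, pushing these laws forward returns the measures themselves.\<close>

theorem cramer_wold:
  assumes m: "prob_space m" "sets m = sets (borel_on H)"
    and n: "prob_space n" "sets n = sets (borel_on H)"
    and marginals: "\<And>a. a \<in> H \<Longrightarrow> distr m borel (inner a) = distr n borel (inner a)"
  shows "m = n"
proof -
  let ?c = "\<lambda>v j. inner (b j) v" and ?P = "\<Pi>\<^sub>M j\<in>(UNIV :: nat set). (borel :: real measure)"
  have meas: "?c \<in> measurable L ?P" if "sets L = sets (borel_on H)" for L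
    using coords_measurable measurable_cong_sets[OF that refl] by blast
  have resynth: "distr (distr L ?P ?c) (borel_on H) synth = L" if "sets L = sets (borel_on H)" for L
  proof -
    have "distr (distr L ?P ?c) (borel_on H) synth = distr L (borel_on H) (\<lambda>v. synth (?c v))"
      using distr_distr[OF synth_measurable meas[OF that]] by (simp add: comp_def)
    also have "\<dots> = distr L L (\<lambda>v. v)"
      using that sets_eq_imp_space_eq[OF that] by (intro distr_cong) (simp_all add: synth_coords)
    also have "\<dots> = L" by simp
    finally show ?thesis .
  qed
  have "distr m ?P ?c = distr n ?P ?c"
  proof (rule measure_eqI_PiM_infinite)
    interpret m: prob_space m by fact
    show "finite_measure (distr m ?P ?c)"
      by (rule m.finite_measure_distr) (rule meas[OF m(2)])
    fix J :: "nat set" and A :: "nat \<Rightarrow> real set"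
    assume J: "finite J" and A: "\<And>j. j \<in> J \<Longrightarrow> A j \<in> sets borel"
    \<comment> \<open>The cylinder identity asks for a Borel set at every index, whereas
      \<open>A\<close> is controlled only on \<open>J\<close>.\<close>
    define A' where "A' j = (if j \<in> J then A j else UNIV)" for j
    have A': "A' j \<in> sets borel" for j using A by (simp add: A'_def)
    let ?E = "prod_emb UNIV (\<lambda>_. borel) J (Pi\<^sub>E J A)"
    have E: "?E \<in> sets ?P"
      using J A by (intro sets_PiM_I) auto
    have "emeasure (distr L ?P ?c) ?E =
        ennreal (\<integral>v. (\<Prod>j\<in>J. indicator (A' j) (inner (b j) v)) * cos (inner 0 v + 0) \<partial>L)"
      if L: "prob_space L" "sets L = sets (borel_on H)" for L
    proof -
      interpret L: prob_space L by fact
      have [measurable]: "inner c \<in> borel_measurable L" for c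
        using inner_measurable measurable_cong_sets[OF L(2) refl] by blast
      note [measurable] = A'
      let ?S = "{v \<in> space L. \<forall>j\<in>J. inner (b j) v \<in> A' j}"
      have "{v \<in> space L. inner (b j) v \<in> A' j} \<in> sets L" for j by measurable
      then have S: "?S \<in> sets L" using J by (intro sets.sets_Collect_finite_All)
      have "emeasure (distr L ?P ?c) ?E = emeasure L (?c -` ?E \<inter> space L)"
        by (rule emeasure_distr[OF meas[OF L(2)] E])
      also have "?c -` ?E \<inter> space L = ?S"
        by (rule set_eqI) (simp add: prod_emb_def restrict_PiE_iff A'_def conj_commute Pi_iff)
      also have "emeasure L ?S = ennreal (\<integral>v. indicator ?S v \<partial>L)"
        using S by (simp add: L.emeasure_eq_measure)
      also have "(\<integral>v. indicator ?S v \<partial>L) = (\<integral>v. (\<Prod>j\<in>J. indicator (A' j) (inner (b j) v)) * cos (inner 0 v + 0) \<partial>L)"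
      proof (rule Bochner_Integration.integral_cong[OF refl])
        fix v assume v: "v \<in> space L"
        have "(\<Prod>j\<in>J. indicator (A' j) (inner (b j) v)) = (indicator ?S v :: real)"
        proof (cases "v \<in> ?S")
          case True
          then show ?thesis by (simp add: prod.neutral)
        next
          case False
          then obtain j where "j \<in> J" "inner (b j) v \<notin> A' j" using v by blast
          then have "(\<Prod>j\<in>J. indicator (A' j) (inner (b j) v)) = (0 :: real)"
            using J by (intro prod_zero bexI[of _ j]) simp_all
          then show ?thesis unfolding indicator_simps(2)[OF False] .
        qed
        then show "indicator ?S v = (\<Prod>j\<in>J. indicator (A' j) (inner (b j) v)) * cos (inner 0 v + 0)"
          by (simp only: inner_zero_left add_0 cos_zero mult_1_right)
      qed
      finally show ?thesis .
    qed
    from this[OF m] this[OF n]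
    show "emeasure (distr m ?P ?c) ?E = emeasure (distr n ?P ?c) ?E"
      using cylinder_cos_integrals_eq[OF m n marginals J A' zero_in_H, where \<theta>=0] by simp
  qed simp_all
  then have "distr (distr m ?P ?c) (borel_on H) synth = distr (distr n ?P ?c) (borel_on H) synth"
    by (rule arg_cong)
  then show ?thesis unfolding resynth[OF m(2)] resynth[OF n(2)] .
qed

end

section \<open>The Cameron--Martin formula\<close>

text \<open>\<open>b\<close> is the eigenbasis. Strict positivity of the eigenvalues makes
  \<open>C\<close> injective, so that a precision operator exists; summability is the trace-class
  condition, which puts the Gaussian sequence almost surely into \<open>H\<close>.\<close>

locale diagonal_covariance = hilbert_basis H b for H :: "'h::real_inner set" and b +
  fixes C :: "'h \<Rightarrow> 'h" and \<mu> :: "nat \<Rightarrow> real"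
  assumes C_in_H: "x \<in> H \<Longrightarrow> C x \<in> H"
    and C_add: "x \<in> H \<Longrightarrow> y \<in> H \<Longrightarrow> C (x + y) = C x + C y"
    and C_scale: "x \<in> H \<Longrightarrow> C (c *\<^sub>R x) = c *\<^sub>R C x"
    and C_bounded: "\<exists>L. \<forall>x\<in>H. norm (C x) \<le> L * norm x"
    and C_symmetric: "x \<in> H \<Longrightarrow> y \<in> H \<Longrightarrow> inner (C x) y = inner x (C y)"
    and C_b: "C (b j) = \<mu> j *\<^sub>R b j"
    and \<mu>_pos: "0 < \<mu> j"
    and \<mu>_summable: "summable \<mu>"
begin

lemma inner_b_C: "x \<in> H \<Longrightarrow> inner (b j) (C x) = \<mu> j * inner (b j) x"
  using C_symmetric[of "b j" x] by (simp add: C_b)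

lemma inner_C_pos:
  assumes "x \<in> H" "x \<noteq> 0"
  shows "0 < inner x (C x)"
proof -
  have s: "(\<lambda>j. \<mu> j * (inner (b j) x)\<^sup>2) sums inner x (C x)"
    using parseval[OF assms(1), of "C x"] assms(1)
    by (simp add: inner_b_C power2_eq_square mult_ac)
  have "\<exists>j. inner (b j) x \<noteq> inner (b j) 0"
    using H_eqI[OF assms(1) zero_in_H] assms(2) by blast
  then obtain j where "inner (b j) x \<noteq> 0" by auto
  then have "0 < (\<Sum>j. \<mu> j * (inner (b j) x)\<^sup>2)"
    using sums_summable[OF s] less_imp_le[OF \<mu>_pos]
    by (intro suminf_pos2[of _ j]) (simp_all add: \<mu>_pos)
  then show ?thesis using sums_unique[OF s] by simp
qed

lemma inner_C_nonneg: "x \<in> H \<Longrightarrow> 0 \<le> inner x (C x)"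
  using inner_C_pos[of x] by (cases "x = 0") (auto intro: less_imp_le)

lemma C_diff: "x \<in> H \<Longrightarrow> y \<in> H \<Longrightarrow> C (x - y) = C x - C y"
  using C_add[of x "(-1) *\<^sub>R y"] C_scale[of y "-1"] H_scale[of y "-1"] by simp

lemma C_tendsto:
  assumes "x \<longlonglongrightarrow> y" "\<And>n. x n \<in> H" "y \<in> H"
  shows "(\<lambda>n. C (x n)) \<longlonglongrightarrow> C y"
proof -
  obtain L where L: "\<And>x. x \<in> H \<Longrightarrow> norm (C x) \<le> L * norm x" using C_bounded by blast
  have "(\<lambda>n. C (x n) - C y) \<longlonglongrightarrow> 0"
  proof (rule Lim_null_comparison)
    show "\<forall>\<^sub>F n in sequentially. norm (C (x n) - C y) \<le> L * norm (x n - y)"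
      using L[OF H_diff[OF assms(2,3)]] by (simp add: C_diff assms(2,3))
    have "(\<lambda>n. L * norm (x n - y)) \<longlonglongrightarrow> L * norm (y - y)"
      by (intro tendsto_intros assms(1))
    then show "(\<lambda>n. L * norm (x n - y)) \<longlonglongrightarrow> 0" by simp
  qed
  then show ?thesis by (simp add: LIM_zero_iff)
qed

section \<open>Gaussian product noise and its image in the Hilbert space\<close>

definition noise :: "nat \<Rightarrow> real measure" where
  "noise j = density lborel (\<lambda>x. ennreal (normal_density 0 (sqrt (\<mu> j)) x))"

definition product_noise :: "(nat \<Rightarrow> real) measure" where
  "product_noise = (\<Pi>\<^sub>M j\<in>UNIV. noise j)"

lemma sets_noise [simp, measurable_cong]: "sets (noise j) = sets borel"
  by (simp add: noise_def)

lemma space_noise [simp]: "space (noise j) = UNIV"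
  by (simp add: noise_def)

lemma prob_noise: "prob_space (noise j)"
  unfolding noise_def by (rule prob_space_normal_density) (simp add: \<mu>_pos)

lemma prob_product_noise: "prob_space product_noise"
  unfolding product_noise_def by (rule prob_space_PiM) (rule prob_noise)

lemma sets_product_noise: "sets product_noise = sets (\<Pi>\<^sub>M j\<in>UNIV. borel)"
  unfolding product_noise_def by (rule sets_PiM_cong) simp_all

lemma measurable_product_noise: "measurable product_noise M = measurable (\<Pi>\<^sub>M j\<in>UNIV. borel) M"
  by (rule measurable_cong_sets[OF sets_product_noise refl])

lemma space_product_noise [simp]: "space product_noise = UNIV"
  by (simp add: product_noise_def space_PiM)

lemma coordinate_measurable [measurable]: "(\<lambda>\<omega>. \<omega> j) \<in> borel_measurable product_noise"
  unfolding measurable_product_noise by measurable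

lemma fun_upd_measurable:
  assumes "f \<in> measurable N product_noise" "h \<in> borel_measurable N"
  shows "(\<lambda>x. fun_upd (f x) k (h x)) \<in> measurable N product_noise"
  unfolding product_noise_def
  by (rule measurable_fun_upd[where J=UNIV])
    (use assms in \<open>simp_all add: product_noise_def measurable_cong_sets[OF refl sets_noise]\<close>)

lemma exp_inner_measurable: "(\<lambda>v. ennreal (exp (inner w v - c))) \<in> borel_measurable (borel_on H)"
  by (rule measurable_compose[OF inner_measurable[of w]]) measurable

text \<open>Redrawing coordinate \<open>k\<close> independently leaves a product measure unchanged.
  This isolates one coordinate, so that a one-dimensional shift can be carried out while the others
  stay frozen.\<close>

lemma nn_integral_resample:
  assumes [measurable]: "f \<in> borel_measurable product_noise"
  shows "(\<integral>\<^sup>+\<omega>. f \<omega> \<partial>product_noise) = (\<integral>\<^sup>+\<omega>. \<integral>\<^sup>+x. f (fun_upd \<omega> k x) \<partial>noise k \<partial>product_noise)"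
proof -
  interpret N: prob_space "noise k" by (rule prob_noise)
  interpret P: prob_space product_noise by (rule prob_product_noise)
  interpret pair_sigma_finite "noise k" product_noise ..
  have meas: "(\<lambda>(x, \<omega>). fun_upd \<omega> k x) \<in> measurable (noise k \<Otimes>\<^sub>M product_noise) product_noise"
    unfolding split_beta'
    by (rule fun_upd_measurable) (simp_all add: measurable_cong_sets[OF refl sets_noise, symmetric])
  have "distr (noise k \<Otimes>\<^sub>M product_noise) product_noise (\<lambda>(x, \<omega>). fun_upd \<omega> k x) = product_noise"
    using distr_pair_PiM_eq_PiM[of UNIV noise k] prob_noise by (simp add: product_noise_def insert_absorb)
  then have "(\<integral>\<^sup>+\<omega>. f \<omega> \<partial>product_noise) =
      (\<integral>\<^sup>+\<omega>. f \<omega> \<partial>distr (noise k \<Otimes>\<^sub>M product_noise) product_noise (\<lambda>(x, \<omega>). fun_upd \<omega> k x))"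
    by simp
  also have "\<dots> = (\<integral>\<^sup>+z. f (case z of (x, \<omega>) \<Rightarrow> fun_upd \<omega> k x) \<partial>(noise k \<Otimes>\<^sub>M product_noise))"
    by (rule nn_integral_distr[OF meas]) measurable
  also have "\<dots> = (\<integral>\<^sup>+\<omega>. \<integral>\<^sup>+x. f (fun_upd \<omega> k x) \<partial>noise k \<partial>product_noise)"
    using nn_integral_snd[of "\<lambda>(x, \<omega>). f (fun_upd \<omega> k x)"] measurable_compose[OF meas assms]
    by (simp add: split_beta')
  finally show ?thesis .
qed

text \<open>Completing the square in the normal density. The translation is
  \<open>s * \<mu> k\<close> so that the resulting exponent has slope exactly
  \<open>s\<close>.\<close>

lemma noise_shift:
  assumes [measurable]: "f \<in> borel_measurable borel"
  shows "(\<integral>\<^sup>+x. f (x + s * \<mu> k) \<partial>noise k) = (\<integral>\<^sup>+x. f x * ennreal (exp (s * x - s\<^sup>2 * \<mu> k / 2)) \<partial>noise k)"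
proof -
  have dens: "normal_density 0 (sqrt (\<mu> k)) (x - s * \<mu> k) =
      normal_density 0 (sqrt (\<mu> k)) x * exp (s * x - s\<^sup>2 * \<mu> k / 2)" for x
  proof -
    have "- ((x - s * \<mu> k)\<^sup>2) / (2 * \<mu> k) = - x\<^sup>2 / (2 * \<mu> k) + (s * x - s\<^sup>2 * \<mu> k / 2)"
      using \<mu>_pos[of k] by (simp add: field_simps power2_eq_square)
    then have "exp (- ((x - s * \<mu> k)\<^sup>2) / (2 * \<mu> k)) = exp (- x\<^sup>2 / (2 * \<mu> k)) * exp (s * x - s\<^sup>2 * \<mu> k / 2)"
      by (simp only: exp_add)
    then show ?thesis
      using \<mu>_pos[of k] by (simp add: normal_density_def)
  qed
  have "(\<integral>\<^sup>+x. f (x + s * \<mu> k) \<partial>noise k) =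
      (\<integral>\<^sup>+x. ennreal (normal_density 0 (sqrt (\<mu> k)) x) * f (x + s * \<mu> k) \<partial>lborel)"
    unfolding noise_def by (subst nn_integral_density) auto
  also have "\<dots> = (\<integral>\<^sup>+x. ennreal (normal_density 0 (sqrt (\<mu> k)) (x - s * \<mu> k)) * f x \<partial>lborel)"
    by (subst nn_integral_real_affine[where c=1 and t="- s * \<mu> k"]) (simp_all add: algebra_simps)
  also have "\<dots> = (\<integral>\<^sup>+x. ennreal (normal_density 0 (sqrt (\<mu> k)) x) * (f x * ennreal (exp (s * x - s\<^sup>2 * \<mu> k / 2))) \<partial>lborel)"
    by (simp only: dens) (simp add: ennreal_mult mult_ac)
  also have "\<dots> = (\<integral>\<^sup>+x. f x * ennreal (exp (s * x - s\<^sup>2 * \<mu> k / 2)) \<partial>noise k)"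
    unfolding noise_def by (subst nn_integral_density) auto
  finally show ?thesis .
qed

text \<open>The expected sum of squares is the trace of the covariance. It is finite, so the sum is
  finite almost surely.\<close>

lemma AE_noise_summable: "AE \<omega> in product_noise. summable (\<lambda>j. (\<omega> j)\<^sup>2)"
proof -
  have second: "(\<integral>\<^sup>+\<omega>. ennreal ((\<omega> j)\<^sup>2) \<partial>product_noise) = ennreal (\<mu> j)" for j
  proof -
    have cn: "centred_normal (sqrt (\<mu> j)) = noise j"
      using \<mu>_pos[of j] by (simp add: centred_normal_def noise_def)
    have d: "distr product_noise (noise j) (\<lambda>\<omega>. \<omega> j) = noise j"
      unfolding product_noise_def by (rule distr_PiM_component) (simp_all add: prob_noise)
    have sq: "(\<lambda>x :: real. ennreal (x\<^sup>2)) \<in> borel_measurable borel"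
      by (intro measurable_compose[OF _ measurable_ennreal] borel_measurable_power) simp
    have m: "(\<lambda>\<omega>. \<omega> j) \<in> measurable product_noise (noise j)"
      using coordinate_measurable by (simp only: measurable_cong_sets[OF refl sets_noise])
    have "(\<integral>\<^sup>+x. ennreal (x\<^sup>2) \<partial>distr product_noise (noise j) (\<lambda>\<omega>. \<omega> j)) =
        (\<integral>\<^sup>+\<omega>. ennreal ((\<omega> j)\<^sup>2) \<partial>product_noise)"
      by (rule nn_integral_distr[OF m, where f="\<lambda>x. ennreal (x\<^sup>2)"])
        (simp only: measurable_cong_sets[OF trans[OF sets_distr sets_noise] refl] sq)
    then have "(\<integral>\<^sup>+\<omega>. ennreal ((\<omega> j)\<^sup>2) \<partial>product_noise) = (\<integral>\<^sup>+x. ennreal (x\<^sup>2) \<partial>noise j)"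
      unfolding d by (rule sym)
    also have "\<dots> = ennreal (\<mu> j)"
      using centred_normal_second_moment[of "sqrt (\<mu> j)"] less_imp_le[OF \<mu>_pos[of j]]
      by (simp add: nn_integral_eq_integral cn)
    finally show ?thesis .
  qed
  have "(\<integral>\<^sup>+\<omega>. (\<Sum>j. ennreal ((\<omega> j)\<^sup>2)) \<partial>product_noise) = (\<Sum>j. ennreal (\<mu> j))"
    by (subst nn_integral_suminf) (simp_all add: second)
  also have "\<dots> < \<infinity>"
    using ennreal_suminf_neq_top[OF \<mu>_summable less_imp_le[OF \<mu>_pos]]
    by (simp add: less_top)
  finally have "AE \<omega> in product_noise. (\<Sum>j. ennreal ((\<omega> j)\<^sup>2)) \<noteq> \<infinity>"
    by (intro nn_integral_PInf_AE) auto
  then show ?thesis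
    by eventually_elim (rule summable_suminf_not_top, simp_all)
qed

definition gauss :: "'h measure" where
  "gauss = distr product_noise (borel_on H) synth"

lemma synth_measurable_noise: "synth \<in> measurable product_noise (borel_on H)"
  unfolding measurable_product_noise by (rule synth_measurable)

lemma sets_gauss [simp, measurable_cong]: "sets gauss = sets (borel_on H)"
  by (simp add: gauss_def)

lemma space_gauss [simp]: "space gauss = H"
  by (simp add: gauss_def)

lemma prob_gauss: "prob_space gauss"
  unfolding gauss_def using prob_product_noise synth_measurable_noise by (rule prob_space.prob_space_distr)

lemma translation_measurable:
  assumes "h \<in> H"
  shows "(\<lambda>v. v + h) \<in> measurable (borel_on H) (borel_on H)"
proof (rule measurable_borel_on)
  have [measurable]: "inner a \<in> borel_measurable (borel_on H)" for a by (rule inner_measurable)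
  show "(\<lambda>v. inner (b j) (v + h)) \<in> borel_measurable (borel_on H)" for j
    unfolding inner_add_right by measurable
qed (simp add: H_add assms)

text \<open>Indexed by \<open>w\<close> instead of the shift \<open>C w\<close>, so that the linear
  functional in the exponent is a true inner product, defined everywhere. Nonnegative test functions
  spare all integrability conditions.\<close>

definition cameron_martin :: "'h \<Rightarrow> bool" where
  "cameron_martin w \<longleftrightarrow> (\<forall>g\<in>borel_measurable (borel_on H).
     (\<integral>\<^sup>+v. g (v + C w) \<partial>gauss) =
     (\<integral>\<^sup>+v. g v * ennreal (exp (inner w v - inner w (C w) / 2)) \<partial>gauss))"

text \<open>Only coordinate \<open>k\<close> moves. On square-summable samples the shift commutes
  with synthesis, and resampling exposes that coordinate to the one-dimensional formula.\<close>

lemma cameron_martin_basis: "cameron_martin (s *\<^sub>R b k)"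
  unfolding cameron_martin_def
proof
  fix g :: "'h \<Rightarrow> ennreal" assume g: "g \<in> borel_measurable (borel_on H)"
  define G where "G \<omega> = g (synth \<omega>)" for \<omega>
  have G [measurable]: "G \<in> borel_measurable product_noise"
    unfolding G_def[abs_def] by (rule measurable_compose[OF synth_measurable_noise g])
  have upd: "(\<lambda>\<omega>. fun_upd \<omega> k (\<omega> k + c)) \<in> measurable product_noise product_noise" for c :: real
    by (rule fun_upd_measurable) measurable
  have upd1: "(\<lambda>x. fun_upd \<omega> k x) \<in> measurable borel product_noise" for \<omega> :: "nat \<Rightarrow> real"
    by (rule fun_upd_measurable) (rule measurable_const, simp, measurable)
  have Cw: "C (s *\<^sub>R b k) = (s * \<mu> k) *\<^sub>R b k"
    by (simp add: C_scale C_b)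
  have g_shift: "(\<lambda>v. g (v + C (s *\<^sub>R b k))) \<in> borel_measurable (borel_on H)"
    by (rule measurable_compose[OF translation_measurable g]) (simp add: C_in_H H_scale)
  have "(\<integral>\<^sup>+v. g (v + C (s *\<^sub>R b k)) \<partial>gauss) = (\<integral>\<^sup>+\<omega>. g (synth \<omega> + C (s *\<^sub>R b k)) \<partial>product_noise)"
    unfolding gauss_def by (rule nn_integral_distr[OF synth_measurable_noise]) (simp add: g_shift)
  also have "\<dots> = (\<integral>\<^sup>+\<omega>. G (fun_upd \<omega> k (\<omega> k + s * \<mu> k)) \<partial>product_noise)"
  proof (rule nn_integral_cong_AE)
    show "AE \<omega> in product_noise. g (synth \<omega> + C (s *\<^sub>R b k)) = G (fun_upd \<omega> k (\<omega> k + s * \<mu> k))"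
      using AE_noise_summable
    proof eventually_elim
      case (elim \<omega>)
      have "summable (\<lambda>j. (fun_upd \<omega> k y j)\<^sup>2)" for y
        by (rule summable_cong[THEN iffD2, OF _ elim])
          (rule eventually_mono[OF eventually_gt_at_top[of k]], simp)
      then have "inner (b j) (synth (fun_upd \<omega> k (\<omega> k + s * \<mu> k))) =
          inner (b j) (synth \<omega> + (s * \<mu> k) *\<^sub>R b k)" for j
        using elim by (cases "j = k") (simp_all add: inner_b_synth inner_add_right orthonormal)
      then have "synth (fun_upd \<omega> k (\<omega> k + s * \<mu> k)) = synth \<omega> + C (s *\<^sub>R b k)"
        unfolding Cw by (intro H_eqI H_add H_scale) simp_all
      then show ?case by (simp add: G_def)
    qed
  qed
  also have "\<dots> = (\<integral>\<^sup>+\<omega>. \<integral>\<^sup>+x. G (fun_upd \<omega> k (x + s * \<mu> k)) \<partial>noise k \<partial>product_noise)"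
    using nn_integral_resample[OF measurable_compose[OF upd[of "s * \<mu> k"] G], of k] by simp
  also have "\<dots> = (\<integral>\<^sup>+\<omega>. \<integral>\<^sup>+x. G (fun_upd \<omega> k x) * ennreal (exp (s * x - s\<^sup>2 * \<mu> k / 2)) \<partial>noise k \<partial>product_noise)"
    by (intro nn_integral_cong noise_shift measurable_compose[OF upd1 G])
  also have "\<dots> = (\<integral>\<^sup>+\<omega>. G \<omega> * ennreal (exp (s * \<omega> k - s\<^sup>2 * \<mu> k / 2)) \<partial>product_noise)"
    using nn_integral_resample[of "\<lambda>\<omega>. G \<omega> * ennreal (exp (s * \<omega> k - s\<^sup>2 * \<mu> k / 2))" k] by simp
  also have "\<dots> = (\<integral>\<^sup>+\<omega>. g (synth \<omega>) * ennreal (exp (inner (s *\<^sub>R b k) (synth \<omega>)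
      - inner (s *\<^sub>R b k) (C (s *\<^sub>R b k)) / 2)) \<partial>product_noise)"
  proof (rule nn_integral_cong_AE)
    show "AE \<omega> in product_noise. G \<omega> * ennreal (exp (s * \<omega> k - s\<^sup>2 * \<mu> k / 2)) =
        g (synth \<omega>) * ennreal (exp (inner (s *\<^sub>R b k) (synth \<omega>)
          - inner (s *\<^sub>R b k) (C (s *\<^sub>R b k)) / 2))"
      using AE_noise_summable
      by eventually_elim (simp add: G_def Cw inner_b_synth orthonormal power2_eq_square mult_ac)
  qed
  also have "\<dots> = (\<integral>\<^sup>+v. g v * ennreal (exp (inner (s *\<^sub>R b k) v
      - inner (s *\<^sub>R b k) (C (s *\<^sub>R b k)) / 2)) \<partial>gauss)"
    unfolding gauss_def
    by (rule nn_integral_distr[symmetric, OF synth_measurable_noise])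
      (unfold measurable_distr_eq1, intro borel_measurable_times_ennreal g exp_inner_measurable)
  finally show "(\<integral>\<^sup>+v. g (v + C (s *\<^sub>R b k)) \<partial>gauss) =
      (\<integral>\<^sup>+v. g v * ennreal (exp (inner (s *\<^sub>R b k) v
        - inner (s *\<^sub>R b k) (C (s *\<^sub>R b k)) / 2)) \<partial>gauss)" .
qed

text \<open>The formula is applied once for each summand. The two cross terms agree by symmetry of
  \<open>C\<close> and complete the quadratic form of \<open>w + w'\<close>.\<close>

lemma cameron_martin_add:
  assumes w: "w \<in> H" "w' \<in> H" and cm: "cameron_martin w" "cameron_martin w'"
  shows "cameron_martin (w + w')"
  unfolding cameron_martin_def
proof
  fix g :: "'h \<Rightarrow> ennreal" assume g: "g \<in> borel_measurable (borel_on H)"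
  define e where "e w v = ennreal (exp (inner w v - inner w (C w) / 2))" for w v
  have e: "e w \<in> borel_measurable (borel_on H)" for w
    unfolding e_def[abs_def] by (rule exp_inner_measurable)
  \<comment> \<open>The exponential from \<open>w\<close> is absorbed into the test function. Its
    constant contains \<open>inner w (C w')\<close> because the shift by \<open>C w'\<close> adds
    exactly this amount to \<open>inner w v\<close>.\<close>
  define g1 where "g1 v = g v * ennreal (exp (inner w v - (inner w (C w') + inner w (C w) / 2)))" for v
  have g1: "g1 \<in> borel_measurable (borel_on H)"
    unfolding g1_def[abs_def] using g exp_inner_measurable by (rule borel_measurable_times_ennreal)
  have g2: "(\<lambda>v. g (v + C w')) \<in> borel_measurable (borel_on H)"
    by (rule measurable_compose[OF translation_measurable g]) (rule C_in_H[OF w(2)])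
  have "(\<integral>\<^sup>+v. g (v + C (w + w')) \<partial>gauss) = (\<integral>\<^sup>+v. g ((v + C w) + C w') \<partial>gauss)"
    using w by (simp add: C_add add.assoc)
  also have "\<dots> = (\<integral>\<^sup>+v. g (v + C w') * e w v \<partial>gauss)"
    using cm(1)[unfolded cameron_martin_def, rule_format, OF g2] by (simp only: e_def)
  also have "\<dots> = (\<integral>\<^sup>+v. g1 (v + C w') \<partial>gauss)"
    by (simp add: g1_def e_def inner_add_right algebra_simps)
  also have "\<dots> = (\<integral>\<^sup>+v. g1 v * e w' v \<partial>gauss)"
    using cm(2)[unfolded cameron_martin_def, rule_format, OF g1] by (simp only: e_def)
  also have "\<dots> = (\<integral>\<^sup>+v. g v * e (w + w') v \<partial>gauss)"
  proof (rule nn_integral_cong)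
    fix v
    have "inner w' (C w) = inner w (C w')"
      using C_symmetric[OF w] by (simp add: inner_commute)
    then have "inner (w + w') v - inner (w + w') (C (w + w')) / 2 =
        (inner w v - (inner w (C w') + inner w (C w) / 2)) + (inner w' v - inner w' (C w') / 2)"
      using w by (simp add: C_add inner_add_left inner_add_right field_simps)
    then have "exp (inner (w + w') v - inner (w + w') (C (w + w')) / 2) =
        exp (inner w v - (inner w (C w') + inner w (C w) / 2)) * exp (inner w' v - inner w' (C w') / 2)"
      by (simp only: exp_add)
    then show "g1 v * e w' v = g v * e (w + w') v"
      by (simp only: g1_def e_def mult.assoc) (simp add: ennreal_mult)
  qed
  finally show "(\<integral>\<^sup>+v. g (v + C (w + w')) \<partial>gauss) =
      (\<integral>\<^sup>+v. g v * ennreal (exp (inner (w + w') v - inner (w + w') (C (w + w')) / 2)) \<partial>gauss)"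
    by (simp only: e_def)
qed

lemma cameron_martin_span:
  assumes "w \<in> span (range b)"
  shows "cameron_martin w"
proof -
  from assms have "cameron_martin w \<and> w \<in> H"
  proof (induction rule: span_induct_alt)
    case base
    show ?case using cameron_martin_basis[of 0 0] by simp
  next
    case (step c x y)
    then obtain k where k: "x = b k" by auto
    have "c *\<^sub>R b k \<in> H" by (simp add: H_scale)
    then show ?case
      using step(2) cameron_martin_basis[of c k] unfolding k by (simp add: cameron_martin_add H_add)
  qed
  then show ?thesis ..
qed

end

section \<open>Perturbed precision operators\<close>

text \<open>For symmetric \<open>\<Gamma>\<close>, the shift bound expresses 0 \<le> \<Gamma> \<le>
  2\<kappa>. This centred form suits a fixed-point argument: subtracting the midpoint leaves a
  perturbation of norm at most \<open>\<kappa>\<close>, half the bound on \<open>\<Gamma>\<close>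
  itself. The case \<open>\<kappa> = 0\<close> is included.\<close>

locale perturbed_gaussian = diagonal_covariance H b C \<mu>
  for H :: "'h::real_inner set" and b C \<mu> +
  fixes \<Gamma> :: "'h \<Rightarrow> 'h" and \<kappa> :: real
  assumes \<Gamma>_in_H: "x \<in> H \<Longrightarrow> \<Gamma> x \<in> H"
    and \<Gamma>_add: "x \<in> H \<Longrightarrow> y \<in> H \<Longrightarrow> \<Gamma> (x + y) = \<Gamma> x + \<Gamma> y"
    and \<Gamma>_scale: "x \<in> H \<Longrightarrow> \<Gamma> (c *\<^sub>R x) = c *\<^sub>R \<Gamma> x"
    and \<Gamma>_symmetric: "x \<in> H \<Longrightarrow> y \<in> H \<Longrightarrow> inner (\<Gamma> x) y = inner x (\<Gamma> y)"
    and \<Gamma>_nonneg: "x \<in> H \<Longrightarrow> 0 \<le> inner (\<Gamma> x) x"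
    and \<Gamma>_shift_bound: "x \<in> H \<Longrightarrow> norm (\<kappa> *\<^sub>R x - \<Gamma> x) \<le> \<kappa> * norm x"
    and \<kappa>_nonneg: "0 \<le> \<kappa>"
begin

lemma \<Gamma>_diff: "x \<in> H \<Longrightarrow> y \<in> H \<Longrightarrow> \<Gamma> (x - y) = \<Gamma> x - \<Gamma> y"
  using \<Gamma>_add[of x "(-1) *\<^sub>R y"] \<Gamma>_scale[of y "-1"] H_scale[of y "-1"] by simp

lemma norm_\<Gamma>: "x \<in> H \<Longrightarrow> norm (\<Gamma> x) \<le> 2 * \<kappa> * norm x"
proof -
  assume x: "x \<in> H"
  have "norm (\<Gamma> x) \<le> norm (\<kappa> *\<^sub>R x) + norm (\<kappa> *\<^sub>R x - \<Gamma> x)"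
    by (metis norm_triangle_sub norm_minus_commute)
  then show ?thesis using \<Gamma>_shift_bound[OF x] \<kappa>_nonneg by simp
qed

lemma \<Gamma>_tendsto:
  assumes "x \<longlonglongrightarrow> y" "\<And>n. x n \<in> H" "y \<in> H"
  shows "(\<lambda>n. \<Gamma> (x n)) \<longlonglongrightarrow> \<Gamma> y"
proof -
  have "(\<lambda>n. \<Gamma> (x n) - \<Gamma> y) \<longlonglongrightarrow> 0"
  proof (rule Lim_null_comparison)
    show "\<forall>\<^sub>F n in sequentially. norm (\<Gamma> (x n) - \<Gamma> y) \<le> 2 * \<kappa> * norm (x n - y)"
      using norm_\<Gamma>[OF H_diff[OF assms(2,3)]] by (simp add: \<Gamma>_diff assms(2,3))
    have "(\<lambda>n. 2 * \<kappa> * norm (x n - y)) \<longlonglongrightarrow> 2 * \<kappa> * norm (y - y)"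
      by (intro tendsto_intros assms(1))
    then show "(\<lambda>n. 2 * \<kappa> * norm (x n - y)) \<longlonglongrightarrow> 0" by simp
  qed
  then show ?thesis by (simp add: LIM_zero_iff)
qed

text \<open>\<open>P + \<Gamma>\<close> in the variable \<open>w = P v\<close>.\<close>

definition precision_sum :: "'h \<Rightarrow> 'h" where
  "precision_sum w = w + \<Gamma> (C w)"

lemma precision_sum_add: "w \<in> H \<Longrightarrow> w' \<in> H \<Longrightarrow> precision_sum (w + w') = precision_sum w + precision_sum w'"
  by (simp add: precision_sum_def C_add \<Gamma>_add C_in_H)

lemma precision_sum_diff: "w \<in> H \<Longrightarrow> w' \<in> H \<Longrightarrow> precision_sum (w - w') = precision_sum w - precision_sum w'"
  by (simp add: precision_sum_def C_diff \<Gamma>_diff C_in_H)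

lemma inner_precision_sum_pos:
  assumes "w \<in> H" "w \<noteq> 0"
  shows "0 < inner (precision_sum w) (C w)"
  using inner_C_pos[OF assms] \<Gamma>_nonneg[OF C_in_H[OF assms(1)]]
  by (simp add: precision_sum_def inner_add_left)

lemma inner_precision_sum_symmetric:
  assumes "w \<in> H" "w' \<in> H"
  shows "inner (precision_sum w) (C w') = inner (C w) (precision_sum w')"
  using assms C_symmetric[of w w'] \<Gamma>_symmetric[of "C w" "C w'"]
  by (simp add: precision_sum_def inner_add_left inner_add_right C_in_H)

text \<open>With \<open>\<Gamma>\<close> positive and \<open>C\<close> strictly positive, pairing
  with \<open>C w\<close> gives a strictly positive form, so only 0 can be sent to 0.\<close>

lemma precision_sum_inj: "inj_on precision_sum H"
proof (rule inj_onI, rule ccontr)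
  fix x y assume xy: "x \<in> H" "y \<in> H" "precision_sum x = precision_sum y" "x \<noteq> y"
  then have "0 < inner (precision_sum (x - y)) (C (x - y))"
    by (intro inner_precision_sum_pos) (simp_all add: H_diff)
  then show False using xy by (simp add: precision_sum_diff)
qed

text \<open>\<open>(P + \<Gamma>) v = a\<close> is solved by iterating \<open>v = (P + \<kappa>)\<inverse> (a + (\<kappa> - \<Gamma>) v)\<close>: the resolvent of \<open>P\<close> has norm
  less than \<open>1 / \<kappa>\<close> because \<open>C\<close> is bounded, and \<open>\<kappa> - \<Gamma>\<close> has norm at most \<open>\<kappa>\<close>.\<close>

lemma precision_sum_surj:
  assumes a: "a \<in> H"
  obtains w where "w \<in> H" "precision_sum w = a"
proof -
  obtain L where L: "0 < L" "\<And>j. \<mu> j \<le> L"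
  proof -
    have "\<mu> j \<le> suminf \<mu>" for j
      using sum_le_suminf[OF \<mu>_summable, of "{j}"] less_imp_le[OF \<mu>_pos] by simp
    then show thesis using that \<mu>_pos[of 0] by (meson less_le_trans)
  qed
  \<comment> \<open>\<open>t / (1 + \<kappa> * t)\<close> increases in \<open>t\<close>, so its
    value at the upper bound \<open>L\<close> of the eigenvalues bounds the resolvent; multiplied by
    \<open>\<kappa>\<close> it stays strictly below 1.\<close>
  define \<rho> where "\<rho> = L / (1 + \<kappa> * L)"
  have den: "0 < 1 + \<kappa> * \<mu> j" "0 < 1 + \<kappa> * L" for j
    using \<kappa>_nonneg less_imp_le[OF \<mu>_pos] L(1) by (auto intro!: add_pos_nonneg)
  have \<rho>: "0 < \<rho>" "\<rho> * \<kappa> < 1"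
    using den(2) L(1) by (simp_all add: \<rho>_def field_simps)
  have "\<exists>w. w \<in> H \<and> w + \<kappa> *\<^sub>R C w = x \<and> norm (C w) \<le> \<rho> * norm x" if x: "x \<in> H" for x
  proof -
    have "\<bar>1 / (1 + \<kappa> * \<mu> j)\<bar> \<le> 1" for j
      using den(1)[of j] \<kappa>_nonneg less_imp_le[OF \<mu>_pos[of j]] by (simp add: divide_le_eq)
    from diagonal_operator[OF x, of "\<lambda>j. 1 / (1 + \<kappa> * \<mu> j)", OF this]
    obtain w where w: "w \<in> H" "\<And>j. inner (b j) w = 1 / (1 + \<kappa> * \<mu> j) * inner (b j) x"
      by blast
    have "\<bar>\<mu> j / (1 + \<kappa> * \<mu> j)\<bar> \<le> \<rho>" for j
    proof -
      have "\<mu> j * (1 + \<kappa> * L) \<le> L * (1 + \<kappa> * \<mu> j)"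
        using L(2)[of j] by (simp add: algebra_simps)
      then have "\<mu> j / (1 + \<kappa> * \<mu> j) \<le> \<rho>"
        using den(1)[of j] den(2) by (simp add: \<rho>_def frac_le_eq divide_le_eq pos_le_divide_eq mult.commute)
      then show ?thesis using den(1)[of j] \<mu>_pos[of j] by simp
    qed
    \<comment> \<open>The norm bound is needed for \<open>C w\<close>, not for \<open>w\<close>. The
      image is therefore built separately from its own multipliers and identified with
      \<open>C w\<close> by coordinates.\<close>
    from diagonal_operator[OF x, of "\<lambda>j. \<mu> j / (1 + \<kappa> * \<mu> j)", OF this]
    obtain y where y: "y \<in> H" "\<And>j. inner (b j) y = \<mu> j / (1 + \<kappa> * \<mu> j) * inner (b j) x"
        "norm y \<le> \<rho> * norm x"
      by blast
    have "C w = y"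
      by (rule H_eqI) (simp_all add: C_in_H w y inner_b_C)
    moreover have "w + \<kappa> *\<^sub>R C w = x"
    proof (rule H_eqI)
      fix j
      have "inner (b j) (w + \<kappa> *\<^sub>R C w) = (1 + \<kappa> * \<mu> j) * inner (b j) w"
        by (simp add: inner_add_right inner_b_C w(1) algebra_simps)
      then show "inner (b j) (w + \<kappa> *\<^sub>R C w) = inner (b j) x"
        using den(1)[of j] by (simp add: w(2))
    qed (simp_all add: x w H_add H_scale C_in_H)
    ultimately show ?thesis using w(1) y(3) by blast
  qed
  then have "\<forall>x\<in>H. \<exists>w. w \<in> H \<and> w + \<kappa> *\<^sub>R C w = x \<and> norm (C w) \<le> \<rho> * norm x" by blast
  from bchoice[OF this] obtain R where R: "\<And>x. x \<in> H \<Longrightarrow> R x \<in> H" "\<And>x. x \<in> H \<Longrightarrow> R x + \<kappa> *\<^sub>R C (R x) = x"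
      "\<And>x. x \<in> H \<Longrightarrow> norm (C (R x)) \<le> \<rho> * norm x"
    by blast
  \<comment> \<open>\<open>R\<close> is obtained by choice and carries no linearity. Additivity is
    recovered from uniqueness: \<open>d + \<kappa> *\<^sub>R C d = 0\<close> forces
    \<open>d = 0\<close> by positivity of \<open>C\<close>.\<close>
  have R_diff: "R x - R y = R (x - y)" if "x \<in> H" "y \<in> H" for x y
  proof -
    let ?d = "R x - R y - R (x - y)"
    have d: "?d \<in> H" using that by (simp add: H_diff R)
    have Cd: "C ?d = C (R x) - C (R y) - C (R (x - y))"
      using that by (simp add: C_diff R H_diff)
    have "?d + \<kappa> *\<^sub>R C ?d = (R x + \<kappa> *\<^sub>R C (R x)) - (R y + \<kappa> *\<^sub>R C (R y)) - (R (x - y) + \<kappa> *\<^sub>R C (R (x - y)))"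
      unfolding Cd by (simp add: algebra_simps)
    also have "\<dots> = 0" using that by (simp add: R(2) H_diff)
    finally have "inner (?d + \<kappa> *\<^sub>R C ?d) ?d = 0" by simp
    then have "inner ?d ?d + \<kappa> * inner ?d (C ?d) = 0"
      by (simp only: inner_add_left inner_scaleR_left inner_commute[of "C ?d"])
    moreover have "0 \<le> \<kappa> * inner ?d (C ?d)"
      using \<kappa>_nonneg inner_C_nonneg[OF d] by simp
    ultimately have "inner ?d ?d = 0"
      using inner_ge_zero[of ?d] by linarith
    then show ?thesis by simp
  qed
  \<comment> \<open>The iteration runs in \<open>v = C w\<close>, the variable in which the
    resolvent bound holds; \<open>w\<close> is read off from the fixed point.\<close>
  let ?f = "\<lambda>v. C (R (a + (\<kappa> *\<^sub>R v - \<Gamma> v)))"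
  have in_H: "a + (\<kappa> *\<^sub>R v - \<Gamma> v) \<in> H" if "v \<in> H" for v
    using that a by (simp add: H_add H_diff H_scale \<Gamma>_in_H)
  have "\<exists>!v\<in>H. ?f v = v"
  proof (rule Banach_fix[OF complete_H, where c="\<rho> * \<kappa>"])
    show "H \<noteq> {}" using zero_in_H by blast
    show "0 \<le> \<rho> * \<kappa>" "\<rho> * \<kappa> < 1" using \<rho> \<kappa>_nonneg by simp_all
    show "?f ` H \<subseteq> H" using in_H by (auto intro: C_in_H R)
    show "dist (?f x) (?f y) \<le> \<rho> * \<kappa> * dist x y" if "x \<in> H" "y \<in> H" for x y
    proof -
      let ?z = "\<kappa> *\<^sub>R (x - y) - \<Gamma> (x - y)"
      have z: "?z \<in> H" using that by (simp add: H_diff H_scale \<Gamma>_in_H)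
      have "?f x - ?f y = C (R (a + (\<kappa> *\<^sub>R x - \<Gamma> x)) - R (a + (\<kappa> *\<^sub>R y - \<Gamma> y)))"
        using that by (simp add: C_diff R in_H)
      also have "\<dots> = C (R ((a + (\<kappa> *\<^sub>R x - \<Gamma> x)) - (a + (\<kappa> *\<^sub>R y - \<Gamma> y))))"
        using that by (simp only: R_diff in_H)
      also have "(a + (\<kappa> *\<^sub>R x - \<Gamma> x)) - (a + (\<kappa> *\<^sub>R y - \<Gamma> y)) = ?z"
        using that by (simp add: \<Gamma>_diff scaleR_diff_right)
      finally have "norm (?f x - ?f y) \<le> \<rho> * norm ?z"
        using R(3)[OF z] by simp
      also have "\<dots> \<le> \<rho> * (\<kappa> * norm (x - y))"
        using \<rho>(1) \<Gamma>_shift_bound[OF H_diff[OF that]] by (intro mult_left_mono) simp_all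
      finally show ?thesis by (simp add: dist_norm mult.assoc)
    qed
  qed
  then obtain v where v: "v \<in> H" "?f v = v" by blast
  define w where "w = R (a + (\<kappa> *\<^sub>R v - \<Gamma> v))"
  have w: "w \<in> H" "C w = v" using v in_H by (simp_all add: w_def R)
  have "w + \<kappa> *\<^sub>R C w = a + (\<kappa> *\<^sub>R v - \<Gamma> v)"
    unfolding w_def by (rule R(2)) (rule in_H[OF v(1)])
  then have "precision_sum w = a"
    using w(2) by (simp add: precision_sum_def)
  with w(1) show thesis by (rule that)
qed

lemma C_inj: "inj_on C H"
proof (rule inj_onI, rule ccontr)
  fix x y assume xy: "x \<in> H" "y \<in> H" "C x = C y" "x \<noteq> y"
  then have "0 < inner (x - y) (C (x - y))" by (intro inner_C_pos) (simp_all add: H_diff)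
  then show False using xy by (simp add: C_diff)
qed

text \<open>In the variable \<open>w\<close> with \<open>v = C w\<close> the perturbed precision
  operator is \<open>precision_sum\<close>, whose injectivity makes \<open>inv_into\<close> a
  genuine inverse at these values.\<close>

lemma perturbed_covariance_eq:
  assumes "w \<in> H"
  shows "perturbed_covariance H C \<Gamma> (precision_sum w) = C w"
proof -
  let ?g = "\<lambda>v. precision H C v + \<Gamma> v"
  have g: "?g (C x) = precision_sum x" if "x \<in> H" for x
    using that by (simp add: precision_def precision_sum_def inv_into_f_f[OF C_inj])
  have "inj_on ?g (C ` H)"
  proof (rule inj_onI)
    fix x y assume "x \<in> C ` H" "y \<in> C ` H" and eq: "?g x = ?g y"
    then obtain x' y' where x': "x = C x'" "x' \<in> H" and y': "y = C y'" "y' \<in> H" by blast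
    then have "precision_sum x' = precision_sum y'" using eq by (simp only: g)
    then have "x' = y'" using x'(2) y'(2) by (rule inj_onD[OF precision_sum_inj])
    then show "x = y" using x' y' by simp
  qed
  from inv_into_f_f[OF this, of "C w"] show ?thesis
    using assms by (simp add: perturbed_covariance_def g)
qed

section \<open>The tilted Gaussian measure and its marginals\<close>

definition quad :: "'h \<Rightarrow> real" where
  "quad v = inner (\<Gamma> v) v"

lemma \<Gamma>_measurable: "\<Gamma> \<in> measurable (borel_on H) (borel_on H)"
proof (rule measurable_borel_on)
  show "(\<lambda>v. inner (b j) (\<Gamma> v)) \<in> borel_measurable (borel_on H)" for j
    by (rule measurable_cong[THEN iffD2, OF _ inner_measurable[of "\<Gamma> (b j)"]])
      (simp add: \<Gamma>_symmetric)
qed (simp add: \<Gamma>_in_H)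

text \<open>Parseval writes the form as a series of products of real coordinates, so no joint
  measurability of the inner product enters.\<close>

lemma quad_measurable: "quad \<in> borel_measurable (borel_on H)"
proof -
  have "(\<lambda>v. \<Sum>j. inner (b j) (\<Gamma> v) * inner (b j) v) \<in> borel_measurable (borel_on H)"
    by (intro borel_measurable_suminf borel_measurable_times inner_measurable
        measurable_compose[OF \<Gamma>_measurable inner_measurable])
  then show ?thesis
    by (rule measurable_cong[THEN iffD2, rotated])
      (unfold quad_def, rule sums_unique[OF parseval], simp add: \<Gamma>_in_H)
qed

lemma quad_nonneg: "v \<in> H \<Longrightarrow> 0 \<le> quad v"
  unfolding quad_def by (rule \<Gamma>_nonneg)

definition mass :: real where
  "mass = (\<integral>v. exp (- quad v / 2) \<partial>gauss)"

lemma exp_quad_measurable: "(\<lambda>v. exp (- quad v / 2)) \<in> borel_measurable (borel_on H)"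
  using quad_measurable by measurable

lemma mass_bounds: "0 < mass" "mass \<le> 1" "(\<integral>\<^sup>+v. ennreal (exp (- quad v / 2)) \<partial>gauss) = ennreal mass"
proof -
  interpret gauss: prob_space gauss by (rule prob_gauss)
  have meas: "(\<lambda>v. exp (- quad v / 2)) \<in> borel_measurable gauss"
    using exp_quad_measurable by (simp only: measurable_cong_sets[OF sets_gauss refl])
  have int: "integrable gauss (\<lambda>v. exp (- quad v / 2))"
    by (rule gauss.integrable_const_bound[where B=1])
      (use meas quad_nonneg in \<open>auto intro!: AE_I2\<close>)
  show "(\<integral>\<^sup>+v. ennreal (exp (- quad v / 2)) \<partial>gauss) = ennreal mass"
    unfolding mass_def using int by (rule nn_integral_eq_integral) simp
  have "mass \<le> (\<integral>v. 1 \<partial>gauss)"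
    unfolding mass_def using int
    by (rule integral_mono) (use quad_nonneg in auto)
  then show "mass \<le> 1" using gauss.prob_space by simp
  have "0 \<le> mass" unfolding mass_def by (rule Bochner_Integration.integral_nonneg) simp
  moreover have "mass \<noteq> 0"
  proof
    assume "mass = 0"
    then have "AE v in gauss. exp (- quad v / 2) = 0"
      unfolding mass_def using int by (subst (asm) integral_nonneg_eq_0_iff_AE) simp_all
    then have "AE v in gauss. False" by simp
    then show False by simp
  qed
  ultimately show "0 < mass" by simp
qed

definition kernel_density :: "'h \<Rightarrow> ennreal" where
  "kernel_density v = ennreal (exp (- quad v / 2) / mass)"

lemma kernel_density_measurable: "kernel_density \<in> borel_measurable (borel_on H)"
  unfolding kernel_density_def[abs_def] using exp_quad_measurable by measurable

definition tilted :: "'h measure" where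
  "tilted = density gauss kernel_density"

lemma sets_tilted [simp]: "sets tilted = sets (borel_on H)"
  by (simp add: tilted_def)

lemma space_tilted [simp]: "space tilted = H"
  by (simp add: tilted_def)

lemma measurable_gauss_eq: "measurable gauss M = measurable (borel_on H) M"
  by (rule measurable_cong_sets[OF sets_gauss refl])

lemma measurable_tilted_eq: "measurable tilted M = measurable (borel_on H) M"
  by (rule measurable_cong_sets[OF sets_tilted refl])

lemma kernel_density_mass: "(\<integral>\<^sup>+v. kernel_density v \<partial>gauss) = 1"
proof -
  have "(\<integral>\<^sup>+v. kernel_density v \<partial>gauss) = (\<integral>\<^sup>+v. ennreal (exp (- quad v / 2)) * ennreal (1 / mass) \<partial>gauss)"
    using mass_bounds(1) by (simp add: kernel_density_def flip: ennreal_mult)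
  also have "\<dots> = ennreal mass * ennreal (1 / mass)"
  proof -
    have "(\<lambda>v. ennreal (exp (- quad v / 2))) \<in> borel_measurable gauss"
      unfolding measurable_gauss_eq by (rule measurable_compose[OF exp_quad_measurable measurable_ennreal])
    then show ?thesis unfolding mass_bounds(3)[symmetric] by (rule nn_integral_multc)
  qed
  also have "\<dots> = 1" using mass_bounds(1) by (simp flip: ennreal_mult)
  finally show ?thesis .
qed

lemma prob_tilted: "prob_space tilted"
proof (rule prob_spaceI)
  show "emeasure tilted (space tilted) = 1"
  proof -
    have "emeasure tilted (space gauss) = (\<integral>\<^sup>+v. kernel_density v * indicator (space gauss) v \<partial>gauss)"
      unfolding tilted_def
      by (rule emeasure_density) (simp_all only: measurable_gauss_eq kernel_density_measurable sets.top)
    also have "\<dots> = (\<integral>\<^sup>+v. kernel_density v \<partial>gauss)"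
      by (rule nn_integral_cong) simp
    finally show ?thesis by (simp add: kernel_density_mass)
  qed
qed

lemma nn_integral_tilted:
  assumes "g \<in> borel_measurable (borel_on H)"
  shows "(\<integral>\<^sup>+v. g v \<partial>tilted) = (\<integral>\<^sup>+v. kernel_density v * g v \<partial>gauss)"
  unfolding tilted_def
  by (rule nn_integral_density) (simp_all add: measurable_gauss_eq kernel_density_measurable assms)

lemma quad_diff:
  assumes "v \<in> H" "h \<in> H"
  shows "quad (v - h) = quad v - 2 * inner (\<Gamma> h) v + quad h"
  using assms \<Gamma>_symmetric[of v h]
  by (simp add: quad_def \<Gamma>_diff inner_diff_left inner_diff_right inner_commute)

text \<open>With \<open>h = C w\<close>, passing from \<open>- quad (v - h) / 2\<close> to
  \<open>- quad v / 2\<close> releases \<open>inner (\<Gamma> h) v\<close> minus half of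
  \<open>quad h\<close>. These terms turn \<open>w\<close> into \<open>precision_sum w\<close> in
  the exponent, and the normalising constant is the same on both sides.\<close>

lemma tilted_shift:
  assumes w: "w \<in> span (range b)" and g: "g \<in> borel_measurable (borel_on H)"
  shows "(\<integral>\<^sup>+v. g (v + C w) \<partial>tilted) =
    (\<integral>\<^sup>+v. g v * ennreal (exp (inner (precision_sum w) v - inner (precision_sum w) (C w) / 2)) \<partial>tilted)"
proof -
  have wH: "w \<in> H" using w closure_subset unfolding H_eq by (rule subsetD[rotated])
  let ?h = "C w"
  have h: "?h \<in> H" using wH by (rule C_in_H)
  \<comment> \<open>Evaluating the density at \<open>v - ?h\<close> makes the whole integrand a
    function of the shifted variable, as the Cameron--Martin formula requires.\<close>
  define f where "f v = kernel_density (v - ?h) * g v" for v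
  have shift_meas: "(\<lambda>v. v + x) \<in> measurable (borel_on H) (borel_on H)" if "x \<in> H" for x
    using that by (rule translation_measurable)
  have "- ?h \<in> H" using H_scale[OF h, of "-1"] by simp
  from measurable_compose[OF shift_meas[OF this] kernel_density_measurable]
  have kd: "(\<lambda>v. kernel_density (v - ?h)) \<in> borel_measurable (borel_on H)" by simp
  have f: "f \<in> borel_measurable (borel_on H)"
    unfolding f_def[abs_def] using kd g by (rule borel_measurable_times_ennreal)
  have "(\<integral>\<^sup>+v. g (v + ?h) \<partial>tilted) = (\<integral>\<^sup>+v. kernel_density v * g (v + ?h) \<partial>gauss)"
    by (rule nn_integral_tilted) (rule measurable_compose[OF shift_meas[OF h] g])
  also have "\<dots> = (\<integral>\<^sup>+v. f (v + ?h) \<partial>gauss)" by (simp add: f_def)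
  also have "\<dots> = (\<integral>\<^sup>+v. f v * ennreal (exp (inner w v - inner w ?h / 2)) \<partial>gauss)"
    using cameron_martin_span[OF w] f by (simp add: cameron_martin_def)
  also have "\<dots> = (\<integral>\<^sup>+v. kernel_density v *
      (g v * ennreal (exp (inner (precision_sum w) v - inner (precision_sum w) ?h / 2))) \<partial>gauss)"
  proof (rule nn_integral_cong)
    fix v assume "v \<in> space gauss"
    then have v: "v \<in> H" by simp
    have "- quad (v - ?h) / 2 + (inner w v - inner w ?h / 2) =
        - quad v / 2 + (inner (precision_sum w) v - inner (precision_sum w) ?h / 2)"
    proof -
      have "quad ?h = inner (\<Gamma> ?h) ?h" by (rule quad_def)
      then show ?thesis
        unfolding quad_diff[OF v h] precision_sum_def by (simp add: inner_add_left field_simps)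
    qed
    then have "exp (- quad (v - ?h) / 2) * exp (inner w v - inner w ?h / 2) =
        exp (- quad v / 2) * exp (inner (precision_sum w) v - inner (precision_sum w) ?h / 2)"
      by (simp only: exp_add[symmetric])
    then have "kernel_density (v - ?h) * ennreal (exp (inner w v - inner w ?h / 2)) =
        kernel_density v * ennreal (exp (inner (precision_sum w) v - inner (precision_sum w) ?h / 2))"
      using mass_bounds(1) by (simp add: kernel_density_def flip: ennreal_mult)
    moreover have "f v * ennreal (exp (inner w v - inner w ?h / 2)) =
        g v * (kernel_density (v - ?h) * ennreal (exp (inner w v - inner w ?h / 2)))"
      by (simp add: f_def mult_ac)
    ultimately show "f v * ennreal (exp (inner w v - inner w ?h / 2)) = kernel_density v *
        (g v * ennreal (exp (inner (precision_sum w) v - inner (precision_sum w) ?h / 2)))"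
      by (simp only: mult.left_commute)
  qed
  also have "\<dots> = (\<integral>\<^sup>+v. g v * ennreal (exp (inner (precision_sum w) v - inner (precision_sum w) ?h / 2)) \<partial>tilted)"
    by (rule nn_integral_tilted[symmetric]) (intro borel_measurable_times_ennreal g exp_inner_measurable)
  finally show ?thesis .
qed

lemma distr_tilted_prob: "real_distribution (distr tilted borel (inner a))"
proof -
  interpret tilted: prob_space tilted by (rule prob_tilted)
  show ?thesis
    by (rule tilted.real_distribution_distr) (simp only: measurable_tilted_eq inner_measurable)
qed

lemma char_tilted: "char (distr tilted borel (inner a)) t = (\<integral>v. iexp (t * inner a v) \<partial>tilted)"
  unfolding char_def
  by (rule integral_distr) (simp_all only: measurable_tilted_eq inner_measurable, measurable)

text \<open>The multiples \<open>s *\<^sub>R w\<close> yield the one-dimensional shift identities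
  with steps \<open>s * \<sigma>\<^sup>2\<close>, where \<open>\<sigma>\<^sup>2\<close> is the
  claimed variance. For \<open>w = 0\<close> the marginal is a point mass and has to be treated
  apart.\<close>

lemma distr_tilted_span:
  assumes w: "w \<in> span (range b)"
  shows "distr tilted borel (inner (precision_sum w)) =
    centred_normal (sqrt (inner (precision_sum w) (C w)))"
proof (cases "w = 0")
  case True
  have "precision_sum 0 = 0"
    using C_scale[of 0 0] \<Gamma>_scale[of 0 0] by (simp add: precision_sum_def)
  have zero: "inner (0 :: 'h) = (\<lambda>_. 0)" by (simp add: fun_eq_iff)
  interpret tilted: prob_space tilted by (rule prob_tilted)
  show ?thesis
    unfolding True \<open>precision_sum 0 = 0\<close> zero
    by (simp add: centred_normal_def tilted.distr_const)
next
  case False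
  have wH: "w \<in> H" using w closure_subset unfolding H_eq by (rule subsetD[rotated])
  let ?a = "precision_sum w" and ?h = "C w"
  define \<sigma> where "\<sigma> = sqrt (inner ?a ?h)"
  have pos: "0 < inner ?a ?h" using inner_precision_sum_pos[OF wH False] .
  then have \<sigma>: "0 < \<sigma>" "\<sigma>\<^sup>2 = inner ?a ?h" by (simp_all add: \<sigma>_def)
  interpret m: real_distribution "distr tilted borel (inner ?a)" by (rule distr_tilted_prob)
  have meas_a: "inner ?a \<in> measurable tilted borel"
    unfolding measurable_tilted_eq by (rule inner_measurable)
  have "distr tilted borel (inner ?a) = density lborel (\<lambda>x. ennreal (normal_density 0 \<sigma> x))"
  proof (rule normal_of_shift_density[OF m.prob_space_axioms m.events_eq_borel \<sigma>(1)])
    fix s :: real and g :: "real \<Rightarrow> ennreal" assume g: "g \<in> borel_measurable borel"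
    have sw: "s *\<^sub>R w \<in> span (range b)" using w by (rule span_scale)
    have ps: "precision_sum (s *\<^sub>R w) = s *\<^sub>R ?a"
      using wH by (simp add: precision_sum_def C_scale \<Gamma>_scale C_in_H scaleR_add_right)
    have g_shift: "(\<lambda>x. g (x + s * \<sigma>\<^sup>2)) \<in> borel_measurable borel"
      using g by measurable
    have ga: "(\<lambda>v. g (inner ?a v)) \<in> borel_measurable (borel_on H)"
      by (rule measurable_compose[OF inner_measurable g])
    have ge: "(\<lambda>x. g x * ennreal (exp (s * x - s\<^sup>2 * \<sigma>\<^sup>2 / 2))) \<in> borel_measurable borel"
      using g by measurable
    have "(\<integral>\<^sup>+x. g (x + s * \<sigma>\<^sup>2) \<partial>distr tilted borel (inner ?a)) = (\<integral>\<^sup>+v. g (inner ?a v + s * \<sigma>\<^sup>2) \<partial>tilted)"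
      by (rule nn_integral_distr[OF meas_a]) (simp add: g_shift)
    also have "\<dots> = (\<integral>\<^sup>+v. g (inner ?a (v + C (s *\<^sub>R w))) \<partial>tilted)"
      by (simp add: C_scale wH inner_add_right \<sigma>(2))
    also have "\<dots> = (\<integral>\<^sup>+v. g (inner ?a v) * ennreal (exp (inner (s *\<^sub>R ?a) v - inner (s *\<^sub>R ?a) (C (s *\<^sub>R w)) / 2)) \<partial>tilted)"
      using tilted_shift[OF sw ga] unfolding ps .
    also have "\<dots> = (\<integral>\<^sup>+v. g (inner ?a v) * ennreal (exp (s * inner ?a v - s\<^sup>2 * \<sigma>\<^sup>2 / 2)) \<partial>tilted)"
      by (simp add: C_scale wH \<sigma>(2) power2_eq_square[of s] mult.assoc)
    also have "\<dots> = (\<integral>\<^sup>+x. g x * ennreal (exp (s * x - s\<^sup>2 * \<sigma>\<^sup>2 / 2)) \<partial>distr tilted borel (inner ?a))"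
      by (rule nn_integral_distr[OF meas_a, symmetric]) (simp add: ge)
    finally show "(\<integral>\<^sup>+x. g (x + s * \<sigma>\<^sup>2) \<partial>distr tilted borel (inner ?a)) =
        (\<integral>\<^sup>+x. g x * ennreal (exp (s * x - s\<^sup>2 * \<sigma>\<^sup>2 / 2)) \<partial>distr tilted borel (inner ?a))" .
  qed
  then show ?thesis
    using \<sigma>(1) unfolding \<sigma>_def[symmetric] by (simp add: centred_normal_def)
qed

text \<open>Both characteristic functions converge along the partial sums of \<open>w\<close>: one
  by dominated convergence, the other because its exponent is continuous in
  \<open>precision_sum w\<close> and \<open>C w\<close>.\<close>

lemma distr_tilted:
  assumes w: "w \<in> H"
  shows "distr tilted borel (inner (precision_sum w)) =
    centred_normal (sqrt (inner (precision_sum w) (C w)))"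
proof (rule Levy_uniqueness[OF distr_tilted_prob])
  interpret tilted: prob_space tilted by (rule prob_tilted)
  have var0: "0 \<le> inner (precision_sum x) (C x)" if "x \<in> H" for x
    using \<Gamma>_nonneg[OF C_in_H[OF that]] inner_C_nonneg[OF that] by (simp add: precision_sum_def inner_add_left)
  show "real_distribution (centred_normal (sqrt (inner (precision_sum w) (C w))))"
    by (rule real_distribution_centred_normal) (simp add: var0 w)
  show "char (distr tilted borel (inner (precision_sum w))) =
      char (centred_normal (sqrt (inner (precision_sum w) (C w))))"
  proof
    fix t
    let ?w = "\<lambda>n. psum n w"
    have lim: "?w \<longlonglongrightarrow> w" using w by (rule psum_tendsto)
    have limC: "(\<lambda>n. C (?w n)) \<longlonglongrightarrow> C w" using lim psum_in_H w by (rule C_tendsto)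
    have limP: "(\<lambda>n. precision_sum (?w n)) \<longlonglongrightarrow> precision_sum w"
      unfolding precision_sum_def
      by (intro tendsto_add lim \<Gamma>_tendsto limC) (simp_all add: C_in_H w)
    have "(\<lambda>n. char (distr tilted borel (inner (precision_sum (?w n)))) t)
        \<longlonglongrightarrow> char (distr tilted borel (inner (precision_sum w))) t"
      unfolding char_tilted
    proof (rule integral_dominated_convergence[where w="\<lambda>_. 1"])
      have m: "(\<lambda>x. iexp (t * x)) \<in> borel_measurable borel" by measurable
      show "(\<lambda>v. iexp (t * inner a v)) \<in> borel_measurable tilted" for a
        unfolding measurable_tilted_eq by (rule measurable_compose[OF inner_measurable m])
      then show "(\<lambda>v. iexp (t * inner a v)) \<in> borel_measurable tilted" for a .
      show "AE v in tilted. (\<lambda>n. iexp (t * inner (precision_sum (?w n)) v)) \<longlonglongrightarrow> iexp (t * inner (precision_sum w) v)"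
        by (intro AE_I2 tendsto_intros limP)
    qed simp_all
    moreover have "(\<lambda>n. char (distr tilted borel (inner (precision_sum (?w n)))) t)
        \<longlonglongrightarrow> char (centred_normal (sqrt (inner (precision_sum w) (C w)))) t"
    proof -
      have "char (distr tilted borel (inner (precision_sum (?w n)))) t =
          of_real (exp (- (inner (precision_sum (?w n)) (C (?w n)) * t\<^sup>2) / 2))" for n
        unfolding distr_tilted_span[OF psum_in_span]
        by (subst char_centred_normal) (simp_all add: var0)
      moreover have "char (centred_normal (sqrt (inner (precision_sum w) (C w)))) t =
          of_real (exp (- (inner (precision_sum w) (C w) * t\<^sup>2) / 2))"
        by (subst char_centred_normal) (simp_all add: var0 w)
      moreover have "(\<lambda>n. complex_of_real (exp (- (inner (precision_sum (?w n)) (C (?w n)) * t\<^sup>2) / 2)))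
          \<longlonglongrightarrow> of_real (exp (- (inner (precision_sum w) (C w) * t\<^sup>2) / 2))"
        by (intro tendsto_intros limP limC) simp
      ultimately show ?thesis by (simp only:)
    qed
    ultimately show "char (distr tilted borel (inner (precision_sum w))) t =
        char (centred_normal (sqrt (inner (precision_sum w) (C w)))) t"
      by (rule LIMSEQ_unique)
  qed
qed

lemma tilted_second_moment:
  assumes w: "w \<in> H"
  shows "integrable tilted (\<lambda>v. (inner (precision_sum w) v)\<^sup>2)"
    and "(\<integral>v. (inner (precision_sum w) v)\<^sup>2 \<partial>tilted) = inner (precision_sum w) (C w)"
proof -
  let ?a = "precision_sum w"
  have meas: "inner ?a \<in> measurable tilted borel"
    unfolding measurable_tilted_eq by (rule inner_measurable)
  have var0: "0 \<le> inner ?a (C w)"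
    using \<Gamma>_nonneg[OF C_in_H[OF w]] inner_C_nonneg[OF w] by (simp add: precision_sum_def inner_add_left)
  have int: "integrable (distr tilted borel (inner ?a)) (\<lambda>x. x\<^sup>2)"
    "(\<integral>x. x\<^sup>2 \<partial>distr tilted borel (inner ?a)) = inner ?a (C w)"
    unfolding distr_tilted[OF w] using centred_normal_second_moment[of "sqrt (inner ?a (C w))"] var0 by simp_all
  show "integrable tilted (\<lambda>v. (inner ?a v)\<^sup>2)"
    using int(1) by (subst (asm) integrable_distr_eq[OF meas]) simp_all
  show "(\<integral>v. (inner ?a v)\<^sup>2 \<partial>tilted) = inner ?a (C w)"
    using int(2) by (subst (asm) integral_distr[OF meas]) simp_all
qed

text \<open>Surjectivity of \<open>precision_sum\<close> makes the known marginals cover every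
  direction, and polarisation of the second moments gives the covariances.\<close>

lemma tilted_is_centred_gaussian: "is_centred_gaussian H (perturbed_covariance H C \<Gamma>) tilted"
  unfolding is_centred_gaussian_def
proof (intro conjI ballI prob_tilted sets_tilted)
  fix a assume a: "a \<in> H"
  then obtain w where w: "w \<in> H" "precision_sum w = a" by (rule precision_sum_surj)
  show "\<exists>\<sigma>\<ge>0. distr tilted borel (inner a) = centred_normal \<sigma>"
  proof (intro exI conjI)
    show "0 \<le> sqrt (inner a (C w))"
      using \<Gamma>_nonneg[OF C_in_H[OF w(1)]] inner_C_nonneg[OF w(1)] w(2)[symmetric]
      by (simp add: precision_sum_def inner_add_left)
    show "distr tilted borel (inner a) = centred_normal (sqrt (inner a (C w)))"
      using distr_tilted[OF w(1)] unfolding w(2) .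
  qed
  fix c assume "c \<in> H"
  then obtain z where z: "z \<in> H" "precision_sum z = c" by (rule precision_sum_surj)
  have wz: "w + z \<in> H" "precision_sum (w + z) = a + c"
    using w z by (simp_all add: H_add precision_sum_add)
  have polar: "inner a v * inner c v = ((inner (a + c) v)\<^sup>2 - (inner a v)\<^sup>2 - (inner c v)\<^sup>2) / 2" for v
    by (simp add: inner_add_left power2_eq_square algebra_simps)
  have mom: "integrable tilted (\<lambda>v. (inner (a + c) v)\<^sup>2)" "integrable tilted (\<lambda>v. (inner a v)\<^sup>2)"
    "integrable tilted (\<lambda>v. (inner c v)\<^sup>2)"
    "(\<integral>v. (inner (a + c) v)\<^sup>2 \<partial>tilted) = inner (a + c) (C (w + z))"
    "(\<integral>v. (inner a v)\<^sup>2 \<partial>tilted) = inner a (C w)" "(\<integral>v. (inner c v)\<^sup>2 \<partial>tilted) = inner c (C z)"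
    using tilted_second_moment[OF wz(1)] tilted_second_moment[OF w(1)] tilted_second_moment[OF z(1)]
    unfolding wz(2) w(2) z(2) by simp_all
  \<comment> \<open>Symmetry of the perturbed precision operator makes the two mixed terms of the
    polarised form equal.\<close>
  have sym: "inner a (C z) = inner (C w) c"
    using inner_precision_sum_symmetric[OF w(1) z(1)] unfolding w(2) z(2) .
  have "(\<integral>v. inner a v * inner c v \<partial>tilted) = (inner (a + c) (C (w + z)) - inner a (C w) - inner c (C z)) / 2"
    unfolding polar using mom by simp
  also have "\<dots> = inner (C w) c"
    using sym w(1) z(1) by (simp add: C_add inner_add_left inner_add_right inner_commute[of c])
  also have "C w = perturbed_covariance H C \<Gamma> a"
    using perturbed_covariance_eq[OF w(1)] unfolding w(2) by simp
  finally show "(\<integral>v. inner a v * inner c v \<partial>tilted) = inner (perturbed_covariance H C \<Gamma> a) c" .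
qed

text \<open>A second Gaussian with this covariance has the same variance in each direction, hence
  the same centred normal marginals, and marginals in all directions determine the measure.\<close>

theorem gaussian_eq_tilted: "gaussian H (perturbed_covariance H C \<Gamma>) = tilted"
  unfolding gaussian_def
proof (rule the_equality)
  show "is_centred_gaussian H (perturbed_covariance H C \<Gamma>) tilted"
    by (rule tilted_is_centred_gaussian)
  fix m assume m: "is_centred_gaussian H (perturbed_covariance H C \<Gamma>) m"
  then have m': "prob_space m" "sets m = sets (borel_on H)" by (simp_all add: is_centred_gaussian_def)
  show "m = tilted"
  proof (rule cramer_wold[OF m' prob_tilted sets_tilted])
    fix a assume a: "a \<in> H"
    have marginal: "\<exists>\<sigma>\<ge>0. distr L borel (inner a) = centred_normal \<sigma> \<and>
        \<sigma>\<^sup>2 = inner (perturbed_covariance H C \<Gamma> a) a"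
      if L: "is_centred_gaussian H (perturbed_covariance H C \<Gamma>) L" for L
    proof -
      obtain \<sigma> where \<sigma>: "\<sigma> \<ge> 0" "distr L borel (inner a) = centred_normal \<sigma>"
        using L a by (auto simp: is_centred_gaussian_def)
      have s: "sets L = sets (borel_on H)" using L by (simp add: is_centred_gaussian_def)
      have meas: "inner a \<in> measurable L borel"
        unfolding measurable_cong_sets[OF s refl] by (rule inner_measurable)
      have "inner (perturbed_covariance H C \<Gamma> a) a = (\<integral>v. inner a v * inner a v \<partial>L)"
        using L a by (simp add: is_centred_gaussian_def)
      also have "\<dots> = (\<integral>x. x\<^sup>2 \<partial>distr L borel (inner a))"
        by (subst integral_distr[OF meas]) (simp_all add: power2_eq_square)
      also have "\<dots> = \<sigma>\<^sup>2" unfolding \<sigma>(2) by (rule centred_normal_second_moment(2)[OF \<sigma>(1)])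
      finally show ?thesis using \<sigma> by auto
    qed
    from marginal[OF m] marginal[OF tilted_is_centred_gaussian]
    show "distr m borel (inner a) = distr tilted borel (inner a)"
      by (metis power2_eq_imp_eq)
  qed
qed

end

section \<open>Doeblin minorization\<close>

text \<open>\<open>g\<close> is the density of a common part, of mass \<open>\<epsilon>\<close>, of
  all transition laws. The bound \<open>\<epsilon> < 1\<close> is strict because the contraction
  argument divides by \<open>1 - \<epsilon>\<close>.\<close>

locale doeblin =
  fixes G :: "'a measure" and K :: "'a \<Rightarrow> 'a measure"
    and k :: "'a \<Rightarrow> 'a \<Rightarrow> ennreal" and g :: "'a \<Rightarrow> ennreal" and \<epsilon> :: real
  assumes prob_G: "prob_space G"
    and k_measurable: "(\<lambda>(u, v). k u v) \<in> borel_measurable (G \<Otimes>\<^sub>M G)"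
    and g_measurable [measurable]: "g \<in> borel_measurable G"
    and K_eq: "\<And>u. u \<in> space G \<Longrightarrow> K u = density G (k u)"
    and K_mass: "\<And>u. u \<in> space G \<Longrightarrow> (\<integral>\<^sup>+ v. k u v \<partial>G) = 1"
    and g_le: "\<And>u v. u \<in> space G \<Longrightarrow> v \<in> space G \<Longrightarrow> g v \<le> k u v"
    and g_mass: "(\<integral>\<^sup>+ v. g v \<partial>G) = ennreal \<epsilon>"
    and \<epsilon>: "0 < \<epsilon>" "\<epsilon> < 1"
begin

sublocale G: prob_space G by (rule prob_G)

lemma k_measurable1 [measurable]: "u \<in> space G \<Longrightarrow> k u \<in> borel_measurable G"
  using measurable_Pair2[OF k_measurable] by simp

lemma k_measurable2 [measurable]:
  assumes "f \<in> measurable M G" "h \<in> measurable M G"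
  shows "(\<lambda>x. k (f x) (h x)) \<in> borel_measurable M"
  using measurable_compose[OF measurable_Pair[OF assms] k_measurable] by simp

sublocale GG: pair_sigma_finite G G ..

lemma prob_K: "prob_space (K u)" if "u \<in> space G"
  using that K_mass[OF that]
  by (intro prob_spaceI) (simp add: K_eq emeasure_density cong: nn_integral_cong)

lemma K_measurable [measurable]: "K \<in> measurable G (prob_algebra G)"
proof (intro measurable_prob_algebraI measurable_subprob_algebra)
  fix A assume [measurable]: "A \<in> sets G"
  have "(\<lambda>u. \<integral>\<^sup>+ v. k u v * indicator A v \<partial>G) \<in> borel_measurable G"
    by measurable
  then show "(\<lambda>u. emeasure (K u) A) \<in> borel_measurable G"
    by (rule measurable_cong[THEN iffD2, rotated]) (simp add: K_eq emeasure_density)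
qed (use prob_K K_eq in \<open>auto simp: prob_space_imp_subprob_space\<close>)

lemma K_measurable_subprob [measurable]: "K \<in> measurable G (subprob_algebra G)"
  by (rule measurable_prob_algebraD) measurable

text \<open>The invariant density is the Neumann series of the residual kernel \<open>k - g\<close> started in \<open>g\<close>.\<close>

primrec residual :: "nat \<Rightarrow> 'a \<Rightarrow> ennreal" where
  "residual 0 v = g v"
| "residual (Suc n) v = (\<integral>\<^sup>+ u. residual n u * (k u v - g v) \<partial>G)"

definition invariant_density :: "'a \<Rightarrow> ennreal" where
  "invariant_density v = (\<Sum>n. residual n v)"

lemma residual_measurable [measurable]: "residual n \<in> borel_measurable G"
proof (induction n)
  case 0
  show ?case by (simp add: g_measurable cong: measurable_cong)
next
  case (Suc n)
  note [measurable] = Suc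
  show ?case by simp
qed

lemma invariant_density_measurable [measurable]: "invariant_density \<in> borel_measurable G"
  unfolding invariant_density_def[abs_def] by measurable

text \<open>For each \<open>u\<close> the residual \<open>k u v - g v\<close> has mass
  \<open>1 - \<epsilon>\<close> in \<open>v\<close>, so by Tonelli every step multiplies the mass by
  this factor.\<close>

lemma residual_mass: "(\<integral>\<^sup>+ v. residual n v \<partial>G) = ennreal (\<epsilon> * (1 - \<epsilon>) ^ n)"
proof (induction n)
  case 0
  show ?case by (simp add: g_mass)
next
  case (Suc n)
  have "(\<integral>\<^sup>+ v. residual (Suc n) v \<partial>G) = (\<integral>\<^sup>+ u. \<integral>\<^sup>+ v. residual n u * (k u v - g v) \<partial>G \<partial>G)"
    by (simp, subst GG.Fubini') (auto simp: split_beta')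
  also have "\<dots> = (\<integral>\<^sup>+ u. residual n u * ennreal (1 - \<epsilon>) \<partial>G)"
  proof (rule nn_integral_cong)
    fix u assume [measurable]: "u \<in> space G"
    have "(\<integral>\<^sup>+ v. k u v - g v \<partial>G) = 1 - ennreal \<epsilon>"
      using \<open>u \<in> space G\<close> by (subst nn_integral_diff) (auto simp: K_mass g_mass g_le)
    then show "(\<integral>\<^sup>+ v. residual n u * (k u v - g v) \<partial>G) = residual n u * ennreal (1 - \<epsilon>)"
      using \<epsilon> by (simp add: nn_integral_cmult ennreal_minus flip: ennreal_1)
  qed
  also have "\<dots> = ennreal (\<epsilon> * (1 - \<epsilon>) ^ Suc n)"
    using \<epsilon> Suc
    by (subst nn_integral_multc) (simp_all add: ac_simps flip: ennreal_mult)
  finally show ?case .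
qed

lemma invariant_density_mass: "(\<integral>\<^sup>+ v. invariant_density v \<partial>G) = 1"
proof -
  have "(\<lambda>n. \<epsilon> * (1 - \<epsilon>) ^ n) sums (\<epsilon> * (1 / (1 - (1 - \<epsilon>))))"
    using \<epsilon> by (intro sums_mult geometric_sums) auto
  then have "(\<lambda>n. \<epsilon> * (1 - \<epsilon>) ^ n) sums 1" using \<epsilon> by simp
  then have "(\<Sum>n. ennreal (\<epsilon> * (1 - \<epsilon>) ^ n)) = ennreal 1"
    using \<epsilon> by (intro suminf_ennreal_eq) auto
  then show ?thesis
    by (simp add: invariant_density_def nn_integral_suminf residual_mass)
qed

text \<open>The residual part of \<open>k\<close> shifts the Neumann series by one place. The
  \<open>g\<close> part contributes the missing zeroth term, because the invariant density has total
  mass 1.\<close>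

lemma invariant_density_fixpoint:
  assumes [measurable]: "v \<in> space G"
  shows "(\<integral>\<^sup>+ u. invariant_density u * k u v \<partial>G) = invariant_density v"
proof -
  have "(\<integral>\<^sup>+ u. invariant_density u * k u v \<partial>G) =
      (\<integral>\<^sup>+ u. invariant_density u * (k u v - g v) + invariant_density u * g v \<partial>G)"
  proof (rule nn_integral_cong)
    fix u assume "u \<in> space G"
    \<comment> \<open>Truncated subtraction can be undone because \<open>g\<close> lies below the
      transition density.\<close>
    then have "k u v = (k u v - g v) + g v"
      using g_le assms by (simp add: diff_add_cancel_ennreal)
    then show "invariant_density u * k u v =
        invariant_density u * (k u v - g v) + invariant_density u * g v"
      by (metis distrib_left)
  qed
  also have "\<dots> = (\<integral>\<^sup>+ u. invariant_density u * (k u v - g v) \<partial>G) + g v"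
    by (subst nn_integral_add) (auto simp: nn_integral_multc invariant_density_mass)
  also have "(\<integral>\<^sup>+ u. invariant_density u * (k u v - g v) \<partial>G) = (\<Sum>n. residual (Suc n) v)"
    unfolding invariant_density_def ennreal_suminf_multc[symmetric]
    by (subst nn_integral_suminf) auto
  also have "\<dots> + g v = invariant_density v"
    unfolding invariant_density_def
    using suminf_offset[of "\<lambda>n. residual n v" 1] by (simp add: add.commute)
  finally show ?thesis .
qed

definition stationary :: "'a measure" where
  "stationary = density G invariant_density"

lemma space_stationary [simp]: "space stationary = space G"
  and sets_stationary [simp, measurable_cong]: "sets stationary = sets G"
  by (simp_all add: stationary_def)

lemma invariant_stationary: "invariant_distribution G K stationary"
  unfolding invariant_distribution_def
proof (intro conjI)
  show "prob_space stationary"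
    by (intro prob_spaceI)
      (simp add: stationary_def emeasure_density invariant_density_mass cong: nn_integral_cong)
  show "sets stationary = sets G" by simp
  have K: "K \<in> measurable stationary (subprob_algebra G)"
    by measurable
  have ne: "space stationary \<noteq> {}" using G.not_empty by simp
  show "stationary \<bind> K = stationary"
  proof (rule measure_eqI)
    show s: "sets (stationary \<bind> K) = sets stationary"
      using sets_bind[OF _ ne, of K G] K_eq by simp
    fix A assume "A \<in> sets (stationary \<bind> K)"
    then have [measurable]: "A \<in> sets G" using s by simp
    have "emeasure (stationary \<bind> K) A = (\<integral>\<^sup>+ u. emeasure (K u) A \<partial>stationary)"
      by (rule emeasure_bind[OF ne K]) measurable
    also have "\<dots> = (\<integral>\<^sup>+ u. invariant_density u * (\<integral>\<^sup>+ v. k u v * indicator A v \<partial>G) \<partial>G)"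
      unfolding stationary_def
      by (subst nn_integral_density) (auto simp: K_eq emeasure_density intro!: nn_integral_cong)
    also have "\<dots> = (\<integral>\<^sup>+ u. \<integral>\<^sup>+ v. invariant_density u * k u v * indicator A v \<partial>G \<partial>G)"
      by (intro nn_integral_cong) (simp add: nn_integral_cmult mult.assoc)
    also have "\<dots> = (\<integral>\<^sup>+ v. \<integral>\<^sup>+ u. invariant_density u * k u v * indicator A v \<partial>G \<partial>G)"
      by (subst GG.Fubini') auto
    also have "\<dots> = (\<integral>\<^sup>+ v. invariant_density v * indicator A v \<partial>G)"
      by (intro nn_integral_cong) (simp add: nn_integral_multc invariant_density_fixpoint)
    also have "\<dots> = emeasure stationary A"
      by (simp add: stationary_def emeasure_density)
    finally show "emeasure (stationary \<bind> K) A = emeasure stationary A" .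
  qed
qed

section \<open>Iterated kernels and contraction\<close>

lemma step_cong:
  assumes "prob_space \<mu>" "sets \<mu> = sets G"
  shows "prob_space (\<mu> \<bind> K)" "sets (\<mu> \<bind> K) = sets G"
proof -
  interpret \<mu>: prob_space \<mu> by fact
  have K: "K \<in> measurable \<mu> (subprob_algebra G)"
    using K_measurable_subprob by (simp cong: measurable_cong_sets add: assms(2))
  have sp: "space \<mu> = space G" using assms(2) by (rule sets_eq_imp_space_eq)
  show "prob_space (\<mu> \<bind> K)"
    by (rule \<mu>.prob_space_bind[OF AE_I2 K]) (simp add: sp prob_K)
  show "sets (\<mu> \<bind> K) = sets G"
    by (rule sets_bind) (auto simp: sp K_eq G.not_empty)
qed

text \<open>\<open>n_step\<close> starts from points only; arbitrary initial laws allow a point mass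
  to be compared with an invariant law.\<close>

definition iter :: "nat \<Rightarrow> 'a measure \<Rightarrow> 'a measure" where
  "iter n = (\<lambda>\<mu>. \<mu> \<bind> K) ^^ n"

lemma iter_Suc: "iter (Suc n) \<mu> = iter n \<mu> \<bind> K"
  by (simp add: iter_def)

lemma iter_prob:
  assumes "prob_space \<mu>" "sets \<mu> = sets G"
  shows "prob_space (iter n \<mu>)" "sets (iter n \<mu>) = sets G"
proof (induction n)
  case 0
  { case 1 show ?case by (simp add: iter_def assms) }
  { case 2 show ?case by (simp add: iter_def assms) }
next
  case (Suc n)
  { case 1 show ?case unfolding iter_Suc using Suc by (rule step_cong) }
  { case 2 show ?case unfolding iter_Suc using Suc by (rule step_cong) }
qed

lemma n_step_eq_iter: "n_step G K n u = iter n (return G u)"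
  by (induction n) (simp_all add: iter_Suc, simp add: iter_def)

lemma iter_invariant: "invariant_distribution G K \<pi> \<Longrightarrow> iter n \<pi> = \<pi>"
  by (induction n) (simp_all add: iter_def invariant_distribution_def)

text \<open>The estimate is propagated through test functions. The kernel maps a [0, 1]-valued
  function to one with range in an interval of length \<open>1 - \<epsilon>\<close>, and rescaling
  that interval gives an admissible test function again. The additive constant cancels between the
  two initial laws.\<close>

lemma contraction:
  assumes f: "f \<in> borel_measurable G" "\<And>x. 0 \<le> f x \<and> f x \<le> (1::real)"
    and \<mu>: "prob_space \<mu>" "sets \<mu> = sets G" and \<nu>: "prob_space \<nu>" "sets \<nu> = sets G"
  shows "\<bar>(\<integral>x. f x \<partial>iter n \<mu>) - (\<integral>x. f x \<partial>iter n \<nu>)\<bar> \<le> (1 - \<epsilon>) ^ n"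
  using f
proof (induction n arbitrary: f)
  case 0
  have "0 \<le> (\<integral>x. f x \<partial>m) \<and> (\<integral>x. f x \<partial>m) \<le> 1" if "prob_space m" "sets m = sets G" for m
  proof -
    interpret m: prob_space m by fact
    have [measurable]: "f \<in> borel_measurable m"
      using 0 that by (simp cong: measurable_cong_sets)
    have "integrable m f"
      by (rule m.integrable_const_bound[where B=1]) (use 0 in auto)
    then have "(\<integral>x. f x \<partial>m) \<le> (\<integral>x. 1 \<partial>m)"
      by (rule integral_mono) (use 0 in auto)
    then show ?thesis using 0 by (auto simp: m.prob_space intro!: integral_nonneg)
  qed
  from this[OF \<mu>] this[OF \<nu>] show ?case unfolding iter_def abs_le_iff by simp
next
  case (Suc n)
  note [measurable] = Suc.prems(1)
  define Kf where "Kf u = (\<integral>v. f v \<partial>K u)" for u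
  \<comment> \<open>The contribution of the minorising part, which every starting point
    shares.\<close>
  define c where "c = (\<integral>v. f v \<partial>density G g)"
  have g_le_K: "(\<integral>v. h v \<partial>density G g) \<le> (\<integral>v. h v \<partial>K u)"
    if [measurable]: "h \<in> borel_measurable G" and h: "\<And>x. 0 \<le> h x \<and> h x \<le> (1::real)" and u: "u \<in> space G"
    for h u
  proof -
    have "(\<integral>v. h v \<partial>density G g) = enn2real (\<integral>\<^sup>+v. g v * ennreal (h v) \<partial>G)"
      using h by (subst integral_eq_nn_integral) (auto simp: nn_integral_density)
    also have "\<dots> \<le> enn2real (\<integral>\<^sup>+v. k u v * ennreal (h v) \<partial>G)"
    proof (rule enn2real_mono)
      show "(\<integral>\<^sup>+v. g v * ennreal (h v) \<partial>G) \<le> (\<integral>\<^sup>+v. k u v * ennreal (h v) \<partial>G)"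
        using g_le[OF u] by (intro nn_integral_mono mult_right_mono) auto
      have "(\<integral>\<^sup>+v. k u v * ennreal (h v) \<partial>G) \<le> (\<integral>\<^sup>+v. k u v * 1 \<partial>G)"
        using h by (intro nn_integral_mono mult_left_mono) (auto simp: ennreal_le_1)
      then show "(\<integral>\<^sup>+v. k u v * ennreal (h v) \<partial>G) < \<top>"
        using K_mass[OF u] by (auto intro: le_less_trans)
    qed
    also have "\<dots> = (\<integral>v. h v \<partial>K u)"
      using h u by (subst integral_eq_nn_integral) (auto simp: nn_integral_density K_eq)
    finally show ?thesis .
  qed
  have Kf: "c \<le> Kf u" "Kf u \<le> c + (1 - \<epsilon>)" if u: "u \<in> space G" for u
  proof -
    interpret Ku: prob_space "K u" using u by (rule prob_K)
    interpret g: finite_measure "density G g"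
      by (rule finite_measureI) (simp add: emeasure_density g_mass cong: nn_integral_cong)
    show "c \<le> Kf u"
      unfolding c_def Kf_def using Suc.prems u by (intro g_le_K) auto
    have K: "f \<in> borel_measurable (K u)" using u by (simp add: K_eq)
    have "integrable (K u) f"
      by (rule Ku.integrable_const_bound[where B=1]) (use Suc.prems K in auto)
    moreover have "integrable (density G g) f"
      by (rule g.integrable_const_bound[where B=1]) (use Suc.prems in auto)
    moreover have "measure (density G g) (space G) = \<epsilon>"
      using \<epsilon> by (simp add: measure_def emeasure_density g_mass cong: nn_integral_cong)
    \<comment> \<open>The lower bound applied to \<open>1 - f\<close> becomes the upper bound for
      \<open>f\<close>; the gap \<open>1 - \<epsilon>\<close> is the difference of the two total
      masses.\<close>
    moreover have "(\<integral>v. 1 - f v \<partial>density G g) \<le> (\<integral>v. 1 - f v \<partial>K u)"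
      using Suc.prems u by (intro g_le_K) (auto simp: algebra_simps)
    ultimately show "Kf u \<le> c + (1 - \<epsilon>)"
      using Ku.prob_space by (simp add: c_def Kf_def)
  qed
  \<comment> \<open>The default 0 outside the space keeps \<open>h\<close> within [0, 1] at every
    argument, as the induction hypothesis demands.\<close>
  define h where "h u = (if u \<in> space G then (Kf u - c) / (1 - \<epsilon>) else 0)" for u
  have Kf_meas [measurable]: "Kf \<in> borel_measurable G"
    unfolding Kf_def[abs_def]
    by (rule measurable_compose[OF K_measurable_subprob integral_measurable_subprob_algebra]) measurable
  have h_meas [measurable]: "h \<in> borel_measurable G"
    unfolding h_def[abs_def] by measurable
  have h: "0 \<le> h u \<and> h u \<le> 1" for u
    using Kf[of u] \<epsilon> by (auto simp: h_def field_simps)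
  have eq: "(\<integral>x. f x \<partial>iter (Suc n) m) = c + (1 - \<epsilon>) * (\<integral>x. h x \<partial>iter n m)"
    if m: "prob_space m" "sets m = sets G" for m
  proof -
    interpret m: prob_space "iter n m" using m by (rule iter_prob)
    have sets[measurable_cong]: "sets (iter n m) = sets G" using m by (rule iter_prob)
    then have sp: "space (iter n m) = space G" by (rule sets_eq_imp_space_eq)
    have K: "K \<in> measurable (iter n m) (subprob_algebra G)" by measurable
    have "(\<integral>x. f x \<partial>iter (Suc n) m) = (\<integral>u. Kf u \<partial>iter n m)"
      unfolding iter_Suc Kf_def
      by (rule integral_bind[OF _ _ K, where B'=1 and B=1])
        (use Suc.prems(2) sp m.finite_measure_axioms in
          \<open>auto intro!: AE_I2 simp: prob_space.emeasure_space_1[OF prob_K]\<close>)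
    also have "\<dots> = (\<integral>u. c + (1 - \<epsilon>) * h u \<partial>iter n m)"
      using \<epsilon> by (intro Bochner_Integration.integral_cong) (auto simp: h_def sp)
    also have "\<dots> = c + (1 - \<epsilon>) * (\<integral>x. h x \<partial>iter n m)"
    proof -
      have "integrable (iter n m) h"
        by (rule m.integrable_const_bound[where B=1]) (use h in auto)
      then show ?thesis by (simp add: m.prob_space)
    qed
    finally show ?thesis .
  qed
  have "(\<integral>x. f x \<partial>iter (Suc n) \<mu>) - (\<integral>x. f x \<partial>iter (Suc n) \<nu>) =
      (1 - \<epsilon>) * ((\<integral>x. h x \<partial>iter n \<mu>) - (\<integral>x. h x \<partial>iter n \<nu>))"
    by (simp add: eq[OF \<mu>] eq[OF \<nu>] algebra_simps)
  then show ?case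
    using Suc.IH[OF h_meas h] \<epsilon> by (simp add: abs_mult mult_left_mono)
qed

text \<open>Indicators serve as test functions. The empty set gives the lower bound 0, which the
  later sandwich argument uses.\<close>

lemma tv_contraction:
  assumes \<mu>: "prob_space \<mu>" "sets \<mu> = sets G" and \<nu>: "prob_space \<nu>" "sets \<nu> = sets G"
  shows "\<And>A. A \<in> sets G \<Longrightarrow> \<bar>measure (iter n \<mu>) A - measure (iter n \<nu>) A\<bar> \<le> (1 - \<epsilon>) ^ n"
    and "tv_dist (iter n \<mu>) (iter n \<nu>) \<le> (1 - \<epsilon>) ^ n"
    and "0 \<le> tv_dist (iter n \<mu>) (iter n \<nu>)"
proof -
  have s: "sets (iter n \<mu>) = sets G" "sets (iter n \<nu>) = sets G"
    using iter_prob(2)[OF \<mu>] iter_prob(2)[OF \<nu>] by simp_all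
  then have sp: "space (iter n \<mu>) = space G" "space (iter n \<nu>) = space G"
    by (auto dest: sets_eq_imp_space_eq)
  show *: "\<bar>measure (iter n \<mu>) A - measure (iter n \<nu>) A\<bar> \<le> (1 - \<epsilon>) ^ n" if A: "A \<in> sets G" for A
  proof -
    have "A \<subseteq> space G" using A by (rule sets.sets_into_space)
    then show ?thesis
      using contraction[OF _ _ \<mu> \<nu>, of "indicator A" n] A s
      by (simp add: sp Int_absorb2)
  qed
  show "tv_dist (iter n \<mu>) (iter n \<nu>) \<le> (1 - \<epsilon>) ^ n"
    unfolding tv_dist_def s by (rule cSUP_least) (auto intro: * simp: sets.empty_sets)
  show "0 \<le> tv_dist (iter n \<mu>) (iter n \<nu>)"
    unfolding tv_dist_def s
    by (rule cSUP_upper2[where x="{}"]) (auto intro!: bdd_aboveI2 *)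
qed

text \<open>Iteration fixes both invariant laws, so their difference on any set lies below every
  power of \<open>1 - \<epsilon>\<close>.\<close>

lemma stationary_unique:
  assumes "invariant_distribution G K \<pi>"
  shows "\<pi> = stationary"
proof (rule measure_eqI)
  have \<pi>: "prob_space \<pi>" "sets \<pi> = sets G"
    and \<sigma>: "prob_space stationary" "sets stationary = sets G"
    using assms invariant_stationary by (auto simp: invariant_distribution_def)
  interpret \<pi>: prob_space \<pi> by fact
  interpret \<sigma>: prob_space stationary by fact
  show "sets \<pi> = sets stationary" using \<pi> by simp
  fix A assume "A \<in> sets \<pi>"
  then have "\<bar>measure \<pi> A - measure stationary A\<bar> \<le> (1 - \<epsilon>) ^ n" for n
    using tv_contraction(1)[OF \<pi> \<sigma>, of A n] \<pi>(2)
    by (simp add: iter_invariant assms invariant_stationary)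
  moreover have "(\<lambda>n. (1 - \<epsilon>) ^ n) \<longlonglongrightarrow> 0"
    using \<epsilon> by (intro LIMSEQ_power_zero) auto
  ultimately have "\<bar>measure \<pi> A - measure stationary A\<bar> \<le> 0"
    by (intro LIMSEQ_le_const) auto
  then show "emeasure \<pi> A = emeasure stationary A"
    by (simp add: \<pi>.emeasure_eq_measure \<sigma>.emeasure_eq_measure)
qed

lemma n_step_tv:
  assumes "u \<in> space G"
  shows "tv_dist (n_step G K n u) stationary \<le> (1 - \<epsilon>) ^ n"
    and "0 \<le> tv_dist (n_step G K n u) stationary"
  using tv_contraction(2,3)[of "return G u" stationary n] invariant_stationary assms
  by (simp_all add: n_step_eq_iter iter_invariant prob_space_return)
    (simp_all add: invariant_distribution_def)

text \<open>If \<open>A\<close> has positive mass, some point of \<open>A\<close> never leaves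
  \<open>A\<close> in one step, so the minorant gives the complement \<open>B\<close> no mass. Then
  every transition law gives \<open>B\<close> at most \<open>1 - \<epsilon>\<close>, and invariance
  yields a mass of \<open>B\<close> that is at most \<open>1 - \<epsilon>\<close> times itself,
  hence 0.\<close>

lemma invariant_set_trivial:
  assumes [measurable]: "A \<in> sets G"
    and abs: "AE u in stationary. u \<in> A \<longrightarrow> measure (K u) A = 1"
  shows "measure stationary A = 0 \<or> measure stationary A = 1"
proof (cases "measure stationary A = 0")
  case A: False
  have inv: "prob_space stationary" "stationary \<bind> K = stationary"
    using invariant_stationary by (auto simp: invariant_distribution_def)
  interpret \<sigma>: prob_space stationary by fact
  define B where "B = space G - A"
  have [measurable]: "B \<in> sets G" by (simp add: B_def)
  have compl: "emeasure (K u) A + emeasure (K u) B = 1" if "u \<in> space G" for u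
  proof -
    have "emeasure (K u) A + emeasure (K u) B = emeasure (K u) (A \<union> B)"
      using that by (intro plus_emeasure) (auto simp: K_eq B_def)
    moreover have "A \<union> B = space (K u)"
      using that sets.sets_into_space[OF assms(1)] by (auto simp: K_eq B_def)
    ultimately show ?thesis using prob_space.emeasure_space_1[OF prob_K[OF that]] by simp
  qed
  have zero: "emeasure (K u) B = 0" if "u \<in> space G" "measure (K u) A = 1" for u
  proof -
    interpret Ku: prob_space "K u" using that(1) by (rule prob_K)
    have "measure (K u) A + measure (K u) B = 1"
      using compl[OF that(1)] by (simp add: Ku.emeasure_eq_measure flip: ennreal_plus)
    then show ?thesis using that(2) by (simp add: Ku.emeasure_eq_measure)
  qed
  have g_le_K: "emeasure (density G g) X \<le> emeasure (K u) X" if "u \<in> space G" "X \<in> sets G" for u X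
    using that by (auto simp: K_eq emeasure_density intro!: nn_integral_mono mult_right_mono g_le)
  \<comment> \<open>One such point is enough, because the minorant does not depend on the starting
    point.\<close>
  have "\<exists>u\<in>space G. u \<in> A \<and> measure (K u) A = 1"
  proof (rule ccontr)
    assume none: "\<not> ?thesis"
    from abs AE_space[of stationary] have "AE u in stationary. u \<notin> A"
      by eventually_elim (use none in auto)
    then have "A \<in> null_sets stationary"
      by (subst AE_iff_null_sets) simp_all
    then have "emeasure stationary A = 0" by (rule null_setsD1)
    then show False using A by (simp add: measure_def)
  qed
  then have "emeasure (density G g) B = 0"
    using zero g_le_K[of _ B] by (metis \<open>B \<in> sets G\<close> le_zero_eq)
  moreover have "emeasure (density G g) A + emeasure (density G g) B = emeasure (density G g) (A \<union> B)"
    by (intro plus_emeasure) (auto simp: B_def)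
  moreover have "A \<union> B = space G"
    using sets.sets_into_space[OF assms(1)] by (auto simp: B_def)
  ultimately have gA: "emeasure (density G g) A = ennreal \<epsilon>"
    by (simp add: emeasure_density g_mass cong: nn_integral_cong)
  have le: "emeasure (K u) B \<le> ennreal (1 - \<epsilon>)" if u: "u \<in> space G" for u
  proof -
    interpret Ku: prob_space "K u" using u by (rule prob_K)
    have "ennreal \<epsilon> \<le> emeasure (K u) A" using g_le_K[OF u, of A] gA by simp
    then have "\<epsilon> \<le> measure (K u) A" by (simp add: Ku.emeasure_eq_measure)
    moreover have "measure (K u) A + measure (K u) B = 1"
      using compl[OF u] by (simp add: Ku.emeasure_eq_measure flip: ennreal_plus)
    ultimately show ?thesis by (simp add: Ku.emeasure_eq_measure ennreal_leI)
  qed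
  have K: "K \<in> measurable stationary (subprob_algebra G)" by measurable
  have ne: "space stationary \<noteq> {}" using G.not_empty by simp
  have "emeasure stationary B = (\<integral>\<^sup>+u. emeasure (K u) B \<partial>stationary)"
    using emeasure_bind[OF ne K, of B] inv(2) by simp
  \<comment> \<open>Almost every point of \<open>A\<close> sends no mass to \<open>B\<close>, which
    is why the bound carries the indicator of \<open>B\<close>.\<close>
  also have "\<dots> \<le> (\<integral>\<^sup>+u. ennreal (1 - \<epsilon>) * indicator B u \<partial>stationary)"
  proof (rule nn_integral_mono_AE)
    from abs AE_space[of stationary]
    show "AE u in stationary. emeasure (K u) B \<le> ennreal (1 - \<epsilon>) * indicator B u"
    proof eventually_elim
      case (elim u)
      then show ?case
        using zero[of u] le[of u] by (cases "u \<in> A") (simp_all add: B_def)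
    qed
  qed
  also have "\<dots> = ennreal (1 - \<epsilon>) * emeasure stationary B"
    by (simp add: nn_integral_cmult_indicator)
  finally have "measure stationary B \<le> (1 - \<epsilon>) * measure stationary B"
    using \<epsilon> by (simp add: \<sigma>.emeasure_eq_measure flip: ennreal_mult)
  then have "\<epsilon> * measure stationary B \<le> 0" by (simp add: algebra_simps)
  then have "measure stationary B = 0"
    using \<epsilon> measure_nonneg[of stationary B] by (metis antisym mult_le_cancel_left_pos mult_zero_right)
  moreover have "measure stationary B = 1 - measure stationary A"
    unfolding B_def using \<sigma>.prob_compl[of A] by (simp only: space_stationary sets_stationary assms(1))
  ultimately show ?thesis by simp
qed simp

theorem ergodic_stationary: "ergodic_chain G K stationary"
  unfolding ergodic_chain_def
proof (intro conjI ballI impI invariant_stationary)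
  fix u assume u: "u \<in> space G"
  show "(\<lambda>n. tv_dist (n_step G K n u) stationary) \<longlonglongrightarrow> 0"
  proof (rule tendsto_sandwich[OF _ _ tendsto_const])
    show "(\<lambda>n. (1 - \<epsilon>) ^ n) \<longlonglongrightarrow> 0"
      using \<epsilon> by (intro LIMSEQ_power_zero) auto
  qed (use n_step_tv[OF u] in auto)
qed (rule invariant_set_trivial)

end

section \<open>The space of square-integrable functions\<close>

lemma square_integrable_rep: "square_integrable (rep_L2 u)"
  using Quotient3_rep_reflp[OF Quotient3_L2, of u] by simp

lemma abs_rep_L2: "abs_L2 (rep_L2 u) = u"
  by (rule Quotient3_abs_rep[OF Quotient3_L2])

lemma rep_abs_L2: "square_integrable f \<Longrightarrow> AE x in lebesgue. rep_L2 (abs_L2 f) x = f x"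
  using rep_abs_rsp_left[OF Quotient3_L2, of f f] by simp

lemma abs_L2_cong:
  assumes "square_integrable f" "square_integrable g" "AE x in lebesgue. f x = g x"
  shows "abs_L2 f = abs_L2 g"
  using Quotient3_rel_abs[OF Quotient3_L2, of f g] assms by blast

lemma rep_measurable [measurable]: "rep_L2 u \<in> borel_measurable lebesgue"
  using square_integrable_rep[of u] by (simp add: square_integrable_def)

lemma rep_square_integrable: "integrable lebesgue (\<lambda>x. (rep_L2 u x)\<^sup>2)"
  using square_integrable_rep[of u] by (simp add: square_integrable_def)

lemma inner_L2_eq: "inner u v = (\<integral>x. rep_L2 u x * rep_L2 v x \<partial>lebesgue)"
  by (simp add: inner_L2.rep_eq)

lemma rep_add: "AE x in lebesgue. rep_L2 (u + v) x = rep_L2 u x + rep_L2 v x"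
proof -
  have "u + v = abs_L2 (\<lambda>x. rep_L2 u x + rep_L2 v x)"
    using plus_L2.abs_eq[of "rep_L2 u" "rep_L2 v"] by (simp add: abs_rep_L2 square_integrable_rep)
  then show ?thesis
    using rep_abs_L2[OF square_integrable_add[OF square_integrable_rep square_integrable_rep]] by metis
qed

lemma rep_scale: "AE x in lebesgue. rep_L2 (c *\<^sub>R u) x = c * rep_L2 u x"
proof -
  have "c *\<^sub>R u = abs_L2 (\<lambda>x. c * rep_L2 u x)"
    using scaleR_L2.abs_eq[of "rep_L2 u" c] by (simp add: abs_rep_L2 square_integrable_rep)
  then show ?thesis
    using rep_abs_L2[OF square_integrable_scale[OF square_integrable_rep]] by metis
qed

lemma rep_diff: "AE x in lebesgue. rep_L2 (u - v) x = rep_L2 u x - rep_L2 v x"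
proof -
  have eq: "u - v = u + (-1) *\<^sub>R v" by simp
  show ?thesis
    unfolding eq using rep_add[of u "(-1) *\<^sub>R v"] rep_scale[of "-1" v] by eventually_elim simp
qed

lemma norm_L2_sq: "(norm u)\<^sup>2 = (\<integral>x. (rep_L2 u x)\<^sup>2 \<partial>lebesgue)"
  unfolding power2_norm_eq_inner inner_L2_eq by (simp add: power2_eq_square)

lemma nn_integral_diff_sq:
  "(\<integral>\<^sup>+x. ennreal ((rep_L2 u x - rep_L2 v x)\<^sup>2) \<partial>lebesgue) = ennreal ((dist u v)\<^sup>2)"
proof -
  have "(\<integral>\<^sup>+x. ennreal ((rep_L2 u x - rep_L2 v x)\<^sup>2) \<partial>lebesgue) =
      (\<integral>\<^sup>+x. ennreal ((rep_L2 (u - v) x)\<^sup>2) \<partial>lebesgue)"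
    by (rule nn_integral_cong_AE) (use rep_diff[of u v] in eventually_elim, simp)
  then show ?thesis
    by (simp add: nn_integral_eq_integral rep_square_integrable dist_norm norm_L2_sq)
qed

lemma dist_eq_integral_rep:
  "(\<integral>x. (rep_L2 u x - rep_L2 v x)\<^sup>2 \<partial>lebesgue) = (dist u v)\<^sup>2"
  "integrable lebesgue (\<lambda>x. (rep_L2 u x - rep_L2 v x)\<^sup>2)"
proof -
  have ae: "AE x in lebesgue. (rep_L2 (u - v) x)\<^sup>2 = (rep_L2 u x - rep_L2 v x)\<^sup>2"
    using rep_diff[of u v] by eventually_elim simp
  have "integrable lebesgue (\<lambda>x. (rep_L2 (u - v) x)\<^sup>2)" by (rule rep_square_integrable)
  with ae show "integrable lebesgue (\<lambda>x. (rep_L2 u x - rep_L2 v x)\<^sup>2)"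
    by (subst integrable_cong_AE[symmetric]) simp_all
  show "(\<integral>x. (rep_L2 u x - rep_L2 v x)\<^sup>2 \<partial>lebesgue) = (dist u v)\<^sup>2"
    unfolding dist_norm norm_L2_sq using ae by (intro integral_cong_AE[symmetric]) simp_all
qed

section \<open>Completeness of the space of square-integrable functions\<close>

lemma Cauchy_fast_subseq:
  fixes u :: "nat \<Rightarrow> 'a::metric_space"
  assumes "Cauchy u"
  obtains r where "strict_mono (r :: nat \<Rightarrow> nat)" "\<And>k. dist (u (r (Suc k))) (u (r k)) < 1 / 2 ^ k"
proof -
  have "\<exists>N. \<forall>m\<ge>N. \<forall>n\<ge>N. dist (u m) (u n) < 1 / 2 ^ k" for k :: nat
    by (rule metric_CauchyD[OF assms]) simp
  then have "\<forall>k. \<exists>N. \<forall>m\<ge>N. \<forall>n\<ge>N. dist (u m) (u n) < 1 / 2 ^ k" by blast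
  from choice[OF this] obtain N
    where N: "\<And>k m n. m \<ge> N k \<Longrightarrow> n \<ge> N k \<Longrightarrow> dist (u m) (u n) < 1 / 2 ^ k"
    by blast
  define r where "r = rec_nat (N 0) (\<lambda>k m. max (Suc m) (N (Suc k)))"
  have r: "r 0 = N 0" "\<And>k. r (Suc k) = max (Suc (r k)) (N (Suc k))"
    by (simp_all add: r_def)
  have ge: "r k \<ge> N k" for k by (cases k) (simp_all add: r)
  have mono: "strict_mono r" by (rule strict_monoI_Suc) (simp add: r)
  show thesis
  proof (rule that[OF mono])
    fix k
    have "r (Suc k) \<ge> N k" using ge[of k] r(2)[of k] by linarith
    then show "dist (u (r (Suc k))) (u (r k)) < 1 / 2 ^ k" using N ge by blast
  qed
qed

text \<open>Lebesgue measure is infinite, so square-integrable increments need not be integrable.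
  Their squares weighted by \<open>2 ^ k\<close> still have a summable series of integrals, and they
  control the increments pointwise up to a geometric error.\<close>

lemma AE_convergent_of_fast_Cauchy:
  fixes f :: "nat \<Rightarrow> 'a \<Rightarrow> real"
  assumes [measurable]: "\<And>k. f k \<in> borel_measurable M"
    and d: "\<And>k. (\<integral>\<^sup>+x. ennreal ((f (Suc k) x - f k x)\<^sup>2) \<partial>M) \<le> ennreal ((1 / 4) ^ k)"
  shows "AE x in M. convergent (\<lambda>k. f k x)"
proof -
  define w where "w k x = 2 ^ k * (f (Suc k) x - f k x)\<^sup>2" for k x
  have [measurable]: "w k \<in> borel_measurable M" for k
    unfolding w_def[abs_def] by measurable
  have w0: "0 \<le> w k x" for k x by (simp add: w_def)
  have "(\<integral>\<^sup>+x. (\<Sum>k. ennreal (w k x)) \<partial>M) = (\<Sum>k. \<integral>\<^sup>+x. ennreal (w k x) \<partial>M)"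
    by (rule nn_integral_suminf) simp
  also have "\<dots> \<le> (\<Sum>k. ennreal ((1 / 2) ^ k))"
  proof (rule suminf_le)
    fix k
    have "(\<integral>\<^sup>+x. ennreal (w k x) \<partial>M) = ennreal (2 ^ k) * (\<integral>\<^sup>+x. ennreal ((f (Suc k) x - f k x)\<^sup>2) \<partial>M)"
      by (subst nn_integral_cmult[symmetric]) (simp_all add: w_def ennreal_mult)
    also have "\<dots> \<le> ennreal (2 ^ k) * ennreal ((1 / 4) ^ k)"
      by (intro mult_left_mono d) simp
    also have "\<dots> = ennreal ((2 * (1 / 4)) ^ k)"
      unfolding power_mult_distrib by (rule ennreal_mult[symmetric]) simp_all
    also have "2 * (1 / 4) = (1 / 2 :: real)" by simp
    finally show "(\<integral>\<^sup>+x. ennreal (w k x) \<partial>M) \<le> ennreal ((1 / 2) ^ k)" .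
  qed simp_all
  also have "\<dots> < \<infinity>"
    by (subst suminf_ennreal2) (auto intro: summable_geometric)
  finally have "AE x in M. (\<Sum>k. ennreal (w k x)) \<noteq> \<infinity>"
    by (intro nn_integral_PInf_AE) auto
  then show ?thesis
  proof eventually_elim
    case (elim x)
    then have "summable (\<lambda>k. w k x)"
      by (intro summable_suminf_not_top w0) simp
    then have s: "summable (\<lambda>k. w k x + (1 / 2) ^ k)"
      by (intro summable_add summable_geometric) auto
    have le: "norm (f (Suc k) x - f k x) \<le> w k x + (1 / 2) ^ k" for k
    proof -
      \<comment> \<open>Multiplying \<open>a \<le> a\<^sup>2 + 1\<close> by \<open>b\<close> bounds
        the increment by its weighted square plus \<open>(1 / 2) ^ k\<close>.\<close>
      define a b where "a = 2 ^ k * \<bar>f (Suc k) x - f k x\<bar>" and "b = (1 / 2 :: real) ^ k"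
      have "0 \<le> a" by (simp add: a_def)
      moreover have "2 * a \<le> a\<^sup>2 + 1"
        using zero_le_power2[of "a - 1"] by (simp add: power2_diff)
      ultimately have "a \<le> a\<^sup>2 + 1" by linarith
      then have "b * a \<le> b * (a\<^sup>2 + 1)"
        by (intro mult_left_mono) (simp_all add: b_def)
      moreover have "b * a = \<bar>f (Suc k) x - f k x\<bar>"
        by (simp add: a_def b_def power_one_over)
      moreover have "b * a\<^sup>2 = w k x"
        by (simp add: a_def b_def w_def power_one_over power2_eq_square)
      ultimately show ?thesis by (simp add: distrib_left b_def)
    qed
    have "summable (\<lambda>k. f (Suc k) x - f k x)"
      by (rule summable_comparison_test'[OF s, of 0]) (rule le)
    then have "convergent (\<lambda>n. \<Sum>k<n. f (Suc k) x - f k x)"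
      by (rule summable_iff_convergent[THEN iffD1])
    then have "convergent (\<lambda>n. (f n x - f 0 x) + f 0 x)"
      unfolding sum_lessThan_telescope[of "\<lambda>k. f k x"] by (intro convergent_add convergent_const)
    then show ?case by simp
  qed
qed

text \<open>Riesz--Fischer: a fast subsequence converges almost everywhere. Fatou's lemma then shows
  both that the limit is square-integrable and that the full sequence converges to it in
  norm.\<close>

lemma complete_L2: "Topological_Spaces.complete (UNIV :: 'a::euclidean_space L2 set)"
  unfolding complete_def
proof (intro allI impI, elim conjE)
  fix u :: "nat \<Rightarrow> 'a L2" assume C: "Cauchy u"
  obtain r where r: "strict_mono r" "\<And>k. dist (u (r (Suc k))) (u (r k)) < 1 / 2 ^ k"
    using Cauchy_fast_subseq[OF C] by blast
  define f where "f k = rep_L2 (u (r k))" for k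
  have [measurable]: "f k \<in> borel_measurable lebesgue" for k by (simp add: f_def)
  have "AE x in lebesgue. convergent (\<lambda>k. f k x)"
  proof (rule AE_convergent_of_fast_Cauchy)
    fix k
    have "(dist (u (r (Suc k))) (u (r k)))\<^sup>2 \<le> (1 / 2 ^ k)\<^sup>2"
      using r(2)[of k] by (intro power_mono) auto
    also have "(1 / 2 ^ k :: real)\<^sup>2 = ((1 / 2)\<^sup>2) ^ k"
      by (simp only: power_one_over[symmetric] power_mult[symmetric] mult.commute)
    also have "(1 / 2 :: real)\<^sup>2 = 1 / 4" by (simp add: power2_eq_square)
    finally show "(\<integral>\<^sup>+x. ennreal ((f (Suc k) x - f k x)\<^sup>2) \<partial>lebesgue) \<le> ennreal ((1 / 4) ^ k)"
      by (simp add: f_def nn_integral_diff_sq ennreal_leI)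
  qed simp
  define g where "g x = lim (\<lambda>k. f k x)" for x
  have [measurable]: "g \<in> borel_measurable lebesgue"
    unfolding g_def[abs_def] by measurable
  have conv: "AE x in lebesgue. (\<lambda>k. f k x) \<longlonglongrightarrow> g x"
    using \<open>AE x in lebesgue. convergent (\<lambda>k. f k x)\<close>
    by eventually_elim (simp add: g_def convergent_LIMSEQ_iff)
  have fatou: "(\<integral>\<^sup>+x. ennreal ((g x - rep_L2 (u m) x)\<^sup>2) \<partial>lebesgue) \<le> ennreal (\<epsilon>\<^sup>2)"
    if le: "\<And>n. n \<ge> m \<Longrightarrow> dist (u n) (u m) \<le> \<epsilon>" and "0 \<le> \<epsilon>" for m \<epsilon>
  proof -
    have "(\<integral>\<^sup>+x. ennreal ((g x - rep_L2 (u m) x)\<^sup>2) \<partial>lebesgue) =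
        (\<integral>\<^sup>+x. liminf (\<lambda>k. ennreal ((f k x - rep_L2 (u m) x)\<^sup>2)) \<partial>lebesgue)"
    proof (rule nn_integral_cong_AE)
      from conv show "AE x in lebesgue. ennreal ((g x - rep_L2 (u m) x)\<^sup>2) =
          liminf (\<lambda>k. ennreal ((f k x - rep_L2 (u m) x)\<^sup>2))"
      proof eventually_elim
        case (elim x)
        have "(\<lambda>k. ennreal ((f k x - rep_L2 (u m) x)\<^sup>2)) \<longlonglongrightarrow> ennreal ((g x - rep_L2 (u m) x)\<^sup>2)"
          by (intro tendsto_intros elim)
        then show ?case by (intro lim_imp_Liminf[symmetric]) simp_all
      qed
    qed
    also have "\<dots> \<le> liminf (\<lambda>k. \<integral>\<^sup>+x. ennreal ((f k x - rep_L2 (u m) x)\<^sup>2) \<partial>lebesgue)"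
      by (rule nn_integral_liminf) simp
    also have "\<dots> = liminf (\<lambda>k. ennreal ((dist (u (r k)) (u m))\<^sup>2))"
      by (simp add: f_def nn_integral_diff_sq)
    also have "\<dots> \<le> ennreal (\<epsilon>\<^sup>2)"
    proof (rule Liminf_le)
      show "\<forall>\<^sub>F k in sequentially. ennreal ((dist (u (r k)) (u m))\<^sup>2) \<le> ennreal (\<epsilon>\<^sup>2)"
        using eventually_ge_at_top[of m]
      proof eventually_elim
        case (elim k)
        then have "r k \<ge> m" using seq_suble[OF r(1), of k] by linarith
        then show ?case by (intro ennreal_leI power_mono le) simp_all
      qed
    qed simp
    finally show ?thesis .
  qed
  obtain N where N: "\<And>m n. m \<ge> N \<Longrightarrow> n \<ge> N \<Longrightarrow> dist (u m) (u n) < 1"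
    using metric_CauchyD[OF C, of 1] by auto
  \<comment> \<open>Fatou controls only the difference from a member of the sequence; adding that
    member back gives the limit itself.\<close>
  have "square_integrable (\<lambda>x. g x - rep_L2 (u N) x)"
    unfolding square_integrable_def
  proof
    have "(\<integral>\<^sup>+x. ennreal ((g x - rep_L2 (u N) x)\<^sup>2) \<partial>lebesgue) \<le> ennreal (1\<^sup>2)"
      by (rule fatou) (use N in \<open>auto intro: less_imp_le\<close>)
    then have "(\<integral>\<^sup>+x. ennreal ((g x - rep_L2 (u N) x)\<^sup>2) \<partial>lebesgue) < \<infinity>"
      using ennreal_less_top by (auto intro: le_less_trans)
    then show "integrable lebesgue (\<lambda>x. (g x - rep_L2 (u N) x)\<^sup>2)"
      by (intro integrableI_nonneg) auto
  qed simp
  from square_integrable_add[OF this square_integrable_rep[of "u N"]]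
  have g: "square_integrable g" by simp
  show "\<exists>l\<in>UNIV. u \<longlonglongrightarrow> l"
  proof (rule bexI[OF _ UNIV_I], rule metric_LIMSEQ_I)
    fix \<epsilon> :: real assume "0 < \<epsilon>"
    then obtain N where N: "\<And>m n. m \<ge> N \<Longrightarrow> n \<ge> N \<Longrightarrow> dist (u m) (u n) < \<epsilon> / 2"
      using metric_CauchyD[OF C, of "\<epsilon> / 2"] by auto
    have "dist (u m) (abs_L2 g) < \<epsilon>" if "m \<ge> N" for m
    proof -
      have "ennreal ((dist (abs_L2 g) (u m))\<^sup>2) = (\<integral>\<^sup>+x. ennreal ((g x - rep_L2 (u m) x)\<^sup>2) \<partial>lebesgue)"
        unfolding nn_integral_diff_sq[symmetric]
        by (rule nn_integral_cong_AE) (use rep_abs_L2[OF g] in eventually_elim, simp)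
      also have "\<dots> \<le> ennreal ((\<epsilon> / 2)\<^sup>2)"
        by (rule fatou) (use N that \<open>0 < \<epsilon>\<close> in \<open>auto intro!: less_imp_le\<close>)
      finally have "(dist (abs_L2 g) (u m))\<^sup>2 \<le> (\<epsilon> / 2)\<^sup>2" by simp
      then have "dist (abs_L2 g) (u m) \<le> \<epsilon> / 2"
        by (rule power2_le_imp_le) (use \<open>0 < \<epsilon>\<close> in simp)
      then show ?thesis using \<open>0 < \<epsilon>\<close> by (simp add: dist_commute)
    qed
    then show "\<exists>N. \<forall>m\<ge>N. dist (u m) (abs_L2 g) < \<epsilon>" by blast
  qed
qed

text \<open>Convergence in norm gives almost everywhere convergence only along subsequences; this
  criterion removes the passage to a subsequence from the conclusion.\<close>

lemma LIMSEQ_subsequences: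
  fixes X :: "nat \<Rightarrow> 'a::metric_space"
  assumes "\<And>s :: nat \<Rightarrow> nat. strict_mono s \<Longrightarrow> \<exists>r :: nat \<Rightarrow> nat. strict_mono r \<and> (\<lambda>n. X (s (r n))) \<longlonglongrightarrow> L"
  shows "X \<longlonglongrightarrow> L"
proof (rule ccontr)
  assume "\<not> X \<longlonglongrightarrow> L"
  then obtain \<epsilon> where "\<epsilon> > 0" and \<epsilon>: "\<And>N. \<exists>n\<ge>N. \<epsilon> \<le> dist (X n) L"
    unfolding lim_sequentially by (meson not_less)
  have "infinite {n. \<epsilon> \<le> dist (X n) L}"
    unfolding infinite_nat_iff_unbounded_le using \<epsilon> by simp
  then obtain s :: "nat \<Rightarrow> nat" where s: "strict_mono s" "\<And>n. \<epsilon> \<le> dist (X (s n)) L"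
    using infinite_enumerate by (metis mem_Collect_eq)
  obtain r :: "nat \<Rightarrow> nat" where "(\<lambda>n. X (s (r n))) \<longlonglongrightarrow> L"
    using assms[OF s(1)] by blast
  from metric_LIMSEQ_D[OF this \<open>\<epsilon> > 0\<close>] obtain N where "dist (X (s (r N))) L < \<epsilon>" by blast
  with s(2)[of "r N"] show False by simp
qed

section \<open>Multiplication operators\<close>

locale bounded_multiplier =
  fixes F :: "real \<Rightarrow> real" and F_plus :: real
  assumes F_continuous: "continuous_on UNIV F"
    and F_bounds: "\<And>x. 0 \<le> F x \<and> F x \<le> F_plus"
begin

lemma F_measurable [measurable]: "F \<in> borel_measurable borel"
  using F_continuous by (rule borel_measurable_continuous_onI)

lemma F_plus_nonneg: "0 \<le> F_plus"
  using F_bounds[of 0] by linarith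

lemma mult_op_square_integrable: "square_integrable (\<lambda>x. F (rep_L2 u x) * rep_L2 v x)"
  unfolding square_integrable_def
proof
  show "integrable lebesgue (\<lambda>x. (F (rep_L2 u x) * rep_L2 v x)\<^sup>2)"
  proof (rule Bochner_Integration.integrable_bound)
    show "integrable lebesgue (\<lambda>x. F_plus\<^sup>2 * (rep_L2 v x)\<^sup>2)"
      by (intro integrable_mult_right rep_square_integrable)
    show "AE x in lebesgue. norm ((F (rep_L2 u x) * rep_L2 v x)\<^sup>2) \<le> norm (F_plus\<^sup>2 * (rep_L2 v x)\<^sup>2)"
      using F_bounds by (intro AE_I2) (simp add: power_mult_distrib mult_right_mono power_mono)
  qed measurable
qed measurable

lemma rep_mult_op: "AE x in lebesgue. rep_L2 (mult_op F u v) x = F (rep_L2 u x) * rep_L2 v x"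
  unfolding mult_op_def by (rule rep_abs_L2) (rule mult_op_square_integrable)

lemma mult_op_in_L2_on: "v \<in> L2_on D \<Longrightarrow> mult_op F u v \<in> L2_on D"
  unfolding L2_on_def mem_Collect_eq
  using rep_mult_op[of u v] by (auto elim: eventually_elim2)

lemma inner_mult_op:
  "inner (mult_op F u v) w = (\<integral>x. F (rep_L2 u x) * (rep_L2 v x * rep_L2 w x) \<partial>lebesgue)"
  unfolding inner_L2_eq using rep_mult_op[of u v]
  by (intro integral_cong_AE) (measurable, auto elim: eventually_mono)

lemma mult_op_add: "mult_op F u (v + w) = mult_op F u v + mult_op F u w"
proof -
  have "abs_L2 (rep_L2 (mult_op F u (v + w))) = abs_L2 (rep_L2 (mult_op F u v + mult_op F u w))"
  proof (rule abs_L2_cong)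
    show "AE x in lebesgue. rep_L2 (mult_op F u (v + w)) x = rep_L2 (mult_op F u v + mult_op F u w) x"
      using rep_mult_op[of u "v + w"] rep_mult_op[of u v] rep_mult_op[of u w] rep_add[of v w]
        rep_add[of "mult_op F u v" "mult_op F u w"]
      by eventually_elim (simp add: distrib_left)
  qed (rule square_integrable_rep)+
  then show ?thesis by (simp add: abs_rep_L2)
qed

lemma mult_op_scale: "mult_op F u (c *\<^sub>R v) = c *\<^sub>R mult_op F u v"
proof -
  have "abs_L2 (rep_L2 (mult_op F u (c *\<^sub>R v))) = abs_L2 (rep_L2 (c *\<^sub>R mult_op F u v))"
  proof (rule abs_L2_cong)
    show "AE x in lebesgue. rep_L2 (mult_op F u (c *\<^sub>R v)) x = rep_L2 (c *\<^sub>R mult_op F u v) x"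
      using rep_mult_op[of u "c *\<^sub>R v"] rep_mult_op[of u v] rep_scale[of c v]
        rep_scale[of c "mult_op F u v"]
      by eventually_elim simp
  qed (rule square_integrable_rep)+
  then show ?thesis by (simp add: abs_rep_L2)
qed

lemma mult_op_symmetric: "inner (mult_op F u v) w = inner v (mult_op F u w)"
  by (simp add: inner_mult_op inner_commute[of v] mult.commute[of "rep_L2 v _"])

lemma mult_op_nonneg: "0 \<le> inner (mult_op F u v) v"
  unfolding inner_mult_op using F_bounds by (intro Bochner_Integration.integral_nonneg) simp

text \<open>The values of \<open>F\<close> lie in an interval with midpoint
  \<open>F_plus / 2\<close>, so the multiplier differs from the midpoint by at most half the
  length.\<close>

lemma mult_op_shift_bound:
  "norm ((F_plus / 2) *\<^sub>R v - mult_op F u v) \<le> F_plus / 2 * norm v"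
proof (rule power2_le_imp_le)
  let ?w = "(F_plus / 2) *\<^sub>R v - mult_op F u v"
  have ae: "AE x in lebesgue. rep_L2 ?w x = (F_plus / 2 - F (rep_L2 u x)) * rep_L2 v x"
    using rep_diff[of "(F_plus / 2) *\<^sub>R v" "mult_op F u v"] rep_scale[of "F_plus / 2" v] rep_mult_op[of u v]
    by eventually_elim (simp add: algebra_simps)
  have "(norm ?w)\<^sup>2 \<le> (\<integral>x. (F_plus / 2)\<^sup>2 * (rep_L2 v x)\<^sup>2 \<partial>lebesgue)"
    unfolding norm_L2_sq
  proof (rule integral_mono_AE)
    show "AE x in lebesgue. (rep_L2 ?w x)\<^sup>2 \<le> (F_plus / 2)\<^sup>2 * (rep_L2 v x)\<^sup>2"
      using ae
    proof eventually_elim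
      case (elim x)
      have "\<bar>F_plus / 2 - F (rep_L2 u x)\<bar> \<le> F_plus / 2"
        using F_bounds[of "rep_L2 u x"] unfolding abs_le_iff by linarith
      then have "(F_plus / 2 - F (rep_L2 u x))\<^sup>2 \<le> (F_plus / 2)\<^sup>2"
        using F_plus_nonneg by (intro power2_le_iff_abs_le[THEN iffD2]) simp_all
      then show ?case unfolding elim power_mult_distrib by (rule mult_right_mono) simp
    qed
  qed (intro integrable_mult_right rep_square_integrable)+
  also have "\<dots> = (F_plus / 2 * norm v)\<^sup>2"
    by (simp add: norm_L2_sq power_mult_distrib power_divide)
  finally show "(norm ?w)\<^sup>2 \<le> (F_plus / 2 * norm v)\<^sup>2" .
qed (use F_plus_nonneg in simp)

text \<open>Along an almost everywhere convergent subsequence continuity of \<open>F\<close> applies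
  pointwise, and \<open>F_plus\<close> times the absolute value of the product of \<open>v\<close>
  and \<open>w\<close> dominates.\<close>

lemma inner_mult_op_subseq:
  assumes "u \<longlonglongrightarrow> l"
  obtains r where "strict_mono (r :: nat \<Rightarrow> nat)"
    "(\<lambda>n. inner (mult_op F (u (r n)) v) w) \<longlonglongrightarrow> inner (mult_op F l v) w"
proof -
  have "(\<lambda>n. (dist (u n) l)\<^sup>2) \<longlonglongrightarrow> 0\<^sup>2"
    using assms by (intro tendsto_power tendsto_dist_iff[THEN iffD1])
  then have "(\<lambda>n. \<integral>x. norm ((rep_L2 (u n) x - rep_L2 l x)\<^sup>2) \<partial>lebesgue) \<longlonglongrightarrow> 0"
    by (simp add: dist_eq_integral_rep)
  from tendsto_L1_AE_subseq[OF dist_eq_integral_rep(2) this]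
  obtain r where r: "strict_mono (r :: nat \<Rightarrow> nat)"
    and ae: "AE x in lebesgue. (\<lambda>n. (rep_L2 (u (r n)) x - rep_L2 l x)\<^sup>2) \<longlonglongrightarrow> 0"
    by blast
  have int: "integrable lebesgue (\<lambda>x. F_plus * \<bar>rep_L2 v x * rep_L2 w x\<bar>)"
    by (intro integrable_mult_right integrable_abs square_integrable_prod square_integrable_rep)
  have "(\<lambda>n. inner (mult_op F (u (r n)) v) w) \<longlonglongrightarrow> inner (mult_op F l v) w"
    unfolding inner_mult_op
  proof (rule integral_dominated_convergence[OF _ _ int])
    show "AE x in lebesgue. (\<lambda>n. F (rep_L2 (u (r n)) x) * (rep_L2 v x * rep_L2 w x))
        \<longlonglongrightarrow> F (rep_L2 l x) * (rep_L2 v x * rep_L2 w x)"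
      using ae
    proof eventually_elim
      case (elim x)
      have "(\<lambda>n. sqrt ((rep_L2 (u (r n)) x - rep_L2 l x)\<^sup>2)) \<longlonglongrightarrow> sqrt 0"
        by (intro tendsto_intros elim)
      then have "(\<lambda>n. rep_L2 (u (r n)) x) \<longlonglongrightarrow> rep_L2 l x"
        by (simp add: tendsto_rabs_zero_iff LIM_zero_iff)
      moreover have "isCont F (rep_L2 l x)"
        using F_continuous by (simp add: continuous_on_eq_continuous_at)
      ultimately have "(\<lambda>n. F (rep_L2 (u (r n)) x)) \<longlonglongrightarrow> F (rep_L2 l x)"
        by (rule isCont_tendsto_compose[rotated])
      then show ?case by (intro tendsto_mult tendsto_const)
    qed
    show "AE x in lebesgue. norm (F (rep_L2 (u (r n)) x) * (rep_L2 v x * rep_L2 w x))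
        \<le> F_plus * \<bar>rep_L2 v x * rep_L2 w x\<bar>" for n
      using F_bounds by (intro AE_I2) (simp add: abs_mult mult_right_mono)
  qed measurable
  with r show thesis by (rule that)
qed

text \<open>Continuity of single matrix entries in \<open>u\<close> is all that is sought: joint
  measurability of the quadratic form will be assembled from such entries.\<close>

lemma inner_mult_op_continuous: "continuous_on UNIV (\<lambda>u. inner (mult_op F u v) w)"
proof (rule continuous_at_imp_continuous_on, rule ballI)
  fix l
  show "isCont (\<lambda>u. inner (mult_op F u v) w) l"
    unfolding continuous_at_sequentially comp_def
  proof (intro allI impI)
    fix u assume u: "u \<longlonglongrightarrow> l"
    show "(\<lambda>n. inner (mult_op F (u n) v) w) \<longlonglongrightarrow> inner (mult_op F l v) w"
    proof (rule LIMSEQ_subsequences)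
      fix s :: "nat \<Rightarrow> nat" assume "strict_mono s"
      then have "(\<lambda>n. u (s n)) \<longlonglongrightarrow> l"
        using LIMSEQ_subseq_LIMSEQ[OF u] by (simp add: comp_def)
      then obtain r :: "nat \<Rightarrow> nat" where "strict_mono r"
        "(\<lambda>n. inner (mult_op F (u (s (r n))) v) w) \<longlonglongrightarrow> inner (mult_op F l v) w"
        by (rule inner_mult_op_subseq)
      then show "\<exists>r. strict_mono r \<and> (\<lambda>n. inner (mult_op F (u (s (r n))) v) w) \<longlonglongrightarrow> inner (mult_op F l v) w"
        by blast
    qed
  qed
qed

lemma inner_mult_op_measurable: "(\<lambda>u. inner (mult_op F u v) w) \<in> borel_measurable borel"
  by (intro borel_measurable_continuous_onI inner_mult_op_continuous)

end

section \<open>Geometric ergodicity\<close>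

locale gaussian_kernel = diagonal_covariance H b C \<mu>
  for H :: "'h::real_inner set" and b C \<mu> +
  fixes \<Gamma> :: "'h \<Rightarrow> 'h \<Rightarrow> 'h" and \<kappa> :: real
  assumes perturbation: "u \<in> H \<Longrightarrow> perturbed_gaussian H b C \<mu> (\<Gamma> u) \<kappa>"
    and \<Gamma>_measurable: "(\<lambda>u. inner (\<Gamma> u (b i)) (b j)) \<in> borel_measurable (borel_on H)"
begin

definition kernel :: "'h \<Rightarrow> 'h measure" where
  "kernel u = gaussian H (perturbed_covariance H C (\<Gamma> u))"

definition weight :: "'h \<Rightarrow> 'h \<Rightarrow> real" where
  "weight u v = exp (- inner (\<Gamma> u v) v / 2)"

definition transition_density :: "'h \<Rightarrow> 'h \<Rightarrow> ennreal" where
  "transition_density u v = ennreal (weight u v / (\<integral>v. weight u v \<partial>gauss))"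

text \<open>Since \<open>\<Gamma> u\<close> has norm at most \<open>2 * \<kappa>\<close>, the
  exponential is a lower bound for \<open>weight u v\<close> uniformly in \<open>u\<close>. The
  factor 1/2 keeps the total mass strictly below 1 even when \<open>\<kappa> = 0\<close>.\<close>

definition minorant :: "'h \<Rightarrow> ennreal" where
  "minorant v = ennreal (exp (- \<kappa> * (norm v)\<^sup>2) / 2)"

lemma
  assumes "u \<in> H"
  shows kernel_eq: "kernel u = density gauss (transition_density u)"
    and transition_density_mass: "(\<integral>\<^sup>+v. transition_density u v \<partial>gauss) = 1"
    and weight_integral: "0 < (\<integral>v. weight u v \<partial>gauss)" "(\<integral>v. weight u v \<partial>gauss) \<le> 1"
proof -
  interpret p: perturbed_gaussian H b C \<mu> "\<Gamma> u" \<kappa> using assms by (rule perturbation)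
  have w: "weight u = (\<lambda>v. exp (- p.quad v / 2))"
    by (simp add: weight_def[abs_def] p.quad_def[abs_def])
  have d: "transition_density u = p.kernel_density"
    unfolding transition_density_def[abs_def] w p.kernel_density_def[abs_def] p.mass_def ..
  show "kernel u = density gauss (transition_density u)"
    unfolding kernel_def p.gaussian_eq_tilted p.tilted_def d ..
  show "(\<integral>\<^sup>+v. transition_density u v \<partial>gauss) = 1"
    unfolding d by (rule p.kernel_density_mass)
  show "0 < (\<integral>v. weight u v \<partial>gauss)" "(\<integral>v. weight u v \<partial>gauss) \<le> 1"
    using p.mass_bounds unfolding p.mass_def w by simp_all
qed

lemma weight_ge:
  assumes "u \<in> H" "v \<in> H"
  shows "exp (- \<kappa> * (norm v)\<^sup>2) \<le> weight u v"
proof -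
  interpret p: perturbed_gaussian H b C \<mu> "\<Gamma> u" \<kappa> using assms(1) by (rule perturbation)
  have "inner (\<Gamma> u v) v \<le> norm (\<Gamma> u v) * norm v" by (rule norm_cauchy_schwarz)
  also have "\<dots> \<le> (2 * \<kappa> * norm v) * norm v"
    by (intro mult_right_mono p.norm_\<Gamma> assms(2)) simp
  finally show ?thesis by (simp add: weight_def power2_eq_square)
qed

text \<open>The normalising integral is at most 1, so dividing by it can only increase the
  weight.\<close>

lemma minorant_le:
  assumes "u \<in> H" "v \<in> H"
  shows "minorant v \<le> transition_density u v"
  unfolding minorant_def transition_density_def
proof (rule ennreal_leI)
  have "weight u v * (\<integral>v. weight u v \<partial>gauss) \<le> weight u v * 1"
    by (intro mult_left_mono weight_integral assms) (simp add: weight_def)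
  then have "weight u v \<le> weight u v / (\<integral>v. weight u v \<partial>gauss)"
    using weight_integral[OF assms(1)] by (simp add: pos_le_divide_eq)
  moreover have "exp (- \<kappa> * (norm v)\<^sup>2) / 2 \<le> weight u v"
    using weight_ge[OF assms] exp_ge_zero[of "- \<kappa> * (norm v)\<^sup>2"] by linarith
  ultimately show "exp (- \<kappa> * (norm v)\<^sup>2) / 2 \<le> weight u v / (\<integral>v. weight u v \<partial>gauss)"
    by (rule order_trans[rotated])
qed

lemma measurable_gauss: "measurable gauss M = measurable (borel_on H) M"
  by (rule measurable_cong_sets[OF sets_gauss refl])

text \<open>Two applications of Parseval separate the variables: each term is a matrix entry
  depending on \<open>u\<close> alone times coordinates of \<open>v\<close>.\<close>

lemma quadratic_form_measurable:
  "(\<lambda>p. inner (\<Gamma> (fst p) (snd p)) (snd p)) \<in> borel_measurable (gauss \<Otimes>\<^sub>M gauss)"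
proof -
  have coef: "(\<lambda>p. inner (\<Gamma> (fst p) (b j)) (b i)) \<in> borel_measurable (gauss \<Otimes>\<^sub>M gauss)" for i j
    by (rule measurable_compose[OF measurable_fst]) (simp only: measurable_gauss \<Gamma>_measurable)
  have coord: "(\<lambda>p. inner (b i) (snd p)) \<in> borel_measurable (gauss \<Otimes>\<^sub>M gauss)" for i
    by (rule measurable_compose[OF measurable_snd]) (simp only: measurable_gauss inner_measurable)
  have "(\<lambda>p. \<Sum>j. (\<Sum>i. inner (\<Gamma> (fst p) (b j)) (b i) * inner (b i) (snd p)) * inner (b j) (snd p))
      \<in> borel_measurable (gauss \<Otimes>\<^sub>M gauss)"
    by (intro borel_measurable_suminf borel_measurable_times coef coord)
  moreover have "inner (\<Gamma> (fst p) (snd p)) (snd p) =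
      (\<Sum>j. (\<Sum>i. inner (\<Gamma> (fst p) (b j)) (b i) * inner (b i) (snd p)) * inner (b j) (snd p))"
    if "p \<in> space (gauss \<Otimes>\<^sub>M gauss)" for p
  proof -
    have p: "fst p \<in> H" "snd p \<in> H" using that by (auto simp: space_pair_measure)
    interpret q: perturbed_gaussian H b C \<mu> "\<Gamma> (fst p)" \<kappa> using p(1) by (rule perturbation)
    have "(\<Sum>i. inner (\<Gamma> (fst p) (b j)) (b i) * inner (b i) (snd p)) = inner (b j) (\<Gamma> (fst p) (snd p))" for j
    proof -
      have "(\<lambda>i. inner (\<Gamma> (fst p) (b j)) (b i) * inner (b i) (snd p)) sums inner (\<Gamma> (fst p) (b j)) (snd p)"
        using parseval[of "\<Gamma> (fst p) (b j)" "snd p"] by (simp add: q.\<Gamma>_in_H inner_commute)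
      then show ?thesis by (simp add: sums_iff q.\<Gamma>_symmetric p(2))
    qed
    then show ?thesis
      using parseval[OF q.\<Gamma>_in_H[OF p(2)], of "snd p"] by (simp add: sums_iff)
  qed
  ultimately show ?thesis by (simp cong: measurable_cong)
qed

lemma transition_density_measurable:
  "(\<lambda>(u, v). transition_density u v) \<in> borel_measurable (gauss \<Otimes>\<^sub>M gauss)"
proof -
  interpret gauss: prob_space gauss by (rule prob_gauss)
  have w: "(\<lambda>(u, v). weight u v) \<in> borel_measurable (gauss \<Otimes>\<^sub>M gauss)"
    unfolding weight_def split_beta' using quadratic_form_measurable by measurable
  then have "(\<lambda>u. \<integral>v. weight u v \<partial>gauss) \<in> borel_measurable gauss"
    by (rule gauss.borel_measurable_lebesgue_integral)
  from measurable_compose[OF measurable_fst this]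
  have "(\<lambda>p. \<integral>v. weight (fst p) v \<partial>gauss) \<in> borel_measurable (gauss \<Otimes>\<^sub>M gauss)" .
  with w show ?thesis
    unfolding transition_density_def split_beta' by measurable
qed

lemma minorant_measurable: "minorant \<in> borel_measurable gauss"
proof -
  have "norm \<in> borel_measurable (borel_on H)"
    by (intro measurable_restrict_space1 borel_measurable_continuous_onI continuous_intros)
  then show ?thesis
    unfolding minorant_def[abs_def] measurable_gauss by measurable
qed

definition minorization :: real where
  "minorization = enn2real (\<integral>\<^sup>+v. minorant v \<partial>gauss)"

lemma minorization:
  "(\<integral>\<^sup>+v. minorant v \<partial>gauss) = ennreal minorization" "0 < minorization" "minorization < 1"
proof -
  interpret gauss: prob_space gauss by (rule prob_gauss)
  interpret p: perturbed_gaussian H b C \<mu> "\<Gamma> 0" \<kappa> by (rule perturbation) simp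
  have "(\<integral>\<^sup>+v. minorant v \<partial>gauss) \<le> (\<integral>\<^sup>+v. ennreal (1 / 2) \<partial>gauss)"
    unfolding minorant_def using p.\<kappa>_nonneg by (intro nn_integral_mono ennreal_leI) simp
  also have "\<dots> = ennreal (1 / 2)" using gauss.emeasure_space_1 by simp
  finally have le: "(\<integral>\<^sup>+v. minorant v \<partial>gauss) \<le> ennreal (1 / 2)" .
  then show eq: "(\<integral>\<^sup>+v. minorant v \<partial>gauss) = ennreal minorization"
    unfolding minorization_def
    by (intro ennreal_enn2real[symmetric]) (rule le_less_trans[OF _ ennreal_less_top])
  have "(\<integral>\<^sup>+v. minorant v \<partial>gauss) \<noteq> 0"
  proof
    assume "(\<integral>\<^sup>+v. minorant v \<partial>gauss) = 0"
    then have "AE v in gauss. minorant v = 0"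
      by (simp only: nn_integral_0_iff_AE[OF minorant_measurable])
    then have "AE v in gauss. False" by (simp add: minorant_def)
    then show False by simp
  qed
  then show "0 < minorization" using eq by (simp add: ennreal_eq_0_iff not_le)
  have "minorization \<le> 1 / 2" using le unfolding eq by (subst (asm) ennreal_le_iff) simp_all
  then show "minorization < 1" by simp
qed

sublocale doeblin gauss kernel transition_density minorant minorization
  by (rule doeblin.intro)
    (simp_all add: prob_gauss transition_density_measurable minorant_measurable kernel_eq
      transition_density_mass minorant_le minorization)

text \<open>The abstract Doeblin argument takes the reference measure \<open>gauss\<close> as state
  space, the final statement takes \<open>borel_on H\<close>. These notions see only the measurable
  sets, which coincide.\<close>

lemma invariant_distribution_gauss:
  "invariant_distribution gauss K \<pi> \<longleftrightarrow> invariant_distribution (borel_on H) K \<pi>"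
  by (simp add: invariant_distribution_def)

lemma n_step_gauss: "n_step gauss K n u = n_step (borel_on H) K n u"
  by (induction n) (simp_all add: return_sets_cong[OF sets_gauss])

lemma ergodic_chain_gauss: "ergodic_chain gauss K \<pi> \<longleftrightarrow> ergodic_chain (borel_on H) K \<pi>"
  by (simp add: ergodic_chain_def invariant_distribution_gauss n_step_gauss)

theorem geometric_ergodicity:
  "\<exists>\<pi>. invariant_distribution (borel_on H) kernel \<pi> \<and>
    (\<forall>\<pi>'. invariant_distribution (borel_on H) kernel \<pi>' \<longrightarrow> \<pi>' = \<pi>) \<and>
    (\<exists>\<epsilon>>0. \<forall>u\<in>H. \<forall>n. tv_dist (n_step (borel_on H) kernel n u) \<pi> \<le> (1 - \<epsilon>) ^ n) \<and>
    ergodic_chain (borel_on H) kernel \<pi>"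
proof (intro exI[of _ stationary] conjI allI impI)
  show "invariant_distribution (borel_on H) kernel stationary"
    using invariant_stationary unfolding invariant_distribution_gauss .
  show "\<pi>' = stationary" if "invariant_distribution (borel_on H) kernel \<pi>'" for \<pi>'
    using that unfolding invariant_distribution_gauss[symmetric] by (rule stationary_unique)
  show "ergodic_chain (borel_on H) kernel stationary"
    using ergodic_stationary unfolding ergodic_chain_gauss .
  show "\<exists>\<epsilon>>0. \<forall>u\<in>H. \<forall>n. tv_dist (n_step (borel_on H) kernel n u) stationary \<le> (1 - \<epsilon>) ^ n"
  proof (intro exI[of _ minorization] conjI ballI allI minorization(2))
    fix u n assume "u \<in> H"
    then show "tv_dist (n_step (borel_on H) kernel n u) stationary \<le> (1 - minorization) ^ n"
      using n_step_tv(1)[of u n] by (simp add: n_step_gauss)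
  qed
qed

end

theorem theorem14:
  fixes D :: "(real ^ 'd) set"
    and C_minus :: "(real ^ 'd) L2 \<Rightarrow> (real ^ 'd) L2"
    and lam :: "nat \<Rightarrow> real" and r :: real
    and F :: "real \<Rightarrow> real" and F_plus :: real
  assumes "D \<in> sets lebesgue"
    and "symmetric_positive_operator (L2_on D) C_minus"
    and "has_eigenvalues (L2_on D) C_minus (\<lambda>j. (lam j)\<^sup>2)"
    and "r > 1"
    and "comparable (\<lambda>j. (lam j)\<^sup>2) (\<lambda>j. real j powr (- r))"
    and "continuous_on UNIV F"
    and "F_plus \<ge> 0"
    and "\<And>x. 0 \<le> F x \<and> F x \<le> F_plus"
  shows "\<exists>\<pi>. invariant_distribution (borel_on (L2_on D)) (transition_kernel D C_minus F) \<pi> \<and>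
      (\<forall>\<pi>'. invariant_distribution (borel_on (L2_on D)) (transition_kernel D C_minus F) \<pi>' \<longrightarrow> \<pi>' = \<pi>) \<and>
      (\<exists>\<epsilon>>0. \<forall>u\<^sub>0\<in>L2_on D. \<forall>n.
         tv_dist (n_step (borel_on (L2_on D)) (transition_kernel D C_minus F) n u\<^sub>0) \<pi> \<le> (1 - \<epsilon>) ^ n) \<and>
      ergodic_chain (borel_on (L2_on D)) (transition_kernel D C_minus F) \<pi>"
proof -
  let ?H = "L2_on D"
  interpret F: bounded_multiplier F F_plus
    using assms by unfold_locales auto
  obtain e where e: "\<And>j. j \<ge> 1 \<Longrightarrow> e j \<in> ?H \<and> C_minus (e j) = (lam j)\<^sup>2 *\<^sub>R e j"
      "\<And>i j. i \<ge> 1 \<Longrightarrow> j \<ge> 1 \<Longrightarrow> inner (e i) (e j) = (if i = j then 1 else 0)"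
      "?H = closure (span (e ` {1..}))"
    using assms(3) unfolding has_eigenvalues_def by blast
  \<comment> \<open>Eigenvalues are numbered from 1, the basis from 0.\<close>
  define b where "b j = e (Suc j)" for j
  define \<mu> where "\<mu> j = (lam (Suc j))\<^sup>2" for j
  have range_b: "range b = e ` {1..}"
  proof -
    have "range b = e ` range Suc" by (auto simp: b_def)
    also have "range Suc = {1..}" by (auto simp: image_iff Suc_le_eq gr0_conv_Suc)
    finally show ?thesis .
  qed
  \<comment> \<open>The upper comparison gives the trace-class condition, as \<open>r > 1\<close>;
    the lower one gives strictly positive eigenvalues and hence injectivity.\<close>
  obtain c1 c2 where c: "0 < c1" "\<And>j. j \<ge> 1 \<Longrightarrow> c1 * real j powr (- r) \<le> (lam j)\<^sup>2"
      "\<And>j. j \<ge> 1 \<Longrightarrow> (lam j)\<^sup>2 \<le> c2 * real j powr (- r)"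
    using assms(5) unfolding comparable_def by blast
  have "summable (\<lambda>j. c2 * real (Suc j) powr (- r))"
    using assms(4) summable_real_powr_iff[of "- r"]
    by (intro summable_mult) (subst summable_Suc_iff, simp)
  moreover have "norm (\<mu> j) \<le> c2 * real (Suc j) powr (- r)" for j
    using c(3)[of "Suc j"] by (simp add: \<mu>_def)
  ultimately have \<mu>_summable: "summable \<mu>"
    by (rule summable_comparison_test'[of _ 0])
  have \<mu>_pos: "0 < \<mu> j" for j
  proof -
    have "0 < c1 * real (Suc j) powr (- r)" using c(1) by simp
    also have "\<dots> \<le> \<mu> j" unfolding \<mu>_def by (rule c(2)) simp
    finally show ?thesis .
  qed
  have complete: "Topological_Spaces.complete ?H"
    by (rule complete_closed_subset[OF _ subset_UNIV complete_L2]) (simp add: e(3))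
  note C = assms(2)[unfolded symmetric_positive_operator_def]
  interpret diagonal_covariance ?H b C_minus \<mu>
  proof
    show "inner (b i) (b j) = (if i = j then 1 else 0)" for i j by (simp add: b_def e(2))
    show "?H = closure (span (range b))" unfolding range_b by (rule e(3))
    show "C_minus (b j) = \<mu> j *\<^sub>R b j" for j by (simp add: b_def \<mu>_def e(1))
  qed (use complete \<mu>_pos \<mu>_summable C in auto)
  \<comment> \<open>The parameter \<open>\<kappa>\<close> is the midpoint of the range allowed for
    \<open>F\<close>.\<close>
  have "perturbed_gaussian ?H b C_minus \<mu> (mult_op F u) (F_plus / 2)" for u
    by unfold_locales
      (rule F.mult_op_in_L2_on F.mult_op_add F.mult_op_scale F.mult_op_symmetric
        F.mult_op_nonneg F.mult_op_shift_bound | use assms(7) in simp)+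
  then interpret gaussian_kernel ?H b C_minus \<mu> "mult_op F" "F_plus / 2"
    by (intro gaussian_kernel.intro diagonal_covariance_axioms gaussian_kernel_axioms.intro
        measurable_restrict_space1 F.inner_mult_op_measurable)
  have "kernel = transition_kernel D C_minus F"
    by (rule ext) (simp add: kernel_def transition_kernel_def)
  then show ?thesis using geometric_ergodicity by simp
qed

end
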